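(* Let $K$ be a field, $S'=K[x_1,\ldots,x_{n-1}]$ and $S=K[x_1,\ldots,x_n]$. Suppose that $\operatorname{sdepth}_{S'} V/U\geq \operatorname{depth}_{S'} V/U$ for all square free monomial ideals $U\subset V$ of $S'$. Then $\operatorname{sdepth}_S I\geq \operatorname{depth}_S I$ for every square free monomial ideal $I\subset S$.
   Context: Let $R=K[x_1,\ldots,x_m]$ be a polynomial ring over a field $K$ and let $M$ be a finitely generated $\mathbb{Z}^m$-graded $R$-module. For a homogeneous element $u\in M$ and a subset $Z\subseteq\{x_1,\ldots,x_m\}$, let $uK[Z]\subset M$ be the $K$-linear subspace of all elements $uf$ with $f\in K[Z]$. It is called a Stanley space of dimension $|Z|$ if $uK[Z]$ is a free $K[Z]$-module. A Stanley decomposition of $M$ is a presentation of the $K$-vector space $M$ as a finite direct sum of Stanley spaces $\mathcal{D}:\ M=\bigoplus_{i=1}^r u_iK[Z_i]$. Put $\operatorname{sdepth}\mathcal{D}=\min\{|Z_i| : i=1,\ldots,r\}$. The Stanley depth is $\operatorname{sdepth}_R M=\max\{\operatorname{sdepth}\mathcal{D} : \mathcal{D}\text{ is a Stanley decomposition of }M\}$. The symbol $\operatorname{depth}_R M$ denotes the usual depth with respect to the graded maximal ideal $(x_1,\ldots,x_m)$. For the zero module, depth and Stanley depth are $\infty$ by convention. A square free monomial ideal is an ideal generated by square free monomials. *)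

theory Defs
  imports "HOL-Algebra.Module" "HOL-Algebra.Ideal" "HOL-Library.Poly_Mapping" "HOL-Library.Extended_Nat"
begin

text \<open>A monomial is a finitely supported exponent vector \<open>nat \<Rightarrow>\<^sub>0 nat\<close>; the type below is
  the polynomial ring in the variables \<open>x\<^sub>i\<close>, \<open>i :: nat\<close>, and \<open>poly_ring X\<close> is its
  subring \<open>K[x\<^sub>i | i \<in> X]\<close>.\<close>

type_synonym 'k mpoly = "(nat \<Rightarrow>\<^sub>0 nat) \<Rightarrow>\<^sub>0 'k"

definition monomial :: "(nat \<Rightarrow>\<^sub>0 nat) \<Rightarrow> 'k::field mpoly" where
  "monomial t = Poly_Mapping.single t 1"

definition indet :: "nat \<Rightarrow> 'k::field mpoly" where
  "indet i = monomial (Poly_Mapping.single i 1)"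

definition poly_ring :: "nat set \<Rightarrow> 'k::field mpoly ring" where
  "poly_ring X =
     \<lparr>carrier = {p. \<forall>t\<in>Poly_Mapping.keys p. Poly_Mapping.keys t \<subseteq> X},
      monoid.mult = (*), one = 1, zero = 0, add = (+)\<rparr>"

definition graded_maximal_ideal :: "nat set \<Rightarrow> 'k::field mpoly set" where
  "graded_maximal_ideal X = Idl\<^bsub>poly_ring X\<^esub> (indet ` X)"

definition squarefree_monomial_ideal :: "nat set \<Rightarrow> 'k::field mpoly set \<Rightarrow> bool" where
  "squarefree_monomial_ideal X I \<longleftrightarrow>
     (\<exists>T. (\<forall>t\<in>T. Poly_Mapping.keys t \<subseteq> X \<and> (\<forall>i. Poly_Mapping.lookup t i \<le> 1)) \<and>
          I = Idl\<^bsub>poly_ring X\<^esub> (monomial ` T))"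

text \<open>The fields \<open>mult\<close> and \<open>one\<close> of a module record carry no meaning for the module
  structure; they are filled arbitrarily below.\<close>

definition ideal_module :: "'a ring \<Rightarrow> 'a set \<Rightarrow> ('a, 'a) module" where
  "ideal_module R I =
     \<lparr>carrier = I, monoid.mult = monoid.mult R, one = one R, zero = zero R, add = add R,
      smult = monoid.mult R\<rparr>"

definition quot_module :: "('a, 'b) module \<Rightarrow> 'b set \<Rightarrow> ('a, 'b set) module" where
  "quot_module M N =
     \<lparr>carrier = a_rcosets\<^bsub>M\<^esub> N, monoid.mult = undefined, one = undefined,
      zero = N, add = set_add M,
      smult = (\<lambda>r C. \<Union>x\<in>C. N +>\<^bsub>M\<^esub> (r \<odot>\<^bsub>M\<^esub> x))\<rparr>"

text \<open>\<open>seq_submodule M [f\<^sub>1,\<dots>,f\<^sub>k]\<close> is the submodule \<open>(f\<^sub>1,\<dots>,f\<^sub>k)M\<close>.\<close>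

definition seq_submodule :: "('a, 'b) module \<Rightarrow> 'a list \<Rightarrow> 'b set" where
  "seq_submodule M fs =
     {finsum M (\<lambda>i. (fs ! i) \<odot>\<^bsub>M\<^esub> m i) {..<length fs} | m. m \<in> {..<length fs} \<rightarrow> carrier M}"

definition nonzerodivisor_on :: "('a, 'b) module \<Rightarrow> 'a \<Rightarrow> bool" where
  "nonzerodivisor_on M f \<longleftrightarrow> (\<forall>x\<in>carrier M. f \<odot>\<^bsub>M\<^esub> x = \<zero>\<^bsub>M\<^esub> \<longrightarrow> x = \<zero>\<^bsub>M\<^esub>)"

definition regular_sequence :: "('a, 'b) module \<Rightarrow> 'a list \<Rightarrow> bool" where
  "regular_sequence M fs \<longleftrightarrow>
     (\<forall>i<length fs. nonzerodivisor_on (quot_module M (seq_submodule M (take i fs))) (fs ! i)) \<and>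
     seq_submodule M fs \<noteq> carrier M"

definition depth_wrt :: "'a set \<Rightarrow> ('a, 'b) module \<Rightarrow> enat" where
  "depth_wrt I M =
     (if carrier M = {\<zero>\<^bsub>M\<^esub>} then \<infinity>
      else Sup {enat (length fs) | fs. set fs \<subseteq> I \<and> regular_sequence M fs})"

definition depth :: "nat set \<Rightarrow> ('k::field mpoly, 'b) module \<Rightarrow> enat" where
  "depth X M = depth_wrt (graded_maximal_ideal X) M"

text \<open>A multigrading of a module assigns to every degree its graded component.
  Degrees are functions \<open>nat \<Rightarrow> int\<close>; for the modules below, components in degrees not
  supported on the variables (or with a negative entry) are zero.\<close>

definition ideal_grading :: "'k::field mpoly set \<Rightarrow> (nat \<Rightarrow> int) \<Rightarrow> 'k mpoly set" where
  "ideal_grading I a =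
     {p \<in> I. \<forall>t\<in>Poly_Mapping.keys p. \<forall>i. int (Poly_Mapping.lookup t i) = a i}"

definition quot_grading ::
    "('a, 'b) module \<Rightarrow> 'b set \<Rightarrow> ((nat \<Rightarrow> int) \<Rightarrow> 'b set) \<Rightarrow> (nat \<Rightarrow> int) \<Rightarrow> 'b set set" where
  "quot_grading M N G a = (\<lambda>x. N +>\<^bsub>M\<^esub> x) ` G a"

definition free_module :: "'a ring \<Rightarrow> ('a, 'b) module \<Rightarrow> bool" where
  "free_module R M \<longleftrightarrow>
     (\<exists>B\<subseteq>carrier M. \<forall>x\<in>carrier M. \<exists>!c.
        c ` B \<subseteq> carrier R \<and> (\<forall>b. b \<notin> B \<longrightarrow> c b = \<zero>\<^bsub>R\<^esub>) \<and> finite {b. c b \<noteq> \<zero>\<^bsub>R\<^esub>} \<and>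
        x = finsum M (\<lambda>b. c b \<odot>\<^bsub>M\<^esub> b) {b. c b \<noteq> \<zero>\<^bsub>R\<^esub>})"

text \<open>\<open>cyclic_space M u Z\<close> is \<open>u K[Z]\<close>.\<close>

definition cyclic_space :: "('k::field mpoly, 'b) module \<Rightarrow> 'b \<Rightarrow> nat set \<Rightarrow> 'b set" where
  "cyclic_space M u Z = {f \<odot>\<^bsub>M\<^esub> u | f. f \<in> carrier (poly_ring Z)}"

definition is_stanley_space ::
    "nat set \<Rightarrow> ('k::field mpoly, 'b) module \<Rightarrow> ((nat \<Rightarrow> int) \<Rightarrow> 'b set) \<Rightarrow> 'b \<Rightarrow> nat set \<Rightarrow> bool"
  where
  "is_stanley_space X M G u Z \<longleftrightarrow>
     (\<exists>a. u \<in> G a) \<and> Z \<subseteq> X \<and> free_module (poly_ring Z) (M\<lparr>carrier := cyclic_space M u Z\<rparr>)"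

definition stanley_decomposition ::
    "nat set \<Rightarrow> ('k::field mpoly, 'b) module \<Rightarrow> ((nat \<Rightarrow> int) \<Rightarrow> 'b set) \<Rightarrow> ('b \<times> nat set) list \<Rightarrow> bool"
  where
  "stanley_decomposition X M G D \<longleftrightarrow>
     (\<forall>(u, Z)\<in>set D. is_stanley_space X M G u Z) \<and>
     (\<forall>x\<in>carrier M. \<exists>!v.
        v \<in> (\<Pi>\<^sub>E i\<in>{..<length D}. cyclic_space M (fst (D ! i)) (snd (D ! i))) \<and>
        x = finsum M v {..<length D})"

definition sdepth_of_decomposition :: "('b \<times> nat set) list \<Rightarrow> enat" where
  "sdepth_of_decomposition D = (INF (u, Z)\<in>set D. enat (card Z))"

text \<open>The supremum is over a set bounded by \<open>card X\<close> if the module is nonzero, hence a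
  maximum whenever a Stanley decomposition exists.\<close>

definition sdepth ::
    "nat set \<Rightarrow> ('k::field mpoly, 'b) module \<Rightarrow> ((nat \<Rightarrow> int) \<Rightarrow> 'b set) \<Rightarrow> enat" where
  "sdepth X M G =
     (if carrier M = {\<zero>\<^bsub>M\<^esub>} then \<infinity>
      else Sup {sdepth_of_decomposition D | D. stanley_decomposition X M G D})"

definition depth_ideal :: "nat set \<Rightarrow> 'k::field mpoly set \<Rightarrow> enat" where
  "depth_ideal X I = depth X (ideal_module (poly_ring X) I)"

definition sdepth_ideal :: "nat set \<Rightarrow> 'k::field mpoly set \<Rightarrow> enat" where
  "sdepth_ideal X I = sdepth X (ideal_module (poly_ring X) I) (ideal_grading I)"

definition depth_quot :: "nat set \<Rightarrow> 'k::field mpoly set \<Rightarrow> 'k mpoly set \<Rightarrow> enat" where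
  "depth_quot X V U = depth X (quot_module (ideal_module (poly_ring X) V) U)"

definition sdepth_quot :: "nat set \<Rightarrow> 'k::field mpoly set \<Rightarrow> 'k mpoly set \<Rightarrow> enat" where
  "sdepth_quot X V U =
     sdepth X (quot_module (ideal_module (poly_ring X) V) U)
       (quot_grading (ideal_module (poly_ring X) V) U (ideal_grading V))"

end

theory Submission
  imports Defs
begin

text \<open>Let \<open>I\<close> be a squarefree monomial ideal of \<open>S = S'[x\<^sub>n]\<close>, and put \<open>U = I \<inter> S'\<close> and
  \<open>V = (I : x\<^sub>n) \<inter> S'\<close>, so that \<open>U \<subseteq> V\<close> are squarefree monomial ideals of \<open>S'\<close>. Since \<open>I\<close> is
  squarefree, a monomial \<open>s x\<^sub>n\<^sup>j\<close> with \<open>s \<in> S'\<close> lies in \<open>I\<close> iff \<open>s \<in> U\<close> (for \<open>j = 0\<close>) or \<open>s \<in> V\<close>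
  (for \<open>j > 0\<close>). This has two consequences.

  On the side of depth, \<open>I / x\<^sub>n I\<close> has only the components \<open>U\<close> in \<open>x\<^sub>n\<close>-degree \<open>0\<close> and \<open>V/U\<close> in
  \<open>x\<^sub>n\<close>-degree \<open>1\<close>; hence \<open>depth I = 1 + depth (I / x\<^sub>n I) \<le> 1 + min (depth U) (depth V/U)\<close>, as
  \<open>x\<^sub>n\<close> is regular on \<open>I\<close>. On the side of Stanley depth, \<open>I = U[x\<^sub>n] \<oplus> x\<^sub>n (V/U)[x\<^sub>n]\<close> as vector
  spaces, so Stanley decompositions of \<open>U\<close> and of \<open>V/U\<close> combine to one of \<open>I\<close> in which every
  dimension has grown by one: \<open>sdepth I \<ge> 1 + min (sdepth U) (sdepth V/U)\<close>. The hypothesis,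
  applied to \<open>0 \<subseteq> U\<close> and to \<open>U \<subseteq> V\<close>, closes the gap.

  The first inequality (\<open>depth_slices_ge\<close>) starts from an arbitrary regular sequence on \<open>I\<close>, which
  need not be homogeneous nor begin with \<open>x\<^sub>n\<close>, and has to produce a regular sequence on
  \<open>I / x\<^sub>n I\<close> that is shorter by one. This is Rees' theorem that maximal regular sequences have
  equal length. The proof follows Kaplansky: a regular sequence is maximal iff the quotient by it
  has an element \<open>\<noteq> 0\<close> killed by the maximal ideal, and that property does not depend on the
  sequence (\<open>socle_independent\<close>, from \<open>socle_exchange\<close> and \<open>common_regular_element\<close>). It rests on
  Hilbert's basis theorem, finiteness of the set of maximal annihilators, and prime avoidance.
  Reducing the new sequence modulo \<open>x\<^sub>n\<close> and taking components of \<open>x\<^sub>n\<close>-degree \<open>0\<close> and \<open>1\<close> gives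
  sequences on \<open>U\<close> and \<open>V/U\<close> (\<open>split_regular_seq\<close>).

  For the second inequality Stanley decompositions of \<open>V/U\<close> are turned into partitions of the
  monomials of \<open>V\<close> outside \<open>U\<close> into cones \<open>t \<cdot> Mon(K[Z])\<close>
  (\<open>cone_partition_of_stanley_decomposition\<close>), partitions for \<open>U\<close> and \<open>V/U\<close> are merged
  (\<open>combine_cone_partitions\<close>), and the result is read as a Stanley decomposition of \<open>I\<close>
  (\<open>stanley_decomposition_of_cones\<close>).\<close>

abbreviation lookup :: "('a \<Rightarrow>\<^sub>0 'b::zero) \<Rightarrow> 'a \<Rightarrow> 'b" where
  "lookup \<equiv> Poly_Mapping.lookup"

abbreviation keys :: "('a \<Rightarrow>\<^sub>0 'b::zero) \<Rightarrow> 'a set" where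
  "keys \<equiv> Poly_Mapping.keys"

abbreviation single :: "'a \<Rightarrow> 'b \<Rightarrow> 'a \<Rightarrow>\<^sub>0 'b::zero" where
  "single \<equiv> Poly_Mapping.single"

section \<open>Regular sequences over a Noetherian ring\<close>

text \<open>All modules of this section are quotients \<open>M/N\<close> of two ideals of a ring \<open>P\<close>, which is itself a
  subring of the ring formed by a type. Such a quotient is represented by the pair of sets \<open>M, N\<close>, so
  that no cosets occur: \<open>(M/N) / f(M/N)\<close> is \<open>M/(N + fM)\<close>, and along a sequence of elements only
  the denominator \<open>N\<close> grows. The denominator \<open>N + fM\<close> is \<open>extend M N f\<close>.\<close>

definition ideal_in :: "'a::comm_ring_1 set \<Rightarrow> 'a set \<Rightarrow> bool" where
  "ideal_in P A \<longleftrightarrow>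
     A \<subseteq> P \<and> 0 \<in> A \<and> (\<forall>a\<in>A. \<forall>b\<in>A. a + b \<in> A) \<and> (\<forall>r\<in>P. \<forall>a\<in>A. r * a \<in> A)"

definition extend :: "'a::comm_ring_1 set \<Rightarrow> 'a set \<Rightarrow> 'a \<Rightarrow> 'a set" where
  "extend M N f = {a + f * x | a x. a \<in> N \<and> x \<in> M}"

definition regular_on :: "'a::comm_ring_1 set \<Rightarrow> 'a set \<Rightarrow> 'a \<Rightarrow> bool" where
  "regular_on M N f \<longleftrightarrow> (\<forall>x\<in>M. f * x \<in> N \<longrightarrow> x \<in> N)"

fun extends :: "'a::comm_ring_1 set \<Rightarrow> 'a set \<Rightarrow> 'a list \<Rightarrow> 'a set" where
  "extends M N [] = N"
| "extends M N (f # fs) = extends M (extend M N f) fs"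

text \<open>The last quotient is allowed to vanish. In that case every element is regular on it and its
  socle is zero, which agrees with the reading of the socle as an obstruction to prolonging the
  sequence.\<close>

fun regular_seq :: "'a::comm_ring_1 set \<Rightarrow> 'a set \<Rightarrow> 'a list \<Rightarrow> bool" where
  "regular_seq M N [] \<longleftrightarrow> True"
| "regular_seq M N (f # fs) \<longleftrightarrow> regular_on M N f \<and> regular_seq M (extend M N f) fs"

text \<open>The denominators met along the sequence, including the first and the last one. A single
  element regular on all these quotients can be moved to the front of the sequence.\<close>

fun stages :: "'a::comm_ring_1 set \<Rightarrow> 'a set \<Rightarrow> 'a list \<Rightarrow> 'a set set" where
  "stages M N [] = {N}"
| "stages M N (f # fs) = insert N (stages M (extend M N f) fs)"

text \<open>The socle of \<open>M/N\<close> with respect to \<open>m\<close>, that is \<open>Hom(P/m, M/N)\<close>, is nonzero. For a regular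
  sequence this detects, in the last quotient, that the sequence cannot be prolonged inside \<open>m\<close>.\<close>

definition has_socle :: "'a::comm_ring_1 set \<Rightarrow> 'a set \<Rightarrow> 'a set \<Rightarrow> bool" where
  "has_socle m M N \<longleftrightarrow> (\<exists>x\<in>M. x \<notin> N \<and> (\<forall>a\<in>m. a * x \<in> N))"

definition colon :: "'a::comm_ring_1 set \<Rightarrow> 'a set \<Rightarrow> 'a \<Rightarrow> 'a set" where
  "colon P K x = {a \<in> P. a * x \<in> K}"

definition prime_in :: "'a::comm_ring_1 set \<Rightarrow> 'a set \<Rightarrow> bool" where
  "prime_in P p \<longleftrightarrow>
     ideal_in P p \<and> 1 \<notin> p \<and> (\<forall>a\<in>P. \<forall>b\<in>P. a * b \<in> p \<longrightarrow> a \<in> p \<or> b \<in> p)"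

lemma extendI: "\<lbrakk>y = a + f * x; a \<in> N; x \<in> M\<rbrakk> \<Longrightarrow> y \<in> extend M N f"
  unfolding extend_def by blast

lemma extendE:
  assumes "y \<in> extend M N f"
  obtains a x where "y = a + f * x" "a \<in> N" "x \<in> M"
  using assms unfolding extend_def by blast

lemma extend_mono:
  assumes "0 \<in> M"
  shows "N \<subseteq> extend M N f"
proof
  fix a assume "a \<in> N"
  moreover have "a = a + f * 0" by simp
  ultimately show "a \<in> extend M N f" unfolding extend_def using assms by blast
qed

lemma extend_commute: "extend M (extend M N x) y = extend M (extend M N y) x"
proof -
  have "extend M (extend M N x) y \<subseteq> extend M (extend M N y) x" for x y
  proof
    fix a assume "a \<in> extend M (extend M N x) y"
    then obtain b u v where "a = (b + x * u) + y * v" "b \<in> N" "u \<in> M" "v \<in> M"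
      unfolding extend_def by blast
    moreover from this have "a = (b + y * v) + x * u" by (simp add: add.commute add.left_commute)
    ultimately show "a \<in> extend M (extend M N y) x" unfolding extend_def by blast
  qed
  then show ?thesis by blast
qed

lemma extends_extend: "extends M (extend M N z) xs = extend M (extends M N xs) z"
  by (induction xs arbitrary: N) (auto simp: extend_commute)

lemma extends_append: "extends M N (xs @ ys) = extends M (extends M N xs) ys"
  by (induction xs arbitrary: N) auto

lemma regular_seq_append:
  "regular_seq M N (xs @ ys) \<longleftrightarrow> regular_seq M N xs \<and> regular_seq M (extends M N xs) ys"
  by (induction xs arbitrary: N) auto

lemma finite_stages: "finite (stages M N xs)"
  by (induction xs arbitrary: N) auto

lemma extends_in_stages: "extends M N xs \<in> stages M N xs"
  by (induction xs arbitrary: N) auto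

lemma regular_on_no_socle:
  assumes "regular_on M N f" "f \<in> m"
  shows "\<not> has_socle m M N"
  using assms unfolding regular_on_def has_socle_def by blast

lemma regular_seq_stages_no_socle:
  assumes "regular_seq M N (xs @ [x])" "set (xs @ [x]) \<subseteq> m" "K \<in> stages M N xs"
  shows "\<not> has_socle m M K"
  using assms
proof (induction xs arbitrary: N)
  case Nil
  then show ?case by (auto dest: regular_on_no_socle)
next
  case (Cons a xs)
  then show ?case by (auto dest: regular_on_no_socle)
qed

text \<open>The chain condition is stated with one coincidence \<open>A (Suc k) = A k\<close> only; applied to a
  strictly increasing chain this is already a contradiction.\<close>

locale noetherian_subring =
  fixes P :: "'a::comm_ring_1 set"
  assumes zero_mem: "0 \<in> P" and one_mem: "1 \<in> P"
    and add_mem: "\<lbrakk>a \<in> P; b \<in> P\<rbrakk> \<Longrightarrow> a + b \<in> P"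
    and mult_mem: "\<lbrakk>a \<in> P; b \<in> P\<rbrakk> \<Longrightarrow> a * b \<in> P"
    and uminus_mem: "a \<in> P \<Longrightarrow> - a \<in> P"
    and acc: "\<lbrakk>\<And>k::nat. ideal_in P (A k); \<And>k. A k \<subseteq> A (Suc k)\<rbrakk> \<Longrightarrow> \<exists>k. A (Suc k) = A k"
begin

lemma ideal_in_whole: "ideal_in P P"
  by (simp add: ideal_in_def zero_mem add_mem mult_mem)

lemma
  assumes "ideal_in P A"
  shows ideal_in_sub: "A \<subseteq> P"
    and ideal_in_zero: "0 \<in> A"
    and ideal_in_add: "\<lbrakk>a \<in> A; b \<in> A\<rbrakk> \<Longrightarrow> a + b \<in> A"
    and ideal_in_mult: "\<lbrakk>r \<in> P; a \<in> A\<rbrakk> \<Longrightarrow> r * a \<in> A"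
  using assms unfolding ideal_in_def by auto

lemma ideal_in_uminus: "\<lbrakk>ideal_in P A; a \<in> A\<rbrakk> \<Longrightarrow> - a \<in> A"
  using ideal_in_mult[of A "-1" a] one_mem uminus_mem by simp

lemma ideal_in_diff: "\<lbrakk>ideal_in P A; a \<in> A; b \<in> A\<rbrakk> \<Longrightarrow> a - b \<in> A"
  using ideal_in_add[of A a "-b"] ideal_in_uminus by simp

lemma extend_sub:
  assumes "N \<subseteq> M" "ideal_in P M" "f \<in> P"
  shows "extend M N f \<subseteq> M"
proof
  fix y assume "y \<in> extend M N f"
  then obtain a x where y: "y = a + f * x" "a \<in> N" "x \<in> M" by (rule extendE)
  have "a + f * x \<in> M"
    by (rule ideal_in_add[OF assms(2) _ ideal_in_mult[OF assms(2,3)]]) (use y assms in auto)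
  then show "y \<in> M" using y by simp
qed

lemma ideal_in_extend:
  assumes N: "ideal_in P N" and M: "ideal_in P M" and f: "f \<in> P"
  shows "ideal_in P (extend M N f)"
  unfolding ideal_in_def
proof (intro conjI ballI)
  show "extend M N f \<subseteq> P"
  proof
    fix y assume "y \<in> extend M N f"
    then obtain a x where y: "y = a + f * x" "a \<in> N" "x \<in> M" by (rule extendE)
    then have "a \<in> P" "x \<in> P" using ideal_in_sub[OF N] ideal_in_sub[OF M] by auto
    then show "y \<in> P" using y f by (simp add: add_mem mult_mem)
  qed
  show "0 \<in> extend M N f"
    using extend_mono[OF ideal_in_zero[OF M]] ideal_in_zero[OF N] by blast
next
  fix a b assume "a \<in> extend M N f" "b \<in> extend M N f"
  then obtain a' x b' y where *: "a = a' + f * x" "b = b' + f * y" "a' \<in> N" "b' \<in> N" "x \<in> M" "y \<in> M"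
    by (elim extendE)
  show "a + b \<in> extend M N f"
  proof (rule extendI)
    show "a + b = (a' + b') + f * (x + y)" using * by (simp add: algebra_simps)
  qed (use * ideal_in_add[OF N] ideal_in_add[OF M] in auto)
next
  fix r a assume r: "r \<in> P" and "a \<in> extend M N f"
  then obtain a' x where *: "a = a' + f * x" "a' \<in> N" "x \<in> M" by (elim extendE)
  show "r * a \<in> extend M N f"
  proof (rule extendI)
    show "r * a = r * a' + f * (r * x)" using * by (simp add: algebra_simps)
  qed (use * r ideal_in_mult[OF N] ideal_in_mult[OF M] in auto)
qed

lemma ideal_in_maximal:
  assumes "A \<in> \<A>" and ideals: "\<And>B. B \<in> \<A> \<Longrightarrow> ideal_in P B"
  shows "\<exists>B\<in>\<A>. A \<subseteq> B \<and> (\<forall>C\<in>\<A>. B \<subseteq> C \<longrightarrow> C = B)"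
proof (rule ccontr)
  assume neg: "\<not> ?thesis"
  define \<B> where "\<B> = {B \<in> \<A>. A \<subseteq> B}"
  have "\<exists>C. C \<in> \<B> \<and> B \<subset> C" if B: "B \<in> \<B>" for B
  proof -
    have "B \<in> \<A>" "A \<subseteq> B" using B by (auto simp: \<B>_def)
    with neg have "\<not> (\<forall>C\<in>\<A>. B \<subseteq> C \<longrightarrow> C = B)" by metis
    then obtain C where "C \<in> \<A>" "B \<subseteq> C" "C \<noteq> B" by metis
    then show ?thesis using \<open>A \<subseteq> B\<close> by (intro exI[of _ C]) (auto simp: \<B>_def)
  qed
  then obtain g where g: "\<And>B. B \<in> \<B> \<Longrightarrow> g B \<in> \<B>" "\<And>B. B \<in> \<B> \<Longrightarrow> B \<subset> g B"
    by metis
  have mem: "(g ^^ k) A \<in> \<B>" for k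
  proof (induction k)
    case 0
    show ?case using assms(1) by (simp add: \<B>_def)
  next
    case (Suc k)
    then show ?case using g(1) by simp
  qed
  have "\<exists>k. (g ^^ Suc k) A = (g ^^ k) A"
  proof (rule acc)
    show "ideal_in P ((g ^^ k) A)" for k
      using mem[of k] ideals unfolding \<B>_def by blast
    show "(g ^^ k) A \<subseteq> (g ^^ Suc k) A" for k
      using g(2)[OF mem[of k]] by auto
  qed
  then show False
    using g(2)[OF mem] by auto
qed

subsection \<open>Prime avoidance\<close>

lemma prime_avoids_intersection:
  assumes "finite J" and "prime_in P q"
    and "\<And>j. j \<in> J \<Longrightarrow> ideal_in P (p j)" "\<And>j. j \<in> J \<Longrightarrow> \<not> p j \<subseteq> q"
  shows "\<exists>b\<in>P. (\<forall>j\<in>J. b \<in> p j) \<and> b \<notin> q"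
  using assms(1,3,4)
proof (induction J rule: finite_induct)
  case empty
  then show ?case using assms(2) one_mem unfolding prime_in_def by auto
next
  case (insert j J)
  then obtain b where b: "b \<in> P" "\<forall>j\<in>J. b \<in> p j" "b \<notin> q" by blast
  obtain c where c: "c \<in> p j" "c \<notin> q" using insert.prems by blast
  have cP: "c \<in> P" using c insert.prems(1) ideal_in_sub by blast
  have "b * c \<notin> q" using b c cP assms(2) unfolding prime_in_def by blast
  moreover have "b * c \<in> p j'" if "j' \<in> insert j J" for j'
    using that b c cP ideal_in_mult insert.prems(1) by (metis insert_iff mult.commute)
  ultimately show ?case using b(1) cP mult_mem by blast
qed

text \<open>If one of the primes lies in another, the smaller one can be dropped. Otherwise the primes are
  incomparable: an element \<open>z\<close> that avoids all but \<open>q\<close> either avoids \<open>q\<close> as well or is corrected by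
  adding \<open>w\<close> which lies in \<open>m\<close> and in all the primes except \<open>q\<close>.\<close>

lemma prime_avoidance:
  assumes "finite F" "ideal_in P m"
    and "\<And>p. p \<in> F \<Longrightarrow> prime_in P p" "\<And>p. p \<in> F \<Longrightarrow> \<not> m \<subseteq> p"
  shows "\<exists>z\<in>m. \<forall>p\<in>F. z \<notin> p"
  using assms(1,3,4)
proof (induction "card F" arbitrary: F rule: less_induct)
  case less
  show ?case
  proof (cases "F = {}")
    case True
    then show ?thesis using assms(2) ideal_in_zero by blast
  next
    case False
    then obtain q where q: "q \<in> F" by blast
    have smaller: "\<exists>z\<in>m. \<forall>p\<in>F - {r}. z \<notin> p" if "r \<in> F" for r
      by (rule less.hyps) (use less.prems that in \<open>auto intro!: diff_less simp: card_gt_0_iff\<close>)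
    show ?thesis
    proof (cases "\<exists>r\<in>F. r \<noteq> q \<and> r \<subseteq> q")
      case True
      then obtain r where r: "r \<in> F" "r \<noteq> q" "r \<subseteq> q" by blast
      then show ?thesis using smaller[OF r(1)] q by blast
    next
      case False
      from smaller[OF q] obtain z where z: "z \<in> m" "\<forall>p\<in>F - {q}. z \<notin> p" by blast
      \<comment> \<open>An element of \<open>m\<close> and of all primes but \<open>q\<close>, to be added if \<open>z \<in> q\<close>.\<close>
      have "\<exists>b\<in>P. (\<forall>j\<in>insert m (F - {q}). b \<in> j) \<and> b \<notin> q"
      proof (rule prime_avoids_intersection[of _ q "\<lambda>j. j"])
        show "ideal_in P j" if "j \<in> insert m (F - {q})" for j
          using that less.prems(2) assms(2) by (auto simp: prime_in_def)
        show "\<not> j \<subseteq> q" if "j \<in> insert m (F - {q})" for j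
          using that less.prems(3) q False by auto
      qed (use less.prems q in auto)
      then obtain w where w: "w \<in> m" "\<forall>p\<in>F - {q}. w \<in> p" "w \<notin> q" by blast
      show ?thesis
      proof (cases "z \<in> q")
        case False
        then show ?thesis using z by blast
      next
        case True
        have "z + w \<notin> p" if "p \<in> F" for p
        proof -
          have p: "ideal_in P p" using that less.prems(2) prime_in_def by blast
          show ?thesis
          proof (cases "p = q")
            case True
            then show ?thesis
              using ideal_in_diff[OF p, of "z + w" z] w \<open>z \<in> q\<close> by auto
          next
            case False
            then show ?thesis
              using ideal_in_diff[OF p, of "z + w" w] w z that by auto
          qed
        qed
        then show ?thesis using ideal_in_add[OF assms(2) z(1) w(1)] by blast
      qed
    qed
  qed
qed

subsection \<open>Associated primes\<close>

lemma ideal_in_colon: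
  assumes "ideal_in P K"
  shows "ideal_in P (colon P K x)"
  using assms zero_mem add_mem mult_mem
  unfolding ideal_in_def colon_def by (auto simp: distrib_right mult.assoc)

text \<open>The maximal ones among the annihilators of nonzero elements of \<open>M/K\<close>. They are associated
  primes, and their union is the set of zero divisors of \<open>M/K\<close>.\<close>

definition max_colons :: "'a set \<Rightarrow> 'a set \<Rightarrow> 'a set set" where
  "max_colons M K = {p. (\<exists>x\<in>M - K. p = colon P K x) \<and>
     (\<forall>y\<in>M - K. p \<subseteq> colon P K y \<longrightarrow> colon P K y = p)}"

text \<open>If \<open>ab\<close> kills \<open>x\<close> and \<open>b\<close> does not, then the annihilator of \<open>b x\<close> contains that of \<open>x\<close>, so
  they agree by maximality, and \<open>a\<close> belongs to the former.\<close>

lemma max_colons_prime: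
  assumes K: "ideal_in P K" and M: "ideal_in P M" and p: "p \<in> max_colons M K"
  shows "prime_in P p"
proof -
  obtain x where x: "x \<in> M" "x \<notin> K" "p = colon P K x"
    and mx: "\<And>y. y \<in> M - K \<Longrightarrow> p \<subseteq> colon P K y \<Longrightarrow> colon P K y = p"
    using p unfolding max_colons_def by blast
  have "a \<in> p \<or> b \<in> p" if ab: "a \<in> P" "b \<in> P" "a * b \<in> p" for a b
  proof (rule disjCI)
    assume "b \<notin> p"
    then have "b * x \<in> M - K" using ab x ideal_in_mult M by (auto simp: colon_def)
    moreover have "p \<subseteq> colon P K (b * x)"
      using x(3) ab(2) ideal_in_mult[OF K] unfolding colon_def
      by (auto simp: mult.left_commute[of _ b x])
    ultimately have "colon P K (b * x) = p" by (rule mx)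
    moreover have "a \<in> colon P K (b * x)" using ab x(3) by (simp add: colon_def mult.assoc)
    ultimately show "a \<in> p" by simp
  qed
  moreover have "1 \<notin> p" using x by (simp add: colon_def)
  ultimately show ?thesis using ideal_in_colon[OF K] x(3) unfolding prime_in_def by blast
qed

lemma zero_divisor_in_max_colon:
  assumes K: "ideal_in P K" and z: "z \<in> P" "\<not> regular_on M K z"
  shows "\<exists>p\<in>max_colons M K. z \<in> p"
proof -
  obtain x where x: "x \<in> M - K" "z * x \<in> K" using z unfolding regular_on_def by blast
  have "\<exists>B\<in>colon P K ` (M - K). colon P K x \<subseteq> B \<and> (\<forall>C\<in>colon P K ` (M - K). B \<subseteq> C \<longrightarrow> C = B)"
    by (rule ideal_in_maximal) (use x K ideal_in_colon in auto)
  then obtain y where y: "y \<in> M - K" "colon P K x \<subseteq> colon P K y"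
      "\<And>w. w \<in> M - K \<Longrightarrow> colon P K y \<subseteq> colon P K w \<Longrightarrow> colon P K w = colon P K y"
    by auto
  have "colon P K y \<in> max_colons M K" unfolding max_colons_def using y(1,3) by auto
  moreover have "z \<in> colon P K y" using y(2) z x by (auto simp: colon_def)
  ultimately show ?thesis by (rule bexI[rotated])
qed

text \<open>Suppose that \<open>x 0, x 1, \<dots>\<close> have pairwise distinct maximal annihilators. The modules generated
  by \<open>K, x 0, \<dots>, x (k - 1)\<close> become stationary, so some \<open>x k\<close> is a combination of its predecessors
  and is killed by whatever kills all of these. As the annihilator of \<open>x k\<close> is prime, it contains
  one of theirs, contradicting maximality.\<close>

lemma finite_max_colons:
  assumes K: "ideal_in P K" and M: "ideal_in P M"
  shows "finite (max_colons M K)"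
proof (rule ccontr)
  assume "infinite (max_colons M K)"
  then obtain p :: "nat \<Rightarrow> 'a set" where p: "inj p" "range p \<subseteq> max_colons M K"
    using infinite_countable_subset[of "max_colons M K"] by auto
  have "\<exists>x. x \<in> M - K \<and> p k = colon P K x" for k
  proof -
    have "p k \<in> max_colons M K" using p(2) by auto
    then show ?thesis unfolding max_colons_def mem_Collect_eq Bex_def by (rule conjunct1)
  qed
  then have "\<exists>x. \<forall>k. x k \<in> M - K \<and> p k = colon P K (x k)" by (intro choice allI)
  then obtain x where x: "\<And>k. x k \<in> M - K" "\<And>k. p k = colon P K (x k)" by auto
  have incomparable: "\<not> p j \<subseteq> p k" if "j \<noteq> k" for j k
  proof
    assume "p j \<subseteq> p k"
    moreover have "p j \<in> max_colons M K" using p by blast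
    ultimately have "p k = p j" unfolding max_colons_def mem_Collect_eq x(2)[of k] using x(1)[of k] by metis
    then show False using p(1) that by (auto dest: injD)
  qed
  define A where "A = rec_nat K (\<lambda>k B. extend P B (x k))"
  have A: "A 0 = K" "A (Suc k) = extend P (A k) (x k)" for k
    by (simp_all add: A_def)
  have xP: "x k \<in> P" for k using x(1)[of k] ideal_in_sub[OF M] by blast
  have idA: "ideal_in P (A k)" for k
    by (induction k) (simp_all add: A K ideal_in_extend ideal_in_whole xP)
  have "\<exists>k. A (Suc k) = A k"
  proof (rule acc)
    show "A k \<subseteq> A (Suc k)" for k using extend_mono[OF zero_mem] A(2) by metis
  qed (rule idA)
  then obtain k where k: "A (Suc k) = A k" by blast
  \<comment> \<open>Stationarity means that \<open>x k\<close> is already generated by its predecessors.\<close>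
  have "0 + x k * 1 \<in> extend P (A k) (x k)"
    by (rule extendI[OF refl ideal_in_zero[OF idA] one_mem])
  then have xk: "x k \<in> A k" using k A(2)[of k] by simp
  have kills: "b * w \<in> K" if "w \<in> A i" "b \<in> P" "\<forall>j\<in>{..<i}. b \<in> p j" for i w b
    using that
  proof (induction i arbitrary: w)
    case 0
    then show ?case using ideal_in_mult[OF K] by (simp add: A(1))
  next
    case (Suc i)
    from Suc.prems(1) obtain a r where w: "w = a + x i * r" "a \<in> A i" "r \<in> P"
      unfolding A(2) extend_def by blast
    have "b * a \<in> K" using Suc.IH[OF w(2)] Suc.prems(2,3) by simp
    have "b \<in> p i" using Suc.prems(3) by simp
    then have "b * x i \<in> K" unfolding x(2) colon_def by simp
    then have "r * (b * x i) \<in> K" by (rule ideal_in_mult[OF K w(3)])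
    with \<open>b * a \<in> K\<close> have "b * a + r * (b * x i) \<in> K" by (rule ideal_in_add[OF K])
    then show ?case using w(1) by (simp add: algebra_simps)
  qed
  have prime: "prime_in P (p j)" for j
    using max_colons_prime[OF K M] p(2) by blast
  have "\<exists>b\<in>P. (\<forall>j\<in>{..<k}. b \<in> p j) \<and> b \<notin> p k"
  proof (rule prime_avoids_intersection[OF _ prime])
    show "ideal_in P (p j)" for j using prime prime_in_def by blast
    show "\<not> p j \<subseteq> p k" if "j \<in> {..<k}" for j using incomparable that by simp
  qed simp
  then obtain b where b: "b \<in> P" "\<forall>j\<in>{..<k}. b \<in> p j" "b \<notin> p k" by blast
  have "b * x k \<in> K" using kills[OF xk b(1,2)] .
  then show False using b(1,3) x(2)[of k] by (simp add: colon_def)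
qed

text \<open>An ideal \<open>m\<close> consisting of zero divisors of \<open>M/K\<close> would lie in a maximal annihilator by prime
  avoidance, that is, kill a nonzero element. Prime avoidance works for all the
  modules \<open>M/K\<close> at once.\<close>

lemma common_regular_element:
  assumes "finite \<K>" and m: "ideal_in P m" and M: "ideal_in P M"
    and \<K>: "\<And>K. K \<in> \<K> \<Longrightarrow> ideal_in P K" "\<And>K. K \<in> \<K> \<Longrightarrow> \<not> has_socle m M K"
  shows "\<exists>z\<in>m. \<forall>K\<in>\<K>. regular_on M K z"
proof -
  have "\<exists>z\<in>m. \<forall>p\<in>(\<Union>K\<in>\<K>. max_colons M K). z \<notin> p"
  proof (rule prime_avoidance[OF _ m])
    show "finite (\<Union>K\<in>\<K>. max_colons M K)" using assms finite_max_colons by blast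
    show "prime_in P p" if "p \<in> (\<Union>K\<in>\<K>. max_colons M K)" for p
      using that \<K>(1) M max_colons_prime by blast
    show "\<not> m \<subseteq> p" if "p \<in> (\<Union>K\<in>\<K>. max_colons M K)" for p
    proof
      assume sub: "m \<subseteq> p"
      obtain K x where "K \<in> \<K>" "x \<in> M" "x \<notin> K" "p = colon P K x"
        using \<open>p \<in> _\<close> by (auto simp: max_colons_def)
      then show False using \<K>(2) sub unfolding has_socle_def colon_def by blast
    qed
  qed
  then obtain z where z: "z \<in> m" "\<And>K p. K \<in> \<K> \<Longrightarrow> p \<in> max_colons M K \<Longrightarrow> z \<notin> p" by blast
  moreover have "z \<in> P" using z(1) ideal_in_sub[OF m] by blast
  ultimately show ?thesis using zero_divisor_in_max_colon \<K>(1) by blast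
qed

subsection \<open>Exchange of regular elements\<close>

lemma ideal_in_stages:
  assumes "ideal_in P N" "ideal_in P M" "set xs \<subseteq> P" "K \<in> stages M N xs"
  shows "ideal_in P K"
  using assms by (induction xs arbitrary: N) (auto intro: ideal_in_extend)

text \<open>The two exchanged elements satisfy \<open>x u = a + z v\<close> with \<open>a \<in> N\<close>: regularity of \<open>z\<close> modulo \<open>x\<close>
  makes \<open>v\<close> divisible by \<open>x\<close>, and \<open>x\<close> can then be cancelled.\<close>

lemma regular_swap:
  assumes N: "ideal_in P N" and M: "ideal_in P M" and P: "x \<in> P" "z \<in> P"
    and "regular_on M N x" "regular_on M (extend M N x) z"
  shows "regular_on M (extend M N z) x"
  unfolding regular_on_def
proof (intro ballI impI)
  fix u assume u: "u \<in> M" "x * u \<in> extend M N z"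
  then obtain a v where v: "x * u = a + z * v" "a \<in> N" "v \<in> M" unfolding extend_def by blast
  have "z * v = - a + x * u" using v by simp
  then have "z * v \<in> extend M N x" using u v ideal_in_uminus[OF N] using extendI by blast
  then have "v \<in> extend M N x" using assms v unfolding regular_on_def by blast
  then obtain b w where w: "v = b + x * w" "b \<in> N" "w \<in> M" unfolding extend_def by blast
  have "x * (u - z * w) = a + z * b" using v w by (simp add: algebra_simps)
  moreover have "a + z * b \<in> N" using v w P by (intro ideal_in_add[OF N] ideal_in_mult[OF N]) auto
  moreover have "u - z * w \<in> M" using u w P by (intro ideal_in_diff[OF M] ideal_in_mult[OF M]) auto
  ultimately have "u - z * w \<in> N" using assms(5) unfolding regular_on_def by auto
  moreover have "u = (u - z * w) + z * w" by simp
  ultimately show "u \<in> extend M N z" using w extendI by metis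
qed

text \<open>Regular sequences cannot be permuted in general; it is the regularity of \<open>z\<close> at every stage
  that allows to put \<open>z\<close> in front.\<close>

lemma regular_seq_modulo:
  assumes "ideal_in P N" "ideal_in P M" "set xs \<subseteq> P" "z \<in> P"
    and "regular_seq M N xs" "\<forall>K\<in>stages M N xs. regular_on M K z"
  shows "regular_seq M (extend M N z) xs"
  using assms
proof (induction xs arbitrary: N)
  case Nil
  then show ?case by simp
next
  case (Cons x xs)
  have "extend M N x \<in> stages M (extend M N x) xs" by (cases xs) auto
  then have "regular_on M (extend M N x) z" using Cons.prems(6) by auto
  then have "regular_on M (extend M N z) x"
    by (rule regular_swap[OF Cons.prems(1,2), rotated -1]) (use Cons.prems in auto)
  moreover have "regular_seq M (extend M (extend M N x) z) xs"
  proof (rule Cons.IH[OF _ Cons.prems(2)])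
    show "ideal_in P (extend M N x)" using Cons.prems by (intro ideal_in_extend) auto
  qed (use Cons.prems in auto)
  ultimately show ?case by (simp add: extend_commute)
qed

text \<open>If \<open>u\<close> represents a socle element modulo \<open>x\<close> and \<open>y u = n + x v\<close>, then \<open>v\<close> represents one
  modulo \<open>y\<close>. Up to isomorphism both socles are \<open>Ext\<^sup>1(P/m, M/N)\<close>, which does not see the
  element divided out.\<close>

lemma socle_exchange:
  assumes N: "ideal_in P N" and M: "ideal_in P M" and m: "ideal_in P m"
    and x: "x \<in> m" "regular_on M N x" and y: "y \<in> m" "regular_on M N y"
    and soc: "has_socle m M (extend M N x)"
  shows "has_socle m M (extend M N y)"
proof -
  have P: "x \<in> P" "y \<in> P" using x y ideal_in_sub[OF m] by auto
  obtain u where u: "u \<in> M" "u \<notin> extend M N x" "\<And>a. a \<in> m \<Longrightarrow> a * u \<in> extend M N x"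
    using soc unfolding has_socle_def by blast
  obtain n v where v: "y * u = n + x * v" "n \<in> N" "v \<in> M"
    using u(3)[OF y(1)] unfolding extend_def by blast
  have "v \<notin> extend M N y"
  proof
    assume "v \<in> extend M N y"
    then obtain n' w where w: "v = n' + y * w" "n' \<in> N" "w \<in> M" unfolding extend_def by blast
    have "y * (u - x * w) = n + x * n'" using v w by (simp add: algebra_simps)
    moreover have "n + x * n' \<in> N" using v w P by (intro ideal_in_add[OF N] ideal_in_mult[OF N]) auto
    moreover have "u - x * w \<in> M" using u w P by (intro ideal_in_diff[OF M] ideal_in_mult[OF M]) auto
    ultimately have "u - x * w \<in> N" using y unfolding regular_on_def by auto
    moreover have "u = (u - x * w) + x * w" by simp
    ultimately show False using w u(2) extendI by metis
  qed
  \<comment> \<open>Multiply \<open>y u = n + x v\<close> by \<open>a\<close> and insert \<open>a u = n' + x w\<close>; then cancel \<open>x\<close>.\<close>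
  moreover have "a * v \<in> extend M N y" if a: "a \<in> m" for a
  proof -
    have aP: "a \<in> P" using a ideal_in_sub[OF m] by blast
    obtain n' w where w: "a * u = n' + x * w" "n' \<in> N" "w \<in> M"
      using u(3)[OF a] unfolding extend_def by blast
    have "x * (a * v) = a * (y * u) - a * n" using v by (simp add: algebra_simps)
    also have "\<dots> = y * (a * u) - a * n" by (simp add: algebra_simps)
    also have "\<dots> = y * n' + x * (y * w) - a * n" using w by (simp add: algebra_simps)
    finally have "x * (a * v - y * w) = y * n' - a * n" by (simp add: algebra_simps)
    moreover have "y * n' - a * n \<in> N" using v w P aP by (intro ideal_in_diff[OF N] ideal_in_mult[OF N]) auto
    moreover have "a * v - y * w \<in> M" using v w P aP by (intro ideal_in_diff[OF M] ideal_in_mult[OF M]) auto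
    ultimately have "a * v - y * w \<in> N" using x unfolding regular_on_def by auto
    moreover have "a * v = (a * v - y * w) + y * w" by simp
    ultimately show ?thesis using w extendI by metis
  qed
  ultimately show ?thesis using v unfolding has_socle_def by blast
qed

text \<open>Induction on the length. An element \<open>z \<in> m\<close> regular at all stages of both sequences replaces the
  last element of either one by \<open>socle_exchange\<close>; after moving \<open>z\<close> to the front, the induction
  hypothesis compares the remaining shorter sequences over \<open>M/(N + zM)\<close>.\<close>

lemma socle_independent:
  assumes "ideal_in P N" and M: "ideal_in P M" and m: "ideal_in P m"
    and "length xs = length ys" "set xs \<subseteq> m" "set ys \<subseteq> m"
    and "regular_seq M N xs" "regular_seq M N ys"
    and "has_socle m M (extends M N xs)"
  shows "has_socle m M (extends M N ys)"
  using assms(1,4-)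
proof (induction "length xs" arbitrary: N xs ys)
  case 0
  then show ?case by simp
next
  case (Suc k)
  obtain xs' x where xs: "xs = xs' @ [x]" using Suc(2) by (metis length_Suc_conv_rev)
  obtain ys' y where ys: "ys = ys' @ [y]" using Suc(2,4) by (metis length_Suc_conv_rev)
  have mP: "m \<subseteq> P" using ideal_in_sub[OF m] .
  have sub: "set xs' \<subseteq> m" "set ys' \<subseteq> m" "x \<in> m" "y \<in> m" using Suc.prems xs ys by auto
  let ?S = "stages M N xs' \<union> stages M N ys'"
  have idS: "ideal_in P K" if "K \<in> ?S" for K
    using that sub mP ideal_in_stages[OF Suc.prems(1) M] by blast
  have "\<exists>z\<in>m. \<forall>K\<in>?S. regular_on M K z"
  proof (rule common_regular_element[OF _ m M])
    show "finite ?S" by (simp add: finite_stages)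
    show "ideal_in P K" if "K \<in> ?S" for K using that by (rule idS)
    show "\<not> has_socle m M K" if "K \<in> ?S" for K
      using that Suc.prems xs ys regular_seq_stages_no_socle by blast
  qed
  then obtain z where z: "z \<in> m" "\<And>K. K \<in> ?S \<Longrightarrow> regular_on M K z" by blast
  have zP: "z \<in> P" using z mP by blast
  have reg: "regular_seq M N xs'" "regular_on M (extends M N xs') x"
      "regular_seq M N ys'" "regular_on M (extends M N ys') y"
    using Suc.prems xs ys by (auto simp: regular_seq_append)
  have "has_socle m M (extend M (extends M N xs') z)"
  proof (rule socle_exchange[where x = x, OF _ M m])
    show "ideal_in P (extends M N xs')" "regular_on M (extends M N xs') z"
      using idS z extends_in_stages by blast+
    show "has_socle m M (extend M (extends M N xs') x)"
      using Suc.prems xs by (simp add: extends_append)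
  qed (use reg sub z in auto)
  then have "has_socle m M (extends M (extend M N z) xs')" by (simp add: extends_extend)
  then have "has_socle m M (extends M (extend M N z) ys')"
    using Suc.hyps(2) Suc.prems xs ys sub reg z zP mP M
    by (intro Suc.hyps(1)[of xs' "extend M N z" ys'] regular_seq_modulo ideal_in_extend) auto
  then have "has_socle m M (extend M (extends M N ys') z)" by (simp add: extends_extend)
  then have "has_socle m M (extend M (extends M N ys') y)"
  proof (rule socle_exchange[where x = z, OF _ M m, rotated -1])
    show "ideal_in P (extends M N ys')" "regular_on M (extends M N ys') z"
      using idS z extends_in_stages by blast+
  qed (use reg sub z in auto)
  then show ?case using ys by (simp add: extends_append)
qed

text \<open>A regular sequence starting with \<open>x\<close> that is shorter than \<open>ys\<close> can be prolonged: otherwise its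
  last quotient has a socle, and so has the quotient by the initial part of \<open>ys\<close> of the same length,
  although the next element of \<open>ys\<close> is regular on it.\<close>

theorem regular_seq_modulo_regular_element:
  assumes N: "ideal_in P N" and M: "ideal_in P M" and m: "ideal_in P m"
    and ys: "set ys \<subseteq> m" "regular_seq M N ys" and x: "x \<in> m" "regular_on M N x"
    and "e < length ys"
  shows "\<exists>zs. length zs = e \<and> set zs \<subseteq> m \<and> regular_seq M (extend M N x) zs"
  using \<open>e < length ys\<close>
proof (induction e)
  case 0
  then show ?case by auto
next
  case (Suc e)
  then obtain zs where zs: "length zs = e" "set zs \<subseteq> m" "regular_seq M (extend M N x) zs" by auto
  define xs where "xs = x # zs"
  have xs: "set xs \<subseteq> m" "regular_seq M N xs" "length xs = Suc e"
    using zs x unfolding xs_def by auto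
  define L where "L = extends M N xs"
  have "\<not> has_socle m M L"
  proof
    assume "has_socle m M L"
    have *: "ys = take (Suc e) ys @ ys ! Suc e # drop (Suc (Suc e)) ys"
      using Suc.prems by (simp add: id_take_nth_drop)
    have "regular_seq M N (take (Suc e) ys @ ys ! Suc e # drop (Suc (Suc e)) ys)"
      using ys * by simp
    then have reg: "regular_seq M N (take (Suc e) ys)"
        "regular_on M (extends M N (take (Suc e) ys)) (ys ! Suc e)"
      unfolding regular_seq_append by auto
    have "has_socle m M (extends M N (take (Suc e) ys))"
    proof (rule socle_independent[OF N M m, of xs])
      show "set (take (Suc e) ys) \<subseteq> m" using ys set_take_subset by fast
      show "has_socle m M (extends M N xs)" using \<open>has_socle m M L\<close> by (simp add: L_def)
    qed (use xs reg Suc.prems in auto)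
    moreover have "ys ! Suc e \<in> m" using ys Suc.prems by (meson nth_mem subsetD)
    ultimately show False using reg regular_on_no_socle by blast
  qed
  moreover have "ideal_in P L"
    unfolding L_def using xs ideal_in_sub[OF m] ideal_in_stages[OF N M] extends_in_stages by blast
  ultimately obtain z where z: "z \<in> m" "regular_on M L z"
    using common_regular_element[of "{L}" m M] m M by auto
  have "regular_seq M N (xs @ [z])"
    using xs z by (simp add: regular_seq_append L_def)
  then have "regular_seq M (extend M N x) (zs @ [z])" by (simp add: xs_def)
  then show ?case using zs z by (intro exI[of _ "zs @ [z]"]) auto
qed

end

section \<open>Polynomial rings\<close>

abbreviation polys :: "nat set \<Rightarrow> 'k::field mpoly set" where
  "polys X \<equiv> carrier (poly_ring X)"

lemma polys_iff: "p \<in> polys X \<longleftrightarrow> (\<forall>t\<in>keys p. keys t \<subseteq> X)"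
  by (simp add: poly_ring_def)

lemma poly_ring_simps [simp]:
  "mult (poly_ring X) = (*)" "one (poly_ring X) = 1" "zero (poly_ring X) = 0" "add (poly_ring X) = (+)"
  by (simp_all add: poly_ring_def)

lemma keys_plus_exponent:
  "keys (s + t) = keys s \<union> keys (t :: nat \<Rightarrow>\<^sub>0 nat)"
  by (auto simp: in_keys_iff lookup_add)

lemma in_keys_plusE:
  assumes "t \<in> keys (p + q)"
  shows "t \<in> keys p \<or> t \<in> keys q"
  using keys_add[of p q] assms by blast

lemma in_keys_timesE:
  assumes "t \<in> keys (p * q)"
  obtains a b where "t = a + b" "a \<in> keys p" "b \<in> keys q"
  using keys_mult[of p q] assms by blast

lemma keys_uminus: "keys (- p) = keys (p :: 'a \<Rightarrow>\<^sub>0 'b::ab_group_add)"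
  by (auto simp: in_keys_iff)

lemma polys_closed:
  "0 \<in> polys X" "1 \<in> polys X"
  "p \<in> polys X \<Longrightarrow> q \<in> polys X \<Longrightarrow> p + q \<in> polys X"
  "p \<in> polys X \<Longrightarrow> q \<in> polys X \<Longrightarrow> p * q \<in> polys X"
  "p \<in> polys X \<Longrightarrow> - p \<in> polys X"
proof -
  show "0 \<in> polys X" "1 \<in> polys X" by (auto simp: polys_iff)
  show "p + q \<in> polys X" if "p \<in> polys X" "q \<in> polys X"
    using that by (auto simp: polys_iff dest!: in_keys_plusE)
  show "p * q \<in> polys X" if "p \<in> polys X" "q \<in> polys X"
    using that by (fastforce simp: polys_iff keys_plus_exponent elim!: in_keys_timesE)
  show "- p \<in> polys X" if "p \<in> polys X"
    using that by (simp add: polys_iff keys_uminus)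
qed

lemma single_in_polys: "keys t \<subseteq> X \<Longrightarrow> single t c \<in> polys X"
  by (auto simp: polys_iff)

lemma lookup_single_times:
  fixes p :: "'k::field mpoly"
  shows "lookup (single u c * p) (u + a) = c * lookup p a"
proof -
  have "lookup (single u c * p) (u + a) =
      (\<Sum>l. (c * (\<Sum>q. lookup p q when u + a = l + q)) when u = l)"
    unfolding lookup_mult lookup_single by (simp add: when_mult)
  also have "\<dots> = c * (\<Sum>q. lookup p q when u + a = u + q)" by simp
  also have "\<dots> = c * lookup p a" by simp
  finally show ?thesis .
qed

lemma sum_of_terms:
  fixes p :: "'k::field mpoly"
  shows "p = (\<Sum>t\<in>keys p. single t (lookup p t))"
proof (rule poly_mapping_eqI)
  fix k
  have "(\<Sum>t\<in>keys p. lookup (single t (lookup p t)) k) =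
    (\<Sum>t\<in>keys p. if t = k then lookup p t else 0)"
    by (intro sum.cong) (auto simp: lookup_single when_def)
  also have "\<dots> = lookup p k"
    by (auto simp: sum.delta in_keys_iff)
  finally show "lookup p k = lookup
      (\<Sum>t\<in>keys p. single t (lookup p t)) k"
    by (simp add: lookup_sum)
qed

lemma sum_mem:
  assumes "0 \<in> S" "\<And>a b. a \<in> S \<Longrightarrow> b \<in> S \<Longrightarrow> a + b \<in> S" "\<And>i. i \<in> I \<Longrightarrow> f i \<in> S"
  shows "sum f I \<in> S"
  using assms(3) by (induction I rule: infinite_finite_induct) (auto intro: assms(1,2))

text \<open>The way in which additive statements about polynomials are reduced to terms below.\<close>

lemma mem_if_terms_mem:
  fixes p :: "'k::field mpoly"
  assumes "0 \<in> S" "\<And>a b. a \<in> S \<Longrightarrow> b \<in> S \<Longrightarrow> a + b \<in> S"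
    and "\<And>t. t \<in> keys p \<Longrightarrow> single t (lookup p t) \<in> S"
  shows "p \<in> S"
  by (subst sum_of_terms) (rule sum_mem[OF assms])

section \<open>Hilbert's basis theorem\<close>

text \<open>A monotone subsequence exists in any linear order; if it is decreasing, it is eventually
  constant in the natural numbers, and its tail is taken.\<close>

lemma nat_seq_mono_subseq:
  fixes s :: "nat \<Rightarrow> nat"
  shows "\<exists>g::nat \<Rightarrow> nat. strict_mono g \<and> mono (\<lambda>k. s (g k))"
proof -
  obtain g :: "nat \<Rightarrow> nat" where g: "strict_mono g" "monoseq (\<lambda>n. s (g n))"
    using seq_monosub[of s] by auto
  show ?thesis
  proof (cases "\<forall>m. \<forall>n\<ge>m. s (g m) \<le> s (g n)")
    case True
    then show ?thesis using g(1) by (intro exI[of _ g] conjI) (simp_all add: mono_def)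
  next
    case False
    then have anti: "s (g n) \<le> s (g m)" if "m \<le> n" for m n
      using g(2) that unfolding monoseq_def by blast
    obtain N where N: "\<And>k. s (g N) \<le> s (g k)"
      using ex_has_least_nat[of "\<lambda>_. True" 0 "\<lambda>k. s (g k)"] by auto
    have const: "s (g (k + N)) = s (g N)" for k
      using N[of "k + N"] anti[of N "k + N"] by simp
    have "strict_mono (\<lambda>k. g (k + N))" using g(1) by (simp add: strict_mono_def)
    moreover have "mono (\<lambda>k. s (g (k + N)))" by (simp add: const mono_def)
    ultimately show ?thesis by (intro exI[of _ "\<lambda>k. g (k + N)"] conjI)
  qed
qed

lemma exponent_mono_subseq:
  fixes t :: "nat \<Rightarrow> nat \<Rightarrow>\<^sub>0 nat"
  assumes "finite X"
  shows "\<exists>g::nat \<Rightarrow> nat. strict_mono g \<and> (\<forall>i\<in>X. mono (\<lambda>k. lookup (t (g k)) i))"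
  using assms
proof (induction X rule: finite_induct)
  case empty
  show ?case by (intro exI[of _ id]) (simp add: strict_mono_def)
next
  case (insert i X)
  then obtain g :: "nat \<Rightarrow> nat" where g: "strict_mono g" "\<And>i. i \<in> X \<Longrightarrow> mono (\<lambda>k. lookup (t (g k)) i)"
    by auto
  obtain h :: "nat \<Rightarrow> nat" where h: "strict_mono h" "mono (\<lambda>k. lookup (t (g (h k))) i)"
    using nat_seq_mono_subseq[of "\<lambda>k. lookup (t (g k)) i"] by auto
  have "strict_mono (\<lambda>k. g (h k))" using g(1) h(1) by (simp add: strict_mono_def)
  moreover have "mono (\<lambda>k. lookup (t (g (h k))) j)" if "j \<in> X" for j
    using g(2)[OF that] strict_mono_mono[OF h(1)] by (simp add: mono_def)
  ultimately show ?case using h(2) by (intro exI[of _ "\<lambda>k. g (h k)"]) auto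
qed

text \<open>Dickson's lemma, in the form that divisibility of monomials in finitely many variables is a well
  quasi-order: pass to a subsequence on which all exponents increase.\<close>

lemma dickson:
  fixes t :: "nat \<Rightarrow> nat \<Rightarrow>\<^sub>0 nat"
  assumes "finite X" "\<And>k. keys (t k) \<subseteq> X"
  shows "\<exists>i j u. i < j \<and> t j = t i + u"
proof -
  obtain g :: "nat \<Rightarrow> nat" where g: "strict_mono g" "\<And>i. i \<in> X \<Longrightarrow> mono (\<lambda>k. lookup (t (g k)) i)"
    using exponent_mono_subseq[OF assms(1), of t] by auto
  have le: "lookup (t (g 0)) i \<le> lookup (t (g 1)) i" for i
  proof (cases "i \<in> X")
    case True
    then show ?thesis using g(2)[OF True] by (auto dest: monoD[of _ 0 1])
  next
    case False
    then have "lookup (t (g 0)) i = 0"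
      using assms(2)[of "g 0"] by (auto simp: in_keys_iff)
    then show ?thesis by simp
  qed
  have "t (g 1) = t (g 0) + (t (g 1) - t (g 0))"
    by (rule poly_mapping_eqI) (use le in \<open>simp add: lookup_add lookup_minus\<close>)
  moreover have "g 0 < g 1" using g(1) by (simp add: strict_mono_def)
  ultimately show ?thesis by blast
qed

lemma zero_le_exponent: "0 \<le> (u :: nat \<Rightarrow>\<^sub>0 nat)"
proof -
  have "\<not> u < 0" by transfer (simp add: less_fun_def)
  then show ?thesis by simp
qed

text \<open>The linear order on finitely supported functions compares at the least position of
  difference. It is a monomial order, but it is well-founded only on finitely many variables: there
  every infinite descent would contain a monomial and, later, one of its multiples, which is not
  smaller.\<close>

lemma wf_lex_exponents:
  assumes "finite X"
  shows "wf {(s, t :: nat \<Rightarrow>\<^sub>0 nat). s < t \<and> keys s \<subseteq> X \<and> keys t \<subseteq> X}"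
  unfolding wf_iff_no_infinite_down_chain
proof
  assume "\<exists>f. \<forall>i. (f (Suc i), f i) \<in>
    {(s, t :: nat \<Rightarrow>\<^sub>0 nat). s < t \<and> keys s \<subseteq> X \<and> keys t \<subseteq> X}"
  then obtain f :: "nat \<Rightarrow> nat \<Rightarrow>\<^sub>0 nat" where f: "\<And>i. f (Suc i) < f i" "\<And>i. keys (f i) \<subseteq> X"
    by auto
  obtain i j u where ij: "i < j" "f j = f i + u" using dickson[of X f] assms f(2) by blast
  have "f j < f i" using ij(1) by (induction rule: strict_inc_induct) (use f(1) order.strict_trans in blast)+
  moreover have "f i + 0 \<le> f i + u" by (rule add_left_mono) (rule zero_le_exponent)
  ultimately show False using ij(2) by simp
qed

text \<open>One step of polynomial division, cancelling the leading term of \<open>q\<close>.\<close>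

lemma reduce_leading_term:
  fixes p q :: "'k::field mpoly"
  assumes "p \<noteq> 0" "Max (keys q) = Max (keys p) + u"
  shows "\<exists>c. \<forall>t\<in>keys (q - single u c * p). t < Max (keys q)"
proof -
  define m where "m = Max (keys p)"
  define c where "c = lookup q (u + m) / lookup p m"
  have "keys p \<noteq> {}" using assms(1) by (metis poly_mapping_eqI lookup_zero in_keys_iff empty_iff)
  then have m: "m \<in> keys p" unfolding m_def by (intro Max_in) auto
  have mq: "Max (keys q) = u + m" using assms(2) by (simp add: m_def add.commute)
  have "t < u + m" if t: "t \<in> keys (q - single u c * p)" for t
  proof -
    have "t \<in> keys q \<or> t \<in> keys (single u c * p)"
      using t in_keys_plusE[of t q "- (single u c * p)"] by (simp add: keys_uminus)
    then have "t \<le> u + m"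
    proof
      assume "t \<in> keys q"
      then show ?thesis using mq[symmetric] by simp
    next
      assume "t \<in> keys (single u c * p)"
      then obtain a b where "t = a + b" "a \<in> keys (single u c)" "b \<in> keys p"
        by (rule in_keys_timesE)
      then have "t = u + b" "b \<le> m" unfolding m_def by (auto split: if_splits)
      then show ?thesis using add_left_mono by blast
    qed
    moreover have "t \<noteq> u + m"
    proof
      assume "t = u + m"
      then have "lookup (q - single u c * p) t = 0"
        using m by (simp add: lookup_minus lookup_single_times c_def in_keys_iff)
      then show False using t by (simp add: in_keys_iff)
    qed
    ultimately show ?thesis by simp
  qed
  then show ?thesis unfolding mq by blast
qed

text \<open>Hilbert's basis theorem. In a strictly increasing chain choose \<open>p k \<in> A (Suc k) - A k\<close> with
  least leading monomial. By Dickson's lemma the leading monomial of some \<open>p i\<close> divides that of a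
  later \<open>p j\<close>, and reducing \<open>p j\<close> by \<open>p i\<close> contradicts the choice of \<open>p j\<close>.\<close>

lemma noetherian_polys:
  assumes "finite X"
  shows "noetherian_subring (polys X :: 'k::field mpoly set)"
proof
  fix A :: "nat \<Rightarrow> 'k mpoly set"
  assume ideal: "\<And>k. ideal_in (polys X) (A k)" and chain: "\<And>k. A k \<subseteq> A (Suc k)"
  have A: "A k \<subseteq> polys X" "0 \<in> A k" "a \<in> A k \<Longrightarrow> b \<in> A k \<Longrightarrow> a + b \<in> A k"
      "r \<in> polys X \<Longrightarrow> a \<in> A k \<Longrightarrow> r * a \<in> A k" for k a b r
    using ideal[of k] unfolding ideal_in_def by blast+
  show "\<exists>k. A (Suc k) = A k"
  proof (rule ccontr)
    assume neg: "\<nexists>k. A (Suc k) = A k"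
    let ?lm = "\<lambda>p::'k mpoly. Max (keys p)"
    have keys_lm: "keys (?lm p) \<subseteq> X" if "p \<in> A k" "p \<noteq> 0" for p k
    proof -
      have "keys p \<noteq> {}" using that(2) by (metis poly_mapping_eqI lookup_zero in_keys_iff empty_iff)
      then have "?lm p \<in> keys p" by (intro Max_in) auto
      moreover have "p \<in> polys X" using that(1) A(1)[of k] by blast
      ultimately show ?thesis unfolding polys_iff by blast
    qed
    have "\<exists>p. p \<in> A (Suc k) - A k \<and> (\<forall>q\<in>A (Suc k) - A k. \<not> ?lm q < ?lm p)" for k
    proof -
      obtain p where p: "p \<in> A (Suc k) - A k" using neg chain[of k] by blast
      let ?R = "{(s, t). s < t \<and> keys s \<subseteq> X \<and> keys t \<subseteq> X}"
      have "\<exists>m\<in>?lm ` (A (Suc k) - A k). \<forall>y. (y, m) \<in> ?R \<longrightarrow> y \<notin> ?lm ` (A (Suc k) - A k)"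
        by (rule wf_eq_minimal[THEN iffD1, OF wf_lex_exponents[OF assms], rule_format, OF imageI[OF p]])
      then obtain m where m: "m \<in> ?lm ` (A (Suc k) - A k)"
        "\<forall>y. (y, m) \<in> ?R \<longrightarrow> y \<notin> ?lm ` (A (Suc k) - A k)" by (rule bexE)
      from m(1) obtain p' where p': "p' \<in> A (Suc k) - A k" "m = ?lm p'" by blast
      have "\<not> ?lm q < ?lm p'" if q: "q \<in> A (Suc k) - A k" for q
      proof
        assume "?lm q < ?lm p'"
        moreover have "r \<noteq> 0" if "r \<in> A (Suc k) - A k" for r using that A(2)[of k] by auto
        then have "keys (?lm q) \<subseteq> X" "keys (?lm p') \<subseteq> X"
          using keys_lm[of _ "Suc k"] q p'(1) by simp_all
        ultimately show False using m(2)[rule_format, of "?lm q"] imageI[OF q, of ?lm] p'(2) by simp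
      qed
      then show ?thesis using p'(1) by blast
    qed
    then have "\<exists>p. \<forall>k. p k \<in> A (Suc k) - A k \<and> (\<forall>q\<in>A (Suc k) - A k. \<not> ?lm q < ?lm (p k))"
      by (intro choice allI)
    then obtain p where p: "\<And>k. p k \<in> A (Suc k)" "\<And>k. p k \<notin> A k"
      "\<And>k q. q \<in> A (Suc k) \<Longrightarrow> q \<notin> A k \<Longrightarrow> \<not> ?lm q < ?lm (p k)" by blast
    have nz: "p k \<noteq> 0" for k using p(2)[of k] A(2)[of k] by auto
    obtain i j u where ij: "i < j" "?lm (p j) = ?lm (p i) + u"
      using dickson[OF assms, of "\<lambda>k. ?lm (p k)"] keys_lm[OF p(1) nz] by blast
    obtain c where c: "\<forall>t\<in>keys (p j - single u c * p i). t < ?lm (p j)"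
      using reduce_leading_term[OF nz[of i] ij(2)] by blast
    let ?r = "p j - single u c * p i"
    have "keys u \<subseteq> X"
      using keys_lm[OF p(1) nz, of j] ij(2) by (simp add: keys_plus_exponent)
    moreover have "A (Suc i) \<subseteq> A j" by (rule lift_Suc_mono_le[of A, OF chain]) (use ij(1) in simp)
    ultimately have si: "single u c * p i \<in> A j"
      using p(1)[of i] by (intro A(4)[OF single_in_polys]) auto
    have "?r = p j + (- 1) * (single u c * p i)" by simp
    moreover have "(- 1) * (single u c * p i) \<in> A (Suc j)"
      using si chain[of j] by (intro A(4)[OF polys_closed(5)[OF polys_closed(2)]]) auto
    ultimately have rS: "?r \<in> A (Suc j)" using A(3)[OF p(1)[of j]] by metis
    have rj: "?r \<notin> A j"
    proof
      assume "?r \<in> A j"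
      then have "?r + single u c * p i \<in> A j" using si A(3) by blast
      then show False using p(2)[of j] by simp
    qed
    then have "?r \<noteq> 0" using A(2)[of j] by auto
    then have "keys ?r \<noteq> {}" by (metis poly_mapping_eqI lookup_zero in_keys_iff empty_iff)
    then have "?lm ?r < ?lm (p j)" using c by simp
    then show False using p(3)[OF rS rj] by simp
  qed
qed (use polys_closed in auto)

section \<open>Monomial ideals\<close>

lemma cring_poly_ring: "cring (poly_ring X :: 'k::field mpoly ring)" (is "cring ?R")
proof (rule cringI)
  show "abelian_group ?R"
  proof (rule abelian_groupI)
    show "\<exists>y\<in>carrier ?R. y \<oplus>\<^bsub>?R\<^esub> x = \<zero>\<^bsub>?R\<^esub>" if "x \<in> carrier ?R" for x
      using polys_closed(5)[OF that] by (intro bexI[of _ "- x"]) simp_all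
  qed (auto simp: polys_closed algebra_simps)
  show "Group.comm_monoid ?R"
    by (rule comm_monoidI) (auto simp: polys_closed algebra_simps)
qed (auto simp: algebra_simps)

lemma ideal_if_ideal_in:
  assumes "ideal_in (polys X) J"
  shows "ideal J (poly_ring X)"
proof (rule idealI)
  show "ring (poly_ring X)" using cring_poly_ring cring_def by blast
  have J: "J \<subseteq> polys X" "0 \<in> J" "\<And>a b. a \<in> J \<Longrightarrow> b \<in> J \<Longrightarrow> a + b \<in> J"
      "\<And>r a. r \<in> polys X \<Longrightarrow> a \<in> J \<Longrightarrow> r * a \<in> J"
    using assms unfolding ideal_in_def by blast+
  show "subgroup J (add_monoid (poly_ring X))"
  proof (rule group.subgroupI)
    show "Group.group (add_monoid (poly_ring X))"
      by (rule abelian_group.a_group[OF ring.is_abelian_group]) (use cring_poly_ring cring_def in blast)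
    show "inv\<^bsub>add_monoid (poly_ring X)\<^esub> a \<in> J" if "a \<in> J" for a
    proof -
      have "(- 1) * a \<in> J" using that by (intro J(4) polys_closed)
      moreover have "inv\<^bsub>add_monoid (poly_ring X)\<^esub> a = - a"
        by (rule group.inv_equality[OF \<open>Group.group (add_monoid (poly_ring X))\<close>])
          (use that J(1) polys_closed(5)[of a X] in auto)
      ultimately show ?thesis by simp
    qed
  qed (use J in auto)
  show "x \<otimes>\<^bsub>poly_ring X\<^esub> a \<in> J" if "a \<in> J" "x \<in> polys X" for a x using that J(4) by simp
  show "a \<otimes>\<^bsub>poly_ring X\<^esub> x \<in> J" if "a \<in> J" "x \<in> polys X" for a x
    using J(4)[of x a] that by (simp add: mult.commute)
qed

lemma monomial_ideal_eq:
  fixes X :: "nat set"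
  assumes T: "\<And>t. t \<in> T \<Longrightarrow> keys t \<subseteq> X"
  shows "Idl\<^bsub>poly_ring X\<^esub> (monomial ` T) =
    {p \<in> polys X :: 'k::field mpoly set. \<forall>t\<in>keys p. \<exists>s\<in>T. \<exists>r. t = s + r}"
    (is "?I = ?J")
proof
  have ring: "ring (poly_ring X :: 'k mpoly ring)" using cring_poly_ring cring_def by blast
  have "ideal_in (polys X) ?J"
    unfolding ideal_in_def
  proof (intro conjI ballI)
    fix p q :: "'k mpoly" assume "p \<in> ?J" "q \<in> ?J"
    then show "p + q \<in> ?J" using polys_closed(3) in_keys_plusE by fast
  next
    fix r p :: "'k mpoly" assume r: "r \<in> polys X" and p: "p \<in> ?J"
    have "\<exists>s\<in>T. \<exists>v. t = s + v" if "t \<in> keys (r * p)" for t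
    proof -
      from that obtain a b where ab: "t = a + b" "b \<in> keys p" by (rule in_keys_timesE)
      then obtain s v where "s \<in> T" "b = s + v" using p by blast
      then have "t = s + (a + v)" using ab by (simp add: add.left_commute)
      then show ?thesis using \<open>s \<in> T\<close> by blast
    qed
    then show "r * p \<in> ?J" using r p polys_closed(4) by blast
  qed (auto simp: polys_closed)
  then have "ideal ?J (poly_ring X)" by (rule ideal_if_ideal_in)
  moreover have "monomial ` T \<subseteq> ?J"
  proof
    fix p :: "'k mpoly" assume "p \<in> monomial ` T"
    then obtain t where t: "t \<in> T" "p = monomial t" by blast
    have "\<exists>s\<in>T. \<exists>r. t = s + r" using t(1) by (intro bexI[of _ t] exI[of _ 0]) simp_all
    then show "p \<in> ?J" using t T[OF t(1)] by (simp add: monomial_def single_in_polys)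
  qed
  ultimately show "?I \<subseteq> ?J" by (rule ring.genideal_minimal[OF ring])
next
  have ring: "ring (poly_ring X :: 'k mpoly ring)" using cring_poly_ring cring_def by blast
  have sub: "monomial ` T \<subseteq> (polys X :: 'k mpoly set)" using T by (auto simp: monomial_def single_in_polys)
  have I: "ideal ?I (poly_ring X)" by (rule ring.genideal_ideal[OF ring sub])
  show "?J \<subseteq> ?I"
  proof
    fix p :: "'k mpoly" assume p: "p \<in> ?J"
    show "p \<in> ?I"
    proof (rule mem_if_terms_mem)
      show "0 \<in> ?I" using additive_subgroup.zero_closed[OF ideal.axioms(1)[OF I]] by simp
      show "a + b \<in> ?I" if "a \<in> ?I" "b \<in> ?I" for a b
        using additive_subgroup.a_closed[OF ideal.axioms(1)[OF I] that] by simp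
    next
      fix t assume t: "t \<in> keys p"
      then obtain s r where s: "s \<in> T" "t = s + r" using p by blast
      have "keys t \<subseteq> X" using t p unfolding polys_iff by blast
      then have "keys r \<subseteq> X" using s(2) by (simp add: keys_plus_exponent)
      then have "single r (lookup p t) \<in> polys X" by (rule single_in_polys)
      moreover have "monomial s \<in> ?I" using ring.genideal_self[OF ring sub] s(1) by blast
      ultimately have "single r (lookup p t) * monomial s \<in> ?I"
        using ideal.I_l_closed[OF I] by fastforce
      then show "single t (lookup p t) \<in> ?I"
        using s(2) by (simp add: monomial_def mult_single add.commute)
    qed
  qed
qed

text \<open>The monomials divisible by a variable are those different from \<open>1\<close>, which is the monomial with
  exponent \<open>0\<close>.\<close>

lemma graded_maximal_ideal_eq:
  "graded_maximal_ideal X = {p :: 'k::field mpoly. p \<in> polys X \<and> lookup p 0 = 0}"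
proof -
  have "indet ` X = (monomial ` ((\<lambda>i. single i 1) ` X) :: 'k mpoly set)"
    by (auto simp: indet_def)
  then have *: "(graded_maximal_ideal X :: 'k mpoly set) =
      {p \<in> polys X. \<forall>t\<in>keys p. \<exists>s\<in>(\<lambda>i. single i 1) ` X. \<exists>r. t = s + r}"
    unfolding graded_maximal_ideal_def by (simp only:, intro monomial_ideal_eq) auto
  have divides: "(\<exists>s\<in>(\<lambda>i. single i 1) ` X. \<exists>r. t = s + r) \<longleftrightarrow> t \<noteq> 0"
    if "keys t \<subseteq> X" for t :: "nat \<Rightarrow>\<^sub>0 nat"
  proof
    assume "\<exists>s\<in>(\<lambda>i. single i 1) ` X. \<exists>r. t = s + r"
    then obtain i r where "t = single i 1 + r" by blast
    then have "lookup t i \<noteq> 0" by (simp add: lookup_add)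
    then show "t \<noteq> 0" by auto
  next
    assume "t \<noteq> 0"
    then obtain i where i: "lookup t i \<noteq> 0"
      by (metis lookup_zero poly_mapping_eqI)
    have "t = single i 1 + (t - single i 1)"
      by (rule poly_mapping_eqI) (use i in \<open>auto simp: lookup_add lookup_minus lookup_single when_def\<close>)
    moreover have "i \<in> X" using that i by (auto simp: in_keys_iff)
    ultimately show "\<exists>s\<in>(\<lambda>i. single i 1) ` X. \<exists>r. t = s + r" by blast
  qed
  have "(\<forall>t\<in>keys p. \<exists>s\<in>(\<lambda>i. single i 1) ` X. \<exists>r. t = s + r) \<longleftrightarrow>
      lookup p 0 = 0" if "p \<in> polys X" for p :: "'k mpoly"
  proof -
    have "(\<forall>t\<in>keys p. \<exists>s\<in>(\<lambda>i. single i 1) ` X. \<exists>r. t = s + r) \<longleftrightarrow>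
        (\<forall>t\<in>keys p. t \<noteq> 0)"
      using that by (intro ball_cong refl divides) (auto simp: polys_iff)
    also have "\<dots> \<longleftrightarrow> 0 \<notin> keys p" by metis
    finally show ?thesis by (simp add: in_keys_iff)
  qed
  then show ?thesis unfolding * by (intro Collect_cong conj_cong refl)
qed

text \<open>Membership of a monomial in a squarefree monomial ideal depends only on the set of variables
  that occur in it. The ideal is therefore described by a family \<open>\<F>\<close> of sets of variables, the
  supports of its generators.\<close>

definition support_ideal :: "nat set \<Rightarrow> nat set set \<Rightarrow> 'k::field mpoly set" where
  "support_ideal X \<F> =
     {p. \<forall>t\<in>keys p. keys t \<subseteq> X \<and> (\<exists>F\<in>\<F>. F \<subseteq> keys t)}"

text \<open>The exponent of the squarefree monomial with support \<open>F\<close>. The finiteness condition makes the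
  function finitely supported for every \<open>F\<close>.\<close>

lift_definition set_exponent :: "nat set \<Rightarrow> nat \<Rightarrow>\<^sub>0 nat" is
  "\<lambda>F i. if finite F \<and> i \<in> F then 1 else 0"
  by (auto intro: finite_subset)

lemma keys_set_exponent: "finite F \<Longrightarrow> keys (set_exponent F) = F"
  by (auto simp: in_keys_iff set_exponent.rep_eq split: if_splits)

lemma squarefree_divides_iff:
  assumes "\<And>i. lookup s i \<le> (1::nat)"
  shows "(\<exists>r. t = s + r) \<longleftrightarrow> keys s \<subseteq> keys t"
proof
  assume "\<exists>r. t = s + r"
  then show "keys s \<subseteq> keys t" by (auto simp: in_keys_iff lookup_add)
next
  assume sub: "keys s \<subseteq> keys t"
  have "lookup s i \<le> lookup t i" for i
  proof (cases "lookup s i = 0")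
    case False
    then have "lookup t i \<noteq> 0" using sub unfolding in_keys_iff subset_iff by blast
    then show ?thesis using assms[of i] by linarith
  qed simp
  then have "t = s + (t - s)" by (intro poly_mapping_eqI) (simp add: lookup_add lookup_minus)
  then show "\<exists>r. t = s + r" by blast
qed

lemma squarefree_monomial_ideal_iff:
  assumes "finite X"
  shows "squarefree_monomial_ideal X I \<longleftrightarrow> (\<exists>\<F>\<subseteq>Pow X. I = support_ideal X \<F>)"
proof
  assume "squarefree_monomial_ideal X I"
  then obtain T where T: "\<And>t. t \<in> T \<Longrightarrow> keys t \<subseteq> X"
      "\<And>t i. t \<in> T \<Longrightarrow> lookup t i \<le> 1" and I: "I = Idl\<^bsub>poly_ring X\<^esub> (monomial ` T)"
    unfolding squarefree_monomial_ideal_def by blast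
  have "I = support_ideal X (keys ` T)"
    unfolding I by (subst monomial_ideal_eq, erule T(1))
      (auto simp: support_ideal_def polys_iff squarefree_divides_iff[OF T(2)])
  then show "\<exists>\<F>\<subseteq>Pow X. I = support_ideal X \<F>" using T(1) by (intro exI[of _ "keys ` T"]) auto
next
  assume "\<exists>\<F>\<subseteq>Pow X. I = support_ideal X \<F>"
  then obtain \<F> where F: "\<F> \<subseteq> Pow X" "I = support_ideal X \<F>" by blast
  have fin: "finite F" if "F \<in> \<F>" for F using that F(1) assms finite_subset by blast
  have le: "lookup (set_exponent F) i \<le> 1" for F i by (simp add: set_exponent.rep_eq)
  have keys: "keys t \<subseteq> X" if t: "t \<in> set_exponent ` \<F>" for t
  proof -
    obtain F where "F \<in> \<F>" "t = set_exponent F" using t by blast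
    then show ?thesis using F(1) fin by (auto simp: keys_set_exponent)
  qed
  have "I = Idl\<^bsub>poly_ring X\<^esub> (monomial ` set_exponent ` \<F>)"
    unfolding F(2) by (subst monomial_ideal_eq, erule keys)
      (auto simp: support_ideal_def polys_iff squarefree_divides_iff[OF le] keys_set_exponent[OF fin])
  then show "squarefree_monomial_ideal X I"
    unfolding squarefree_monomial_ideal_def using keys le by (intro exI[of _ "set_exponent ` \<F>"]) auto
qed

section \<open>Quotient modules\<close>

text \<open>The modules here are records without further fields, as \<open>quot_module\<close> and \<open>seq_submodule\<close>
  expect them.\<close>

locale plain_module = Module.module R M
  for R :: "('a, 'r) ring_scheme" (structure) and M :: "('a, 'b) module" (structure)
begin

lemma abelian_subgroup_if_submodule:
  assumes "submodule N R M"
  shows "abelian_subgroup N M"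
  using assms unfolding submodule_def
  by (intro abelian_subgroupI3 additive_subgroupI M.abelian_group_axioms) auto

lemma
  assumes "submodule N R M"
  shows quot_carrier: "carrier (quot_module M N) = (\<lambda>x. N +>\<^bsub>M\<^esub> x) ` carrier M"
    and quot_zero: "\<zero>\<^bsub>quot_module M N\<^esub> = N"
    and quot_add: "\<lbrakk>x \<in> carrier M; y \<in> carrier M\<rbrakk> \<Longrightarrow>
      (N +>\<^bsub>M\<^esub> x) \<oplus>\<^bsub>quot_module M N\<^esub> (N +>\<^bsub>M\<^esub> y) = N +>\<^bsub>M\<^esub> (x \<oplus>\<^bsub>M\<^esub> y)"
    and coset_eq_zero_iff: "x \<in> carrier M \<Longrightarrow> N +>\<^bsub>M\<^esub> x = N \<longleftrightarrow> x \<in> N"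
proof -
  interpret N: abelian_subgroup N M by (rule abelian_subgroup_if_submodule[OF assms])
  show "carrier (quot_module M N) = (\<lambda>x. N +>\<^bsub>M\<^esub> x) ` carrier M"
    by (auto simp: quot_module_def A_RCOSETS_def' )
  show "\<zero>\<^bsub>quot_module M N\<^esub> = N" by (simp add: quot_module_def)
  show "(N +>\<^bsub>M\<^esub> x) \<oplus>\<^bsub>quot_module M N\<^esub> (N +>\<^bsub>M\<^esub> y) = N +>\<^bsub>M\<^esub> (x \<oplus>\<^bsub>M\<^esub> y)"
    if "x \<in> carrier M" "y \<in> carrier M"
    using N.a_rcos_sum[OF that] by (simp add: quot_module_def)
  show "N +>\<^bsub>M\<^esub> x = N \<longleftrightarrow> x \<in> N" if "x \<in> carrier M"
    using N.a_rcos_self[OF that] N.a_rcos_const by blast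
qed

text \<open>Scalar multiplication is defined as a union over all representatives; the members of this union
  coincide.\<close>

lemma quot_smult:
  assumes N: "submodule N R M" and r: "r \<in> carrier R" and x: "x \<in> carrier M"
  shows "r \<odot>\<^bsub>quot_module M N\<^esub> (N +>\<^bsub>M\<^esub> x) = N +>\<^bsub>M\<^esub> (r \<odot>\<^bsub>M\<^esub> x)"
proof -
  interpret N: abelian_subgroup N M by (rule abelian_subgroup_if_submodule[OF N])
  have const: "N +>\<^bsub>M\<^esub> (r \<odot>\<^bsub>M\<^esub> y) = N +>\<^bsub>M\<^esub> (r \<odot>\<^bsub>M\<^esub> x)" if y: "y \<in> N +>\<^bsub>M\<^esub> x" for y
  proof -
    obtain h where h: "h \<in> N" "y = h \<oplus>\<^bsub>M\<^esub> x" using y unfolding a_r_coset_def' by blast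
    have hM: "h \<in> carrier M" using h(1) N.a_Hcarr by blast
    have rh: "r \<odot>\<^bsub>M\<^esub> h \<in> N" using N r h(1) by (simp add: submodule.smult_closed)
    have "r \<odot>\<^bsub>M\<^esub> y = r \<odot>\<^bsub>M\<^esub> h \<oplus>\<^bsub>M\<^esub> r \<odot>\<^bsub>M\<^esub> x" using h r x hM by (simp add: smult_r_distr)
    then have "r \<odot>\<^bsub>M\<^esub> y \<in> N +>\<^bsub>M\<^esub> (r \<odot>\<^bsub>M\<^esub> x)" using rh unfolding a_r_coset_def' by blast
    then show ?thesis using N.a_repr_independence' r x by (metis smult_closed)
  qed
  have ne: "N +>\<^bsub>M\<^esub> x \<noteq> {}" using N.a_rcos_self[OF x] by blast
  have "r \<odot>\<^bsub>quot_module M N\<^esub> (N +>\<^bsub>M\<^esub> x) = (\<Union>y\<in>N +>\<^bsub>M\<^esub> x. N +>\<^bsub>M\<^esub> (r \<odot>\<^bsub>M\<^esub> y))"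
    by (simp add: quot_module_def)
  also have "\<dots> = N +>\<^bsub>M\<^esub> (r \<odot>\<^bsub>M\<^esub> x)" by (rule SUP_eq_const[OF ne const])
  finally show ?thesis .
qed

text \<open>The module axioms descend along the surjection \<open>x \<mapsto> N + x\<close>.\<close>

lemma module_quot:
  assumes N: "submodule N R M"
  shows "plain_module R (quot_module M N)"
proof (intro plain_module.intro moduleI)
  interpret N: abelian_subgroup N M by (rule abelian_subgroup_if_submodule[OF N])
  show "cring R" ..
  note [simp] = quot_carrier[OF N] quot_zero[OF N] quot_add[OF N] quot_smult[OF N]
  show "abelian_group (quot_module M N)"
  proof (rule abelian_groupI)
    show "\<zero>\<^bsub>quot_module M N\<^esub> \<in> carrier (quot_module M N)"
      using coset_eq_zero_iff[OF N, of "\<zero>\<^bsub>M\<^esub>"] N.zero_closed by force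
    show "\<zero>\<^bsub>quot_module M N\<^esub> \<oplus>\<^bsub>quot_module M N\<^esub> C = C"
      if C: "C \<in> carrier (quot_module M N)" for C
    proof -
      obtain x where x: "x \<in> carrier M" "C = N +>\<^bsub>M\<^esub> x" using C by auto
      have "(N +>\<^bsub>M\<^esub> \<zero>\<^bsub>M\<^esub>) \<oplus>\<^bsub>quot_module M N\<^esub> (N +>\<^bsub>M\<^esub> x) = N +>\<^bsub>M\<^esub> x"
        using x by simp
      moreover have "N +>\<^bsub>M\<^esub> \<zero>\<^bsub>M\<^esub> = N" using coset_eq_zero_iff[OF N, of "\<zero>\<^bsub>M\<^esub>"] by simp
      ultimately show ?thesis using x by simp
    qed
    show "\<exists>D\<in>carrier (quot_module M N). D \<oplus>\<^bsub>quot_module M N\<^esub> C = \<zero>\<^bsub>quot_module M N\<^esub>"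
      if C: "C \<in> carrier (quot_module M N)" for C
    proof -
      obtain x where x: "x \<in> carrier M" "C = N +>\<^bsub>M\<^esub> x" using C by auto
      have "(N +>\<^bsub>M\<^esub> \<ominus>\<^bsub>M\<^esub> x) \<oplus>\<^bsub>quot_module M N\<^esub> C = N"
        using x coset_eq_zero_iff[OF N, of "\<zero>\<^bsub>M\<^esub>"] by (simp add: M.l_neg)
      then show ?thesis using x by (intro bexI[of _ "N +>\<^bsub>M\<^esub> \<ominus>\<^bsub>M\<^esub> x"]) auto
    qed
  qed (auto simp: M.a_ac)
  show "a \<odot>\<^bsub>quot_module M N\<^esub> C \<in> carrier (quot_module M N)"
    if "a \<in> carrier R" "C \<in> carrier (quot_module M N)" for a C
    using that by auto
  show "(a \<oplus>\<^bsub>R\<^esub> b) \<odot>\<^bsub>quot_module M N\<^esub> C =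
      (a \<odot>\<^bsub>quot_module M N\<^esub> C) \<oplus>\<^bsub>quot_module M N\<^esub> (b \<odot>\<^bsub>quot_module M N\<^esub> C)"
    if "a \<in> carrier R" "b \<in> carrier R" "C \<in> carrier (quot_module M N)" for a b C
    using that by (auto simp: smult_l_distr)
  show "a \<odot>\<^bsub>quot_module M N\<^esub> (C \<oplus>\<^bsub>quot_module M N\<^esub> D) =
      (a \<odot>\<^bsub>quot_module M N\<^esub> C) \<oplus>\<^bsub>quot_module M N\<^esub> (a \<odot>\<^bsub>quot_module M N\<^esub> D)"
    if "a \<in> carrier R" "C \<in> carrier (quot_module M N)" "D \<in> carrier (quot_module M N)" for a C D
    using that by (auto simp: smult_r_distr)
  show "(a \<otimes>\<^bsub>R\<^esub> b) \<odot>\<^bsub>quot_module M N\<^esub> C = a \<odot>\<^bsub>quot_module M N\<^esub> (b \<odot>\<^bsub>quot_module M N\<^esub> C)"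
    if "a \<in> carrier R" "b \<in> carrier R" "C \<in> carrier (quot_module M N)" for a b C
    using that by (auto simp: smult_assoc1)
  show "\<one>\<^bsub>R\<^esub> \<odot>\<^bsub>quot_module M N\<^esub> C = C" if "C \<in> carrier (quot_module M N)" for C
    using that by auto
qed

lemma nonzerodivisor_on_quot_iff:
  assumes N: "submodule N R M" and f: "f \<in> carrier R"
  shows "nonzerodivisor_on (quot_module M N) f \<longleftrightarrow>
    (\<forall>x\<in>carrier M. f \<odot>\<^bsub>M\<^esub> x \<in> N \<longrightarrow> x \<in> N)"
  using f by (simp add: nonzerodivisor_on_def quot_carrier[OF N] quot_zero[OF N] quot_smult[OF N]
      coset_eq_zero_iff[OF N])

lemma seq_submodule_Nil: "seq_submodule M [] = {\<zero>\<^bsub>M\<^esub>}"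
  unfolding seq_submodule_def by auto

text \<open>Prolonging a sequence by \<open>f\<close> adds \<open>fM\<close>, which is how \<open>extend\<close> builds up denominators.\<close>

lemma seq_submodule_snoc:
  assumes fs: "set fs \<subseteq> carrier R" and f: "f \<in> carrier R"
  shows "seq_submodule M (fs @ [f]) =
    {a \<oplus>\<^bsub>M\<^esub> f \<odot>\<^bsub>M\<^esub> x | a x. a \<in> seq_submodule M fs \<and> x \<in> carrier M}"
proof -
  let ?n = "length fs"
  have sum: "finsum M (\<lambda>i. ((fs @ [f]) ! i) \<odot>\<^bsub>M\<^esub> m i) {..<Suc ?n} =
      finsum M (\<lambda>i. (fs ! i) \<odot>\<^bsub>M\<^esub> m i) {..<?n} \<oplus>\<^bsub>M\<^esub> f \<odot>\<^bsub>M\<^esub> m ?n"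
    if m: "m \<in> {..<Suc ?n} \<rightarrow> carrier M" for m
  proof -
    have cl: "(fs ! i) \<odot>\<^bsub>M\<^esub> m i \<in> carrier M" if "i < ?n" for i
      using that fs m by (auto intro!: smult_closed)
    have "finsum M (\<lambda>i. ((fs @ [f]) ! i) \<odot>\<^bsub>M\<^esub> m i) {..<Suc ?n} =
        f \<odot>\<^bsub>M\<^esub> m ?n \<oplus>\<^bsub>M\<^esub> finsum M (\<lambda>i. ((fs @ [f]) ! i) \<odot>\<^bsub>M\<^esub> m i) {..<?n}"
      unfolding lessThan_Suc
      by (subst M.finsum_insert) (use f m cl in \<open>auto simp: nth_append Pi_iff\<close>)
    also have "finsum M (\<lambda>i. ((fs @ [f]) ! i) \<odot>\<^bsub>M\<^esub> m i) {..<?n} =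
        finsum M (\<lambda>i. (fs ! i) \<odot>\<^bsub>M\<^esub> m i) {..<?n}"
      by (rule M.finsum_cong') (use cl in \<open>auto simp: nth_append\<close>)
    finally show ?thesis
      using cl m f by (subst M.a_comm) (auto intro!: M.finsum_closed)
  qed
  show ?thesis
  proof (intro equalityI subsetI)
    fix y assume "y \<in> seq_submodule M (fs @ [f])"
    then obtain m where m: "m \<in> {..<Suc ?n} \<rightarrow> carrier M"
      "y = finsum M (\<lambda>i. ((fs @ [f]) ! i) \<odot>\<^bsub>M\<^esub> m i) {..<Suc ?n}"
      unfolding seq_submodule_def by auto
    have "finsum M (\<lambda>i. (fs ! i) \<odot>\<^bsub>M\<^esub> m i) {..<?n} \<in> seq_submodule M fs"
      unfolding seq_submodule_def mem_Collect_eq using m(1) by (intro exI[of _ m]) auto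
    then show "y \<in> {a \<oplus>\<^bsub>M\<^esub> f \<odot>\<^bsub>M\<^esub> x | a x. a \<in> seq_submodule M fs \<and> x \<in> carrier M}"
      using m sum[OF m(1)] by auto
  next
    fix y assume "y \<in> {a \<oplus>\<^bsub>M\<^esub> f \<odot>\<^bsub>M\<^esub> x | a x. a \<in> seq_submodule M fs \<and> x \<in> carrier M}"
    then obtain m x where m: "m \<in> {..<?n} \<rightarrow> carrier M" "x \<in> carrier M"
      "y = finsum M (\<lambda>i. (fs ! i) \<odot>\<^bsub>M\<^esub> m i) {..<?n} \<oplus>\<^bsub>M\<^esub> f \<odot>\<^bsub>M\<^esub> x"
      unfolding seq_submodule_def by auto
    define m' where "m' = m(?n := x)"
    have m': "m' \<in> {..<Suc ?n} \<rightarrow> carrier M" using m(1,2) by (auto simp: m'_def Pi_iff less_Suc_eq)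
    have "finsum M (\<lambda>i. (fs ! i) \<odot>\<^bsub>M\<^esub> m i) {..<?n} = finsum M (\<lambda>i. (fs ! i) \<odot>\<^bsub>M\<^esub> m' i) {..<?n}"
      by (rule M.finsum_cong') (use fs m(1) in \<open>auto simp: m'_def Pi_iff intro!: smult_closed\<close>)
    then have "y = finsum M (\<lambda>i. ((fs @ [f]) ! i) \<odot>\<^bsub>M\<^esub> m' i) {..<Suc ?n}"
      using m(3) sum[OF m'] by (simp add: m'_def)
    then show "y \<in> seq_submodule M (fs @ [f])"
      unfolding seq_submodule_def using m' by auto
  qed
qed

end

section \<open>Modules given by ideals of polynomial rings\<close>

lemma ideal_module_simps [simp]:
  "carrier (ideal_module R I) = I" "zero (ideal_module R I) = zero R"
  "add (ideal_module R I) = add R" "smult (ideal_module R I) = mult R"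
  by (simp_all add: ideal_module_def)

lemma ideal_in_polys_uminus:
  fixes I :: "'k::field mpoly set"
  assumes "ideal_in (polys X) I" "a \<in> I"
  shows "- a \<in> I"
proof -
  have "(- 1) * a \<in> I"
    using assms polys_closed(5)[OF polys_closed(2)] unfolding ideal_in_def by blast
  then show ?thesis by simp
qed

lemma module_ideal_module:
  fixes I :: "'k::field mpoly set"
  assumes "ideal_in (polys X) I"
  shows "plain_module (poly_ring X) (ideal_module (poly_ring X) I)"
proof -
  have I: "I \<subseteq> polys X" "0 \<in> I" "\<And>a b. a \<in> I \<Longrightarrow> b \<in> I \<Longrightarrow> a + b \<in> I"
      "\<And>r a. r \<in> polys X \<Longrightarrow> a \<in> I \<Longrightarrow> r * a \<in> I"
    using assms unfolding ideal_in_def by blast+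
  have neg: "- a \<in> I" if "a \<in> I" for a
    using ideal_in_polys_uminus[OF assms that] .
  show ?thesis
  proof (intro plain_module.intro moduleI[OF cring_poly_ring])
    show "abelian_group (ideal_module (poly_ring X) I)"
    proof (rule abelian_groupI)
      show "\<exists>y\<in>carrier (ideal_module (poly_ring X) I). y \<oplus>\<^bsub>ideal_module (poly_ring X) I\<^esub> x =
          \<zero>\<^bsub>ideal_module (poly_ring X) I\<^esub>" if "x \<in> carrier (ideal_module (poly_ring X) I)" for x
        using neg that by (intro bexI[of _ "- x"]) simp_all
    qed (use I in \<open>auto simp: algebra_simps\<close>)
  qed (use I in \<open>auto simp: algebra_simps\<close>)
qed

lemma submodule_ideal_module:
  fixes I :: "'k::field mpoly set"
  assumes I: "ideal_in (polys X) I" and N: "ideal_in (polys X) N" "N \<subseteq> I"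
  shows "submodule N (poly_ring X) (ideal_module (poly_ring X) I)"
proof -
  interpret plain_module "poly_ring X" "ideal_module (poly_ring X) I" by (rule module_ideal_module[OF I])
  have N': "0 \<in> N" "\<And>a b. a \<in> N \<Longrightarrow> b \<in> N \<Longrightarrow> a + b \<in> N"
      "\<And>r a. r \<in> polys X \<Longrightarrow> a \<in> N \<Longrightarrow> r * a \<in> N"
    using N(1) unfolding ideal_in_def by blast+
  show ?thesis
  proof (rule submoduleI)
    show "\<ominus>\<^bsub>ideal_module (poly_ring X) I\<^esub> a \<in> N" if a: "a \<in> N" for a
    proof -
      have "- a \<in> N" by (rule ideal_in_polys_uminus[OF N(1) a])
      moreover have "\<ominus>\<^bsub>ideal_module (poly_ring X) I\<^esub> a = - a"
        by (rule M.minus_equality) (use \<open>- a \<in> N\<close> a N(2) in auto)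
      ultimately show ?thesis by simp
    qed
  qed (use N' N(2) in auto)
qed

lemma coset_ideal_module:
  "N +>\<^bsub>ideal_module (poly_ring X) I\<^esub> x = {a + x | a. a \<in> N}"
  by (auto simp: a_r_coset_def')

lemma coset_eq_iff:
  fixes N :: "'k::field mpoly set"
  assumes "ideal_in (polys X) N"
  shows "N +>\<^bsub>ideal_module (poly_ring X) I\<^esub> x = N +>\<^bsub>ideal_module (poly_ring X) I\<^esub> y \<longleftrightarrow> x - y \<in> N"
proof -
  have N: "0 \<in> N" "\<And>a b. a \<in> N \<Longrightarrow> b \<in> N \<Longrightarrow> a + b \<in> N"
      "\<And>r a. r \<in> polys X \<Longrightarrow> a \<in> N \<Longrightarrow> r * a \<in> N"
    using assms unfolding ideal_in_def by blast+
  have neg: "- a \<in> N" if "a \<in> N" for a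
    using ideal_in_polys_uminus[OF assms that] .
  have sub: "{a + x | a. a \<in> N} \<subseteq> {a + y | a. a \<in> N}" if "x - y \<in> N" for x y
  proof
    fix z assume "z \<in> {a + x | a. a \<in> N}"
    then obtain a where "a \<in> N" "z = (a + (x - y)) + y" by auto
    then show "z \<in> {a + y | a. a \<in> N}" using that N(2) by blast
  qed
  show ?thesis unfolding coset_ideal_module
  proof
    assume eq: "{a + x | a. a \<in> N} = {a + y | a. a \<in> N}"
    have "0 + x \<in> {a + x | a. a \<in> N}" using N(1) by blast
    then obtain a where "0 + x = a + y" "a \<in> N" unfolding eq by blast
    then show "x - y \<in> N" by (simp add: algebra_simps)
  next
    assume "x - y \<in> N"
    moreover from neg[OF this] have "y - x \<in> N" by simp
    ultimately show "{a + x | a. a \<in> N} = {a + y | a. a \<in> N}" using sub by blast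
  qed
qed

section \<open>Depth of a quotient of two ideals\<close>

lemma regular_seq_iff_nth:
  "regular_seq M N fs \<longleftrightarrow> (\<forall>i<length fs. regular_on M (extends M N (take i fs)) (fs ! i))"
proof (induction fs arbitrary: N)
  case Nil
  show ?case by simp
next
  case (Cons f fs)
  show ?case by (simp add: Cons.IH All_less_Suc2)
qed

lemma ideal_in_zero_ideal: "ideal_in P {0}"  if "0 \<in> P"
  using that by (simp add: ideal_in_def)

context noetherian_subring
begin

lemma ideal_in_extends:
  assumes "ideal_in P N" "ideal_in P M" "set fs \<subseteq> P"
  shows "ideal_in P (extends M N fs)"
  using ideal_in_stages[OF assms extends_in_stages] .

lemma extends_sub:
  assumes "ideal_in P N" "ideal_in P M" "set fs \<subseteq> P" "N \<subseteq> M"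
  shows "N \<subseteq> extends M N fs \<and> extends M N fs \<subseteq> M"
  using assms
proof (induction fs arbitrary: N)
  case (Cons f fs)
  have f: "f \<in> P" "set fs \<subseteq> P" using Cons.prems(3) by auto
  have "N \<subseteq> extend M N f" using extend_mono ideal_in_zero[OF Cons.prems(2)] .
  moreover have "ideal_in P (extend M N f)" "extend M N f \<subseteq> M"
    using ideal_in_extend[OF Cons.prems(1,2) f(1)] extend_sub[OF Cons.prems(4,2) f(1)] by auto
  ultimately show ?case
    using Cons.IH[of "extend M N f"] Cons.prems(2) f(2) by auto
qed auto

end

lemma seq_submodule_ideal_module:
  fixes I :: "'k::field mpoly set"
  assumes I: "ideal_in (polys X) I"
  shows "set fs \<subseteq> polys X \<Longrightarrow> seq_submodule (ideal_module (poly_ring X) I) fs = extends I {0} fs"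
proof (induction fs rule: rev_induct)
  case Nil
  show ?case by (simp add: plain_module.seq_submodule_Nil[OF module_ideal_module[OF I]])
next
  case (snoc f fs)
  then show ?case
    by (simp add: plain_module.seq_submodule_snoc[OF module_ideal_module[OF I]] extends_append extend_def)
qed

text \<open>An ideal \<open>I\<close> is the quotient \<open>I/0\<close>, so its regular sequences are those of the pair \<open>I, 0\<close>.\<close>

lemma regular_seq_if_regular_sequence:
  fixes I :: "'k::field mpoly set"
  assumes fin: "finite X" and I: "ideal_in (polys X) I" and fs: "set fs \<subseteq> polys X"
    and reg: "regular_sequence (ideal_module (poly_ring X) I) fs"
  shows "regular_seq I {0} fs"
  unfolding regular_seq_iff_nth
proof (intro allI impI)
  interpret noetherian_subring "polys X :: 'k mpoly set" by (rule noetherian_polys[OF fin])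
  fix i assume i: "i < length fs"
  have sub: "set (take i fs) \<subseteq> polys X" using fs set_take_subset by fast
  have z: "ideal_in (polys X) {0 :: 'k mpoly}" "{0} \<subseteq> I"
    using ideal_in_zero_ideal zero_mem ideal_in_zero[OF I] by auto
  have "submodule (extends I {0} (take i fs)) (poly_ring X) (ideal_module (poly_ring X) I)"
    using submodule_ideal_module[OF I] ideal_in_extends[OF z(1) I sub] extends_sub[OF z(1) I sub z(2)] by blast
  moreover have "nonzerodivisor_on
      (quot_module (ideal_module (poly_ring X) I) (extends I {0} (take i fs))) (fs ! i)"
    using reg i unfolding regular_sequence_def seq_submodule_ideal_module[OF I sub, symmetric] by blast
  moreover have "fs ! i \<in> polys X" using fs i by (meson nth_mem subsetD)
  ultimately show "regular_on I (extends I {0} (take i fs)) (fs ! i)"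
    by (simp add: plain_module.nonzerodivisor_on_quot_iff[OF module_ideal_module[OF I]] regular_on_def)
qed

text \<open>The module \<open>V/U\<close>, with \<open>cls x\<close> the class of \<open>x\<close>. Regular sequences on it involve quotients of a
  quotient module; the lemmas below bring them back to denominators between \<open>U\<close> and \<open>V\<close>.\<close>

locale ideal_quotient =
  fixes X :: "nat set" and V U :: "'k::field mpoly set"
  assumes finite_vars: "finite X"
    and V: "ideal_in (polys X) V" and U: "ideal_in (polys X) U" and UV: "U \<subseteq> V"
begin

sublocale noetherian_subring "polys X :: 'k mpoly set"
  by (rule noetherian_polys[OF finite_vars])

abbreviation "R \<equiv> poly_ring X :: 'k mpoly ring"
abbreviation "MV \<equiv> ideal_module R V"
abbreviation "Q \<equiv> quot_module MV U"
abbreviation "cls x \<equiv> U +>\<^bsub>MV\<^esub> x"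

lemma module_V: "plain_module R MV" by (rule module_ideal_module[OF V])

lemma submodule_U: "submodule U R MV" by (rule submodule_ideal_module[OF V U UV])

lemma module_Q: "plain_module R Q" by (rule plain_module.module_quot[OF module_V submodule_U])

lemma Q_carrier: "carrier Q = cls ` V"
  using plain_module.quot_carrier[OF module_V submodule_U] by simp

lemma Q_zero: "\<zero>\<^bsub>Q\<^esub> = U"
  using plain_module.quot_zero[OF module_V submodule_U] .

lemma Q_add: "x \<in> V \<Longrightarrow> y \<in> V \<Longrightarrow> cls x \<oplus>\<^bsub>Q\<^esub> cls y = cls (x + y)"
  using plain_module.quot_add[OF module_V submodule_U] by simp

lemma Q_smult: "r \<in> polys X \<Longrightarrow> x \<in> V \<Longrightarrow> r \<odot>\<^bsub>Q\<^esub> cls x = cls (r * x)"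
  using plain_module.quot_smult[OF module_V submodule_U] by simp

lemma cls_eq_iff: "cls x = cls y \<longleftrightarrow> x - y \<in> U"
  by (rule coset_eq_iff[OF U])

lemma cls_eq_zero_iff: "x \<in> V \<Longrightarrow> cls x = U \<longleftrightarrow> x \<in> U"
  using plain_module.coset_eq_zero_iff[OF module_V submodule_U] by simp

lemma cls_mem_image_iff:
  assumes E: "ideal_in (polys X) E" "U \<subseteq> E" and x: "x \<in> V"
  shows "cls x \<in> cls ` E \<longleftrightarrow> x \<in> E"
proof
  assume "cls x \<in> cls ` E"
  then obtain y where y: "y \<in> E" "cls x = cls y" by blast
  then have "x - y \<in> E" using E(2) unfolding cls_eq_iff by blast
  then have "(x - y) + y \<in> E" using y(1) by (rule ideal_in_add[OF E(1)])
  then show "x \<in> E" by simp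
qed auto

lemma submodule_image:
  assumes E: "ideal_in (polys X) E" "U \<subseteq> E" "E \<subseteq> V"
  shows "submodule (cls ` E) R Q"
proof -
  interpret Q: plain_module R Q by (rule module_Q)
  show ?thesis
  proof (rule Q.submoduleI)
    show "cls ` E \<subseteq> carrier Q" using E(3) unfolding Q_carrier by blast
    show "\<zero>\<^bsub>Q\<^esub> \<in> cls ` E"
      unfolding Q_zero using cls_eq_zero_iff[of 0] ideal_in_zero[OF V] ideal_in_zero[OF U] ideal_in_zero[OF E(1)]
      by (intro image_eqI[of _ _ 0]) auto
    show "\<ominus>\<^bsub>Q\<^esub> C \<in> cls ` E" if C: "C \<in> cls ` E" for C
    proof -
      obtain x where x: "x \<in> E" "C = cls x" using C by blast
      have mx: "- x \<in> E" by (rule ideal_in_uminus[OF E(1) x(1)])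
      have "cls (- x) \<oplus>\<^bsub>Q\<^esub> cls x = \<zero>\<^bsub>Q\<^esub>"
        using x mx E(3) cls_eq_zero_iff[of 0] ideal_in_zero[OF V] ideal_in_zero[OF U]
        by (subst Q_add) (auto simp: Q_zero)
      then have "\<ominus>\<^bsub>Q\<^esub> cls x = cls (- x)"
        using x mx E(3) by (intro Q.M.minus_equality) (auto simp: Q_carrier)
      then show ?thesis using mx x by simp
    qed
    show "C \<oplus>\<^bsub>Q\<^esub> D \<in> cls ` E" if CD: "C \<in> cls ` E" "D \<in> cls ` E" for C D
    proof -
      obtain x y where x: "x \<in> E" "C = cls x" "y \<in> E" "D = cls y" using CD by blast
      then have "C \<oplus>\<^bsub>Q\<^esub> D = cls (x + y)" using E(3) Q_add by blast
      then show ?thesis using ideal_in_add[OF E(1) x(1,3)] by simp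
    qed
    show "r \<odot>\<^bsub>Q\<^esub> C \<in> cls ` E" if C: "r \<in> carrier R" "C \<in> cls ` E" for r C
    proof -
      obtain x where x: "x \<in> E" "C = cls x" using C by blast
      then have "r \<odot>\<^bsub>Q\<^esub> C = cls (r * x)" using E(3) C(1) Q_smult by blast
      then show ?thesis using ideal_in_mult[OF E(1) C(1) x(1)] by simp
    qed
  qed
qed

lemma seq_submodule_Q:
  "set fs \<subseteq> polys X \<Longrightarrow> seq_submodule Q fs = cls ` extends V U fs"
proof (induction fs rule: rev_induct)
  case Nil
  have "cls ` U = {U}"
  proof
    show "cls ` U \<subseteq> {U}" using cls_eq_zero_iff UV by blast
    show "{U} \<subseteq> cls ` U"
      using cls_eq_zero_iff[of 0] ideal_in_zero[OF V] ideal_in_zero[OF U] by (auto intro: image_eqI[of _ _ 0])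
  qed
  then show ?case by (simp add: plain_module.seq_submodule_Nil[OF module_Q] Q_zero)
next
  case (snoc f fs)
  have fs: "set fs \<subseteq> polys X" "f \<in> polys X" using snoc.prems by auto
  let ?E = "extends V U fs"
  have EV: "?E \<subseteq> V" by (rule extends_sub[OF U V fs(1) UV, THEN conjunct2])
  have sum: "cls a \<oplus>\<^bsub>Q\<^esub> f \<odot>\<^bsub>Q\<^esub> cls x = cls (a + f * x)" if "a \<in> ?E" "x \<in> V" for a x
  proof -
    have "a \<in> V" "f * x \<in> V" using that EV ideal_in_mult[OF V fs(2)] by auto
    then show ?thesis using that(2) fs(2) by (simp add: Q_smult Q_add)
  qed
  have "seq_submodule Q (fs @ [f]) =
      {a \<oplus>\<^bsub>Q\<^esub> f \<odot>\<^bsub>Q\<^esub> x | a x. a \<in> cls ` ?E \<and> x \<in> cls ` V}"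
    using snoc fs by (simp add: plain_module.seq_submodule_snoc[OF module_Q] Q_carrier)
  also have "\<dots> = {cls a \<oplus>\<^bsub>Q\<^esub> f \<odot>\<^bsub>Q\<^esub> cls x | a x. a \<in> ?E \<and> x \<in> V}" by blast
  also have "\<dots> = {cls (a + f * x) | a x. a \<in> ?E \<and> x \<in> V}"
    using sum by (intro Collect_cong) metis
  also have "\<dots> = cls ` extend V ?E f" unfolding extend_def by blast
  finally show ?case by (simp add: extends_append)
qed

lemma regular_sequence_Q:
  assumes fs: "set fs \<subseteq> polys X" and reg: "regular_seq V U fs" and proper: "extends V U fs \<noteq> V"
  shows "regular_sequence Q fs"
  unfolding regular_sequence_def
proof (intro conjI allI impI)
  fix i assume i: "i < length fs"
  have sub: "set (take i fs) \<subseteq> polys X" using fs set_take_subset by fast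
  have f: "fs ! i \<in> polys X" using fs i by (meson nth_mem subsetD)
  let ?E = "extends V U (take i fs)"
  have E: "ideal_in (polys X) ?E" "U \<subseteq> ?E" "?E \<subseteq> V"
    using ideal_in_extends[OF U V sub] extends_sub[OF U V sub UV] by auto
  have r: "regular_on V ?E (fs ! i)" using reg i unfolding regular_seq_iff_nth by blast
  have "C \<in> cls ` ?E" if C: "C \<in> carrier Q" "fs ! i \<odot>\<^bsub>Q\<^esub> C \<in> cls ` ?E" for C
  proof -
    obtain x where x: "x \<in> V" "C = cls x" using C(1) unfolding Q_carrier by blast
    have "cls (fs ! i * x) \<in> cls ` ?E" using C(2) x f by (simp add: Q_smult)
    then have "fs ! i * x \<in> ?E" using cls_mem_image_iff[OF E(1,2)] ideal_in_mult[OF V f x(1)] by blast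
    then show ?thesis using r x unfolding regular_on_def by blast
  qed
  then show "nonzerodivisor_on (quot_module Q (seq_submodule Q (take i fs))) (fs ! i)"
    unfolding seq_submodule_Q[OF sub]
    using plain_module.nonzerodivisor_on_quot_iff[OF module_Q submodule_image[OF E], of "fs ! i"] f by blast
next
  have E: "ideal_in (polys X) (extends V U fs)" "U \<subseteq> extends V U fs" "extends V U fs \<subseteq> V"
    using ideal_in_extends[OF U V fs] extends_sub[OF U V fs UV] by auto
  obtain x where x: "x \<in> V" "x \<notin> extends V U fs" using proper E(3) by blast
  then have "cls x \<notin> cls ` extends V U fs" using cls_mem_image_iff[OF E(1,2)] by blast
  then show "seq_submodule Q fs \<noteq> carrier Q"
    unfolding seq_submodule_Q[OF fs] Q_carrier using x(1) by blast
qed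

text \<open>If \<open>V = U\<close>, the module is zero and its depth is infinite by convention; in all other cases the
  given sequence also has to satisfy \<open>fs \<cdot> (V/U) \<noteq> V/U\<close>.\<close>

lemma depth_quot_ge:
  assumes fs: "set fs \<subseteq> graded_maximal_ideal X" and reg: "regular_seq V U fs"
    and proper: "V = U \<or> extends V U fs \<noteq> V"
  shows "enat (length fs) \<le> depth_quot X V U"
proof (cases "V = U")
  case True
  then have "carrier Q = {\<zero>\<^bsub>Q\<^esub>}"
    using cls_eq_zero_iff ideal_in_zero[OF U] unfolding Q_carrier Q_zero by auto
  then show ?thesis by (simp add: depth_quot_def depth_def depth_wrt_def)
next
  case False
  have "set fs \<subseteq> polys X" using fs unfolding graded_maximal_ideal_eq by blast
  then have "regular_sequence Q fs" using False reg proper by (intro regular_sequence_Q) auto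
  then show ?thesis
    using fs unfolding depth_quot_def depth_def depth_wrt_def by (auto intro!: Sup_upper)
qed

end


section \<open>Coefficients with respect to one variable\<close>

text \<open>The coefficient of \<open>x\<^sub>n\<^sup>j\<close> in \<open>p\<close>, a polynomial in the other variables: its monomials are the \<open>s\<close>
  without \<open>x\<^sub>n\<close>, with the coefficient of \<open>s x\<^sub>n\<^sup>j\<close> in \<open>p\<close>.\<close>

lift_definition var_coeff :: "nat \<Rightarrow> nat \<Rightarrow> 'k::field mpoly \<Rightarrow> 'k mpoly" is
  "\<lambda>n j p s. if lookup s n = 0 then p (s + single n j) else 0"
proof -
  fix n j :: nat and p :: "(nat \<Rightarrow>\<^sub>0 nat) \<Rightarrow> 'k"
  assume "finite {t. p t \<noteq> 0}"
  then have "finite ((\<lambda>s. s + single n j) -` {t. p t \<noteq> 0})"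
    by (rule finite_vimageI) (simp add: inj_on_def)
  then show "finite {s. (if lookup s n = 0 then p (s + single n j) else 0) \<noteq> 0}"
    by (rule finite_subset[rotated]) auto
qed

lemmas lookup_var_coeff = var_coeff.rep_eq

lemma var_coeff_zero [simp]: "var_coeff n j 0 = 0"
  by (rule poly_mapping_eqI) (simp add: lookup_var_coeff)

lemma var_coeff_add: "var_coeff n j (p + q) = var_coeff n j p + var_coeff n j q"
  by (rule poly_mapping_eqI) (simp add: lookup_var_coeff lookup_add)

lemma lookup_zero_if_keys_sub:
  "keys t \<subseteq> X \<Longrightarrow> n \<notin> X \<Longrightarrow> lookup t n = 0"
  by (auto simp: in_keys_iff)

lemma var_coeff_single:
  "var_coeff n j (single t c) =
    (if lookup t n = j then single (t - single n j) c else 0)"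
proof (rule poly_mapping_eqI)
  fix s :: "nat \<Rightarrow>\<^sub>0 nat"
  have *: "t = s + single n j \<and> lookup s n = 0 \<longleftrightarrow>
      lookup t n = j \<and> s = t - single n j"
  proof
    assume "t = s + single n j \<and> lookup s n = 0"
    then show "lookup t n = j \<and> s = t - single n j"
      by (simp add: lookup_add)
  next
    assume *: "lookup t n = j \<and> s = t - single n j"
    then have "t = s + single n j"
      by (intro poly_mapping_eqI) (auto simp: lookup_add lookup_minus lookup_single when_def)
    then show "t = s + single n j \<and> lookup s n = 0"
      using * by (simp add: lookup_minus)
  qed
  show "lookup (var_coeff n j (single t c)) s =
      lookup (if lookup t n = j
        then single (t - single n j) c else 0) s"
  proof (cases "t = s + single n j \<and> lookup s n = 0")
    case True
    moreover from this have "lookup t n = j \<and> s = t - single n j"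
      using * by simp
    ultimately show ?thesis by (simp add: lookup_var_coeff)
  next
    case False
    moreover from this have "\<not> (lookup t n = j \<and> s = t - single n j)"
      using * by simp
    ultimately show ?thesis by (auto simp: lookup_var_coeff lookup_single when_def)
  qed
qed

text \<open>Taking coefficients with respect to \<open>x\<^sub>n\<close> is linear over the polynomials without \<open>x\<^sub>n\<close>. By
  additivity in both factors it is enough to multiply two terms.\<close>

lemma var_coeff_times:
  fixes g m :: "'k::field mpoly"
  assumes g: "g \<in> polys X" and n: "n \<notin> X"
  shows "var_coeff n j (g * m) = g * var_coeff n j m"
proof -
  have mult_term: "var_coeff n j (single t c * m) = single t c * var_coeff n j m"
    if t: "lookup t n = 0" for t and c :: 'k and m
  proof -
    have "m \<in> {m. var_coeff n j (single t c * m) = single t c * var_coeff n j m}"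
    proof (rule mem_if_terms_mem)
      fix s
      have "t + s - single n j = t + (s - single n j)"
        if "lookup s n = j"
        by (rule poly_mapping_eqI) (use that in \<open>auto simp: lookup_add lookup_minus lookup_single when_def\<close>)
      then show "single s (lookup m s)
          \<in> {m. var_coeff n j (single t c * m) = single t c * var_coeff n j m}"
        using t by (simp add: mult_single var_coeff_single lookup_add)
    qed (simp_all add: var_coeff_add distrib_left)
    then show ?thesis by simp
  qed
  have "g \<in> {g. var_coeff n j (g * m) = g * var_coeff n j m}"
  proof (rule mem_if_terms_mem)
    fix t assume "t \<in> keys g"
    then have "lookup t n = 0"
      using g n unfolding polys_iff by (intro lookup_zero_if_keys_sub[of t X n]) auto
    then show "single t (lookup g t) \<in> {g. var_coeff n j (g * m) = g * var_coeff n j m}"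
      using mult_term by simp
  qed (simp_all add: var_coeff_add distrib_right)
  then show ?thesis by simp
qed

lemma var_coeff_id:
  assumes "p \<in> polys X" "n \<notin> X"
  shows "var_coeff n 0 p = p"
proof (rule poly_mapping_eqI)
  fix s
  have "lookup p s = 0" if "lookup s n \<noteq> 0"
  proof -
    have "s \<notin> keys p"
      using assms that lookup_zero_if_keys_sub[of s X n] unfolding polys_iff by metis
    then show ?thesis by (simp add: in_keys_iff)
  qed
  then show "lookup (var_coeff n 0 p) s = lookup p s"
    by (simp add: lookup_var_coeff)
qed

lemma var_coeff_indet_times:
  "var_coeff n 0 (indet n * p) = 0"
  "var_coeff n 1 (indet n * p) = var_coeff n 0 p"
proof -
  have "lookup (indet n * p) s = 0" if s: "lookup s n = 0" for s
  proof (rule ccontr)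
    assume "lookup (indet n * p) s \<noteq> 0"
    then have "s \<in> keys (indet n * p)" by (simp add: in_keys_iff)
    then obtain a b where "s = a + b" "a \<in> keys (indet n :: 'a mpoly)" by (rule in_keys_timesE)
    then show False using s by (simp add: indet_def monomial_def lookup_add)
  qed
  then show "var_coeff n 0 (indet n * p) = 0"
    by (intro poly_mapping_eqI) (simp add: lookup_var_coeff)
  have "lookup (indet n * p) (s + single n 1) = lookup p s" for s
    using lookup_single_times[of "single n 1" 1 p s]
    by (simp add: indet_def monomial_def add.commute)
  then show "var_coeff n 1 (indet n * p) = var_coeff n 0 p"
    by (intro poly_mapping_eqI) (simp add: lookup_var_coeff)
qed

lemma var_coeff_in_polys:
  assumes "p \<in> polys (insert n X)"
  shows "var_coeff n j p \<in> polys X"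
  unfolding polys_iff
proof
  fix s assume "s \<in> keys (var_coeff n j p)"
  then have s: "lookup s n = 0" "s + single n j \<in> keys p"
    by (auto simp: in_keys_iff lookup_var_coeff split: if_splits)
  then have "keys (s + single n j) \<subseteq> insert n X"
    using assms unfolding polys_iff by blast
  then show "keys s \<subseteq> X" using s(1) by (auto simp: keys_plus_exponent in_keys_iff)
qed

text \<open>This is why a polynomial acts on any module killed by \<open>x\<^sub>n\<close> through its value at \<open>x\<^sub>n = 0\<close>.\<close>

lemma split_off_var:
  fixes p :: "'k::field mpoly"
  assumes p: "p \<in> polys (insert n X)"
  shows "\<exists>h\<in>polys (insert n X). p = var_coeff n 0 p + indet n * h"
proof -
  have "p \<in> {p. \<exists>h\<in>polys (insert n X). p = var_coeff n 0 p + indet n * h}"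
  proof (rule mem_if_terms_mem)
    show "0 \<in> {p. \<exists>h\<in>polys (insert n X). p = var_coeff n 0 p + indet n * h}"
      using polys_closed(1) by (auto intro!: bexI[of _ 0])
  next
    fix a b :: "'k mpoly" assume "a \<in> {p. \<exists>h\<in>polys (insert n X). p = var_coeff n 0 p + indet n * h}"
      "b \<in> {p. \<exists>h\<in>polys (insert n X). p = var_coeff n 0 p + indet n * h}"
    then obtain h k where hk: "h \<in> polys (insert n X)" "k \<in> polys (insert n X)"
      "a = var_coeff n 0 a + indet n * h" "b = var_coeff n 0 b + indet n * k" by blast
    have "a + b = (var_coeff n 0 a + indet n * h) + (var_coeff n 0 b + indet n * k)"
      using hk(3,4) by simp
    also have "\<dots> = var_coeff n 0 (a + b) + indet n * (h + k)"
      by (simp add: var_coeff_add algebra_simps)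
    finally show "a + b \<in> {p. \<exists>h\<in>polys (insert n X). p = var_coeff n 0 p + indet n * h}"
      using polys_closed(3)[OF hk(1,2)] by blast
  next
    fix t assume t: "t \<in> keys p"
    define c where "c = lookup p t"
    have tX: "keys t \<subseteq> insert n X" using p t unfolding polys_iff by blast
    show "single t c \<in> {p. \<exists>h\<in>polys (insert n X). p = var_coeff n 0 p + indet n * h}"
    proof (cases "lookup t n = 0")
      case True
      then have "single t c = var_coeff n 0 (single t c) + indet n * 0"
        by (simp add: var_coeff_single)
      then show ?thesis using polys_closed(1) by blast
    next
      case False
      let ?s = "t - single n 1"
      have t': "t = single n 1 + ?s"
        by (rule poly_mapping_eqI) (use False in \<open>auto simp: lookup_add lookup_minus lookup_single when_def\<close>)
      have "indet n * single ?s c = single (single n 1 + ?s) c"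
        by (simp add: indet_def monomial_def mult_single)
      then have "single t c =
          var_coeff n 0 (single t c) + indet n * single ?s c"
        using False t' by (simp add: var_coeff_single)
      moreover have "keys ?s \<subseteq> insert n X"
        using tX by (subst (asm) t') (simp add: keys_plus_exponent)
      ultimately show ?thesis using single_in_polys by blast
    qed
  qed
  then show ?thesis by blast
qed

section \<open>Supports of squarefree monomial ideals\<close>

definition support_exponents :: "nat set \<Rightarrow> nat set set \<Rightarrow> (nat \<Rightarrow>\<^sub>0 nat) set" where
  "support_exponents X \<F> = {t. keys t \<subseteq> X \<and> (\<exists>F\<in>\<F>. F \<subseteq> keys t)}"

lemma support_ideal_iff:
  "p \<in> support_ideal X \<F> \<longleftrightarrow> keys p \<subseteq> support_exponents X \<F>"
  by (auto simp: support_ideal_def support_exponents_def)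

lemma support_exponents_add:
  "s \<in> support_exponents X \<F> \<Longrightarrow> keys r \<subseteq> X \<Longrightarrow> r + s \<in> support_exponents X \<F>"
  unfolding support_exponents_def mem_Collect_eq keys_plus_exponent by blast

lemma ideal_in_support_ideal: "ideal_in (polys X) (support_ideal X \<F> :: 'k::field mpoly set)"
  unfolding ideal_in_def
proof (intro conjI ballI)
  show "support_ideal X \<F> \<subseteq> (polys X :: 'k mpoly set)" by (auto simp: support_ideal_def polys_iff)
  show "0 \<in> (support_ideal X \<F> :: 'k mpoly set)" by (simp add: support_ideal_def)
next
  fix p q :: "'k mpoly" assume "p \<in> support_ideal X \<F>" "q \<in> support_ideal X \<F>"
  then show "p + q \<in> support_ideal X \<F>"
    unfolding support_ideal_iff using keys_add[of p q] by (meson Un_least order_trans)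
next
  fix r p :: "'k mpoly" assume r: "r \<in> polys X" and p: "p \<in> support_ideal X \<F>"
  show "r * p \<in> support_ideal X \<F>"
    unfolding support_ideal_iff
  proof
    fix t assume "t \<in> keys (r * p)"
    then obtain a b where ab: "t = a + b" "a \<in> keys r" "b \<in> keys p"
      by (rule in_keys_timesE)
    have "keys a \<subseteq> X" using r ab(2) by (simp add: polys_iff)
    moreover have "b \<in> support_exponents X \<F>" using p ab(3) unfolding support_ideal_iff by (rule subsetD)
    ultimately show "t \<in> support_exponents X \<F>" unfolding ab(1) by (rule support_exponents_add[rotated])
  qed
qed

lemma support_ideal_empty: "support_ideal X {} = ({0} :: 'k::field mpoly set)"
proof -
  have "p = 0" if "keys p = {}" for p :: "'k mpoly"
    using that by (metis poly_mapping_eqI lookup_zero in_keys_iff empty_iff)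
  then show ?thesis by (auto simp: support_ideal_def)
qed

text \<open>Nakayama's lemma for the graded module \<open>V/U\<close>: a monomial of least total degree in \<open>V\<close> outside
  \<open>U\<close> does not occur in any element of \<open>U + mV\<close>, because elements of \<open>m\<close> have no constant term.\<close>

lemma extends_support_ideal_proper:
  fixes U V :: "'k::field mpoly set"
  assumes fin: "finite X" and V: "V = support_ideal X \<F>" and U: "U = support_ideal X \<G>"
    and UV: "U \<subseteq> V" "U \<noteq> V" and fs: "set fs \<subseteq> graded_maximal_ideal X"
  shows "extends V U fs \<noteq> V"
proof -
  \<comment> \<open>The total degree.\<close>
  define d where "d t = (\<Sum>i\<in>X. lookup t i)" for t :: "nat \<Rightarrow>\<^sub>0 nat"
  have d_add: "d (s + t) = d s + d t" for s t by (simp add: d_def lookup_add sum.distrib)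
  have d_pos: "d t > 0" if t: "keys t \<subseteq> X" "t \<noteq> 0" for t
  proof -
    obtain i where i: "lookup t i \<noteq> 0" using t(2) by (metis lookup_zero poly_mapping_eqI)
    then have "i \<in> X" using t(1) by (auto simp: in_keys_iff)
    then have "lookup t i \<le> d t" unfolding d_def by (intro member_le_sum) (use fin in auto)
    then show ?thesis using i by simp
  qed
  let ?A = "support_exponents X \<F>" and ?B = "support_exponents X \<G>"
  obtain p where p: "p \<in> V" "p \<notin> U" using UV by blast
  then have "keys p \<subseteq> ?A" "\<not> keys p \<subseteq> ?B"
    unfolding V U support_ideal_iff by simp_all
  then have "\<exists>t. t \<in> ?A - ?B" by blast
  then obtain t where t: "t \<in> ?A - ?B" and min: "\<And>s. s \<in> ?A - ?B \<Longrightarrow> d t \<le> d s"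
    using ex_has_least_nat[of "\<lambda>t. t \<in> ?A - ?B" _ d] by blast
  have inv: "\<forall>p\<in>extends V N gs. t \<notin> keys p"
    if "\<forall>p\<in>N. t \<notin> keys p" "set gs \<subseteq> graded_maximal_ideal X" for N gs
    using that
  proof (induction gs arbitrary: N)
    case Nil
    then show ?case by simp
  next
    case (Cons g gs)
    have "g \<in> graded_maximal_ideal X" using Cons.prems(2) by simp
    then have g: "g \<in> polys X" "lookup g 0 = 0" unfolding graded_maximal_ideal_eq by auto
    have "\<forall>p\<in>extend V N g. t \<notin> keys p"
    proof (intro ballI notI)
      fix p assume "p \<in> extend V N g" and tp: "t \<in> keys p"
      then obtain a m where m: "p = a + g * m" "a \<in> N" "m \<in> V" by (elim extendE)
      have "t \<in> keys (g * m)"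
        using tp in_keys_plusE[of t a "g * m"] Cons.prems(1) m by blast
      then obtain r s where rs: "t = r + s" "r \<in> keys g" "s \<in> keys m"
        by (rule in_keys_timesE)
      have r: "keys r \<subseteq> X" using g(1) rs(2) unfolding polys_iff by blast
      have "r \<noteq> 0" using g(2) rs(2) by (auto simp: in_keys_iff)
      have "s \<in> ?A" using m(3) rs(3) unfolding V support_ideal_iff by blast
      moreover have "s \<notin> ?B" using support_exponents_add[of s X \<G> r] r t rs(1) by blast
      ultimately have "d t \<le> d s" using min by blast
      then show False using d_pos[OF r \<open>r \<noteq> 0\<close>] d_add[of r s] rs(1) by simp
    qed
    then show ?case using Cons.IH[of "extend V N g"] Cons.prems(2) by simp
  qed
  have "\<forall>p\<in>U. t \<notin> keys p" using t by (auto simp: U support_ideal_iff)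
  then have "\<forall>p\<in>extends V U fs. t \<notin> keys p" using fs by (rule inv)
  moreover have "single t 1 \<in> V" using t unfolding V support_ideal_iff by simp
  moreover have "t \<in> keys (single t 1 :: 'k mpoly)" by simp
  ultimately show ?thesis by blast
qed

section \<open>The two slices of a squarefree monomial ideal\<close>

text \<open>Here \<open>U = I \<inter> K[X]\<close> and \<open>V = (I : x\<^sub>n) \<inter> K[X]\<close>, written through the supports of generators:
  those without \<open>n\<close> generate \<open>U\<close>, and removing \<open>n\<close> from all of them gives generators of \<open>V\<close>.\<close>

locale squarefree_slices =
  fixes X :: "nat set" and n :: nat and \<F> :: "nat set set" and I U V :: "'k::field mpoly set"
  assumes fin: "finite X" and n: "n \<notin> X"
    and I_def: "I = support_ideal (insert n X) \<F>"
    and U_def: "U = support_ideal X {F \<in> \<F>. n \<notin> F}"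
    and V_def: "V = support_ideal X ((\<lambda>F. F - {n}) ` \<F>)"
begin

lemma exponent_U_iff:
  assumes "keys t \<subseteq> X"
  shows "t \<in> support_exponents X {F \<in> \<F>. n \<notin> F} \<longleftrightarrow> t \<in> support_exponents (insert n X) \<F>"
  using assms n unfolding support_exponents_def by blast

lemma exponent_V_iff:
  assumes "keys t \<subseteq> X" "j > 0"
  shows "t \<in> support_exponents X ((\<lambda>F. F - {n}) ` \<F>) \<longleftrightarrow>
    t + single n j \<in> support_exponents (insert n X) \<F>"
  using assms unfolding support_exponents_def mem_Collect_eq keys_plus_exponent by auto

lemma U_sub_V: "U \<subseteq> V"
  unfolding U_def V_def support_ideal_def by blast

lemma ideals: "ideal_in (polys (insert n X)) I" "ideal_in (polys X) U" "ideal_in (polys X) V"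
  unfolding I_def U_def V_def by (rule ideal_in_support_ideal)+

lemma key_var_coeff:
  assumes "p \<in> I" "s \<in> keys (var_coeff n j p)"
  shows "keys s \<subseteq> X" "s + single n j \<in> support_exponents (insert n X) \<F>"
proof -
  have "p \<in> polys (insert n X)" using assms(1) ideals(1) unfolding ideal_in_def by blast
  then show "keys s \<subseteq> X"
    using var_coeff_in_polys assms(2) unfolding polys_iff by blast
  have "s + single n j \<in> keys p"
    using assms(2) by (auto simp: in_keys_iff lookup_var_coeff split: if_splits)
  then show "s + single n j \<in> support_exponents (insert n X) \<F>"
    using assms(1) unfolding I_def support_ideal_iff by blast
qed

lemma var_coeff_0_in_U:
  assumes p: "p \<in> I"
  shows "var_coeff n 0 p \<in> U"
  unfolding U_def support_ideal_iff
proof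
  fix s assume "s \<in> keys (var_coeff n 0 p)"
  note s = key_var_coeff[OF p this]
  show "s \<in> support_exponents X {F \<in> \<F>. n \<notin> F}" using exponent_U_iff[OF s(1)] s(2) by simp
qed

lemma var_coeff_1_in_V:
  assumes p: "p \<in> I"
  shows "var_coeff n 1 p \<in> V"
  unfolding V_def support_ideal_iff
proof
  fix s assume "s \<in> keys (var_coeff n 1 p)"
  note s = key_var_coeff[OF p this]
  show "s \<in> support_exponents X ((\<lambda>F. F - {n}) ` \<F>)" using exponent_V_iff[OF s(1), of 1] s(2) by simp
qed

lemma U_sub_I: "U \<subseteq> I"
  unfolding U_def I_def support_ideal_def by blast

lemma indet_times_V:
  assumes v: "v \<in> V"
  shows "indet n * v \<in> I"
  unfolding I_def support_ideal_iff
proof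
  fix t assume "t \<in> keys (indet n * v)"
  then obtain a b where ab: "t = a + b" "a \<in> keys (indet n :: 'k mpoly)" "b \<in> keys v"
    by (rule in_keys_timesE)
  have "a = single n 1" using ab(2) by (simp add: indet_def monomial_def)
  then have t: "t = b + single n 1" using ab(1) by (simp add: add.commute)
  have b: "b \<in> support_exponents X ((\<lambda>F. F - {n}) ` \<F>)"
    using v ab(3) unfolding V_def support_ideal_iff by blast
  then have "keys b \<subseteq> X" unfolding support_exponents_def by blast
  then show "t \<in> support_exponents (insert n X) \<F>" using exponent_V_iff[of b 1] b t by simp
qed

lemma U_V_in_polys: "u \<in> U \<Longrightarrow> u \<in> polys X" "v \<in> V \<Longrightarrow> v \<in> polys X"
  using ideals(2,3) unfolding ideal_in_def by blast+

lemma indet_in_polys: "indet n \<in> (polys (insert n X) :: 'k mpoly set)"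
  by (auto simp: indet_def monomial_def polys_iff)

text \<open>The inductive form of the isomorphism \<open>I/x\<^sub>nI = U \<oplus> x\<^sub>n(V/U)\<close>. The denominator \<open>N\<close> contains
  \<open>x\<^sub>nI\<close>, its elements have components in \<open>A\<close> and \<open>B\<close> of \<open>x\<^sub>n\<close>-degree \<open>0\<close> and \<open>1\<close>, and conversely
  \<open>A\<close> and \<open>x\<^sub>nB\<close> lie in \<open>N\<close>. Since \<open>x\<^sub>n\<close> kills \<open>I/N\<close>, an element \<open>z\<close> acts on it as its value \<open>z'\<close>
  at \<open>x\<^sub>n = 0\<close>, and the property passes from \<open>N, A, B\<close> to \<open>N + zI\<close>, \<open>A + z'U\<close>, \<open>B + z'V\<close>.\<close>

lemma split_regular_seq:
  assumes N: "ideal_in (polys (insert n X)) N" "\<And>p. p \<in> I \<Longrightarrow> indet n * p \<in> N"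
    and low: "\<And>p. p \<in> N \<Longrightarrow> var_coeff n 0 p \<in> A" "\<And>p. p \<in> N \<Longrightarrow> var_coeff n 1 p \<in> B"
    and up: "A \<subseteq> N" "\<And>b. b \<in> B \<Longrightarrow> indet n * b \<in> N"
    and zs: "set zs \<subseteq> polys (insert n X)" and reg: "regular_seq I N zs"
  shows "regular_seq U A (map (var_coeff n 0) zs) \<and> regular_seq V B (map (var_coeff n 0) zs)"
  using assms
proof (induction zs arbitrary: N A B)
  case Nil
  show ?case by simp
next
  case (Cons z zs)
  note N = Cons.prems(1,2) and low = Cons.prems(3,4) and up = Cons.prems(5,6)
  interpret noetherian_subring "polys (insert n X) :: 'k mpoly set"
    by (rule noetherian_polys) (use fin in simp)
  have z: "z \<in> polys (insert n X)" and zs: "set zs \<subseteq> polys (insert n X)" using Cons.prems(7) by auto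
  have reg: "regular_on I N z" "regular_seq I (extend I N z) zs" using Cons.prems(8) by auto
  define z' where "z' = var_coeff n 0 z"
  have z': "z' \<in> polys X" unfolding z'_def by (rule var_coeff_in_polys[OF z])
  obtain h where h: "h \<in> polys (insert n X)" "z = z' + indet n * h"
    using split_off_var[OF z] unfolding z'_def by blast
  \<comment> \<open>Modulo \<open>N\<close>, the actions of \<open>z\<close> and \<open>z'\<close> agree.\<close>
  have zm: "\<exists>e\<in>N. z * m = z' * m + e" if m: "m \<in> I" for m
  proof -
    have "indet n * (h * m) \<in> N" using N(2) ideal_in_mult[OF ideals(1) h(1) m] .
    moreover have "z * m = z' * m + indet n * (h * m)" unfolding h(2) by (simp add: algebra_simps)
    ultimately show ?thesis by blast
  qed
  have "regular_on U A z'"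
    unfolding regular_on_def
  proof (intro ballI impI)
    fix u assume u: "u \<in> U" "z' * u \<in> A"
    then have uI: "u \<in> I" using U_sub_I by blast
    obtain e where e: "e \<in> N" "z * u = z' * u + e" using zm[OF uI] by blast
    have "z' * u + e \<in> N" using ideal_in_add[OF N(1) _ e(1)] u(2) up(1) by blast
    then have "u \<in> N" using reg(1) uI e(2) unfolding regular_on_def by simp
    then have "var_coeff n 0 u \<in> A" by (rule low(1))
    then show "u \<in> A" using var_coeff_id[OF U_V_in_polys(1)[OF u(1)] n] by simp
  qed
  moreover have "regular_on V B z'"
    unfolding regular_on_def
  proof (intro ballI impI)
    fix v assume v: "v \<in> V" "z' * v \<in> B"
    let ?m = "indet n * v"
    have mI: "?m \<in> I" by (rule indet_times_V[OF v(1)])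
    obtain e where e: "e \<in> N" "z * ?m = z' * ?m + e" using zm[OF mI] by blast
    have "z' * ?m = indet n * (z' * v)" by (simp add: mult.left_commute)
    then have "z' * ?m + e \<in> N" using ideal_in_add[OF N(1) up(2)[OF v(2)] e(1)] by metis
    then have "?m \<in> N" using reg(1) mI e(2) unfolding regular_on_def by simp
    then have "var_coeff n 1 ?m \<in> B" by (rule low(2))
    then show "v \<in> B" using var_coeff_id[OF U_V_in_polys(2)[OF v(1)] n]
      unfolding var_coeff_indet_times by simp
  qed
  moreover have "regular_seq U (extend U A z') (map (var_coeff n 0) zs) \<and>
      regular_seq V (extend V B z') (map (var_coeff n 0) zs)"
  proof (rule Cons.IH[of "extend I N z"])
    have N_sub: "N \<subseteq> extend I N z" by (rule extend_mono[OF ideal_in_zero[OF ideals(1)]])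
    show idN: "ideal_in (polys (insert n X)) (extend I N z)"
      by (rule ideal_in_extend[OF N(1) ideals(1) z])
    show "indet n * p \<in> extend I N z" if "p \<in> I" for p using N(2)[OF that] N_sub by blast
    have ext': "\<exists>a m. p = a + z' * m \<and> a \<in> N \<and> m \<in> I" if p: "p \<in> extend I N z" for p
    proof -
      obtain a m where m: "p = a + z * m" "a \<in> N" "m \<in> I" using p by (rule extendE)
      obtain e where e: "e \<in> N" "z * m = z' * m + e" using zm[OF m(3)] by blast
      have "p = (a + e) + z' * m" using m(1) e(2) by (simp add: algebra_simps)
      then show ?thesis using ideal_in_add[OF N(1) m(2) e(1)] m(3) by blast
    qed
    have ext: "a + z' * m \<in> extend I N z" if am: "a \<in> N" "m \<in> I" for a m
    proof -
      obtain e where e: "e \<in> N" "z * m = z' * m + e" using zm[OF am(2)] by blast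
      show ?thesis
      proof (rule extendI)
        show "a + z' * m = (a - e) + z * m" using e(2) by simp
      qed (use am ideal_in_diff[OF N(1) am(1) e(1)] in auto)
    qed
    show "var_coeff n 0 p \<in> extend U A z'" if p: "p \<in> extend I N z" for p
    proof -
      obtain a m where m: "p = a + z' * m" "a \<in> N" "m \<in> I" using ext'[OF p] by blast
      show ?thesis
      proof (rule extendI)
        show "var_coeff n 0 p = var_coeff n 0 a + z' * var_coeff n 0 m"
          unfolding m(1) var_coeff_add var_coeff_times[OF z' n] ..
      qed (use low(1)[OF m(2)] var_coeff_0_in_U[OF m(3)] in auto)
    qed
    show "var_coeff n 1 p \<in> extend V B z'" if p: "p \<in> extend I N z" for p
    proof -
      obtain a m where m: "p = a + z' * m" "a \<in> N" "m \<in> I" using ext'[OF p] by blast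
      show ?thesis
      proof (rule extendI)
        show "var_coeff n 1 p = var_coeff n 1 a + z' * var_coeff n 1 m"
          unfolding m(1) var_coeff_add var_coeff_times[OF z' n] ..
      qed (use low(2)[OF m(2)] var_coeff_1_in_V[OF m(3)] in auto)
    qed
    show "extend U A z' \<subseteq> extend I N z"
    proof
      fix p assume "p \<in> extend U A z'"
      then obtain a m where "p = a + z' * m" "a \<in> A" "m \<in> U" by (rule extendE)
      then show "p \<in> extend I N z" using ext up(1) U_sub_I by blast
    qed
    show "indet n * b \<in> extend I N z" if b: "b \<in> extend V B z'" for b
    proof -
      obtain a m where m: "b = a + z' * m" "a \<in> B" "m \<in> V" using b by (rule extendE)
      have "indet n * b = indet n * a + z' * (indet n * m)" unfolding m(1) by (simp add: algebra_simps)
      then show ?thesis using ext[OF up(2)[OF m(2)] indet_times_V[OF m(3)]] by simp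
    qed
  qed (use zs reg(2) in auto)
  ultimately show ?case by (simp add: z'_def)
qed

text \<open>As \<open>x\<^sub>n\<close> is regular on \<open>I\<close>, a regular sequence \<open>fs\<close> on \<open>I\<close> yields regular sequences of any smaller
  length on \<open>I/x\<^sub>nI\<close>, and these restrict to both summands.\<close>

lemma depth_slices_ge:
  assumes fs: "set fs \<subseteq> graded_maximal_ideal (insert n X)"
    and reg: "regular_sequence (ideal_module (poly_ring (insert n X)) I) fs" and e: "e < length fs"
  shows "enat e \<le> depth_quot X U {0}" "enat e \<le> depth_quot X V U"
proof -
  let ?m = "graded_maximal_ideal (insert n X) :: 'k mpoly set"
  have fin': "finite (insert n X)" using fin by simp
  interpret noetherian_subring "polys (insert n X) :: 'k mpoly set" by (rule noetherian_polys[OF fin'])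
  have m: "ideal_in (polys (insert n X)) ?m"
    unfolding ideal_in_def graded_maximal_ideal_eq
  proof (intro conjI ballI)
    fix r p :: "'k mpoly"
    assume r: "r \<in> polys (insert n X)" and p: "p \<in> {p. p \<in> polys (insert n X) \<and> lookup p 0 = 0}"
    have "0 \<notin> keys (r * p)"
    proof
      assume "0 \<in> keys (r * p)"
      then obtain a b where ab: "0 = a + b" "b \<in> keys p" by (rule in_keys_timesE)
      have "keys b = {}" using keys_plus_exponent[of a b] ab(1) by simp
      then have "b = 0" by (metis poly_mapping_eqI lookup_zero in_keys_iff empty_iff)
      then show False using ab(2) p by (simp add: in_keys_iff)
    qed
    then show "r * p \<in> {p. p \<in> polys (insert n X) \<and> lookup p 0 = 0}"
      using polys_closed(4)[OF r, of p] p by (simp add: in_keys_iff)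
  qed (auto simp: lookup_add polys_closed)
  have "set fs \<subseteq> polys (insert n X)" using fs ideal_in_sub[OF m] by blast
  then have reg0: "regular_seq I {0} fs" using regular_seq_if_regular_sequence[OF fin' ideals(1) _ reg] by blast
  have xm: "indet n \<in> ?m"
    unfolding graded_maximal_ideal_eq using indet_in_polys
    by (auto simp: indet_def monomial_def lookup_single when_def poly_mapping_eq_iff fun_eq_iff split: if_splits)
  have x_reg: "regular_on I {0} (indet n)"
    unfolding regular_on_def
  proof (intro ballI impI)
    fix p :: "'k mpoly" assume "indet n * p \<in> {0}"
    then have zero: "indet n * p = 0" by simp
    have "indet n \<noteq> (0 :: 'k mpoly)"
      unfolding indet_def monomial_def by (metis lookup_single_eq lookup_zero zero_neq_one)
    then show "p \<in> {0}" using zero by simp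
  qed
  have zero: "ideal_in (polys (insert n X)) {0 :: 'k mpoly}" by (rule ideal_in_zero_ideal[OF zero_mem])
  obtain zs where zs: "length zs = e" "set zs \<subseteq> ?m" "regular_seq I (extend I {0} (indet n)) zs"
    using regular_seq_modulo_regular_element[OF zero ideals(1) m fs reg0 xm x_reg e] by blast
  let ?N = "extend I {0} (indet n)" and ?zs = "map (var_coeff n 0) zs"
  have N: "p \<in> ?N \<longleftrightarrow> (\<exists>q\<in>I. p = indet n * q)" for p unfolding extend_def by auto
  have split: "regular_seq U {0} ?zs \<and> regular_seq V U ?zs"
  proof (rule split_regular_seq[of ?N])
    show "ideal_in (polys (insert n X)) ?N" by (rule ideal_in_extend[OF zero ideals(1) indet_in_polys])
    show "indet n * p \<in> ?N" if "p \<in> I" for p using that unfolding N by blast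
    show "var_coeff n 0 p \<in> {0}" if "p \<in> ?N" for p using that var_coeff_indet_times(1) unfolding N by auto
    show "var_coeff n 1 p \<in> U" if "p \<in> ?N" for p
      using that var_coeff_indet_times(2) var_coeff_0_in_U unfolding N by metis
    show "{0} \<subseteq> ?N" using extend_mono[OF ideal_in_zero[OF ideals(1)]] .
    show "indet n * b \<in> ?N" if "b \<in> U" for b using that U_sub_I unfolding N by blast
  qed (use zs ideal_in_sub[OF m] in auto)
  have zs': "set ?zs \<subseteq> graded_maximal_ideal X"
  proof
    fix z assume "z \<in> set ?zs"
    then obtain y where y: "y \<in> set zs" "z = var_coeff n 0 y" by auto
    then have "y \<in> polys (insert n X)" "lookup y 0 = 0"
      using zs(2) unfolding graded_maximal_ideal_eq by auto
    then show "z \<in> graded_maximal_ideal X"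
      unfolding graded_maximal_ideal_eq y(2) using var_coeff_in_polys by (auto simp: lookup_var_coeff)
  qed
  have zero_U: "{0} \<subseteq> U" using ideals(2) unfolding ideal_in_def by blast
  have zeroX: "ideal_in (polys X) {0 :: 'k mpoly}" by (rule ideal_in_zero_ideal[OF polys_closed(1)])
  have "ideal_quotient X U {0}" by (rule ideal_quotient.intro[OF fin ideals(2) zeroX zero_U])
  then have "enat (length ?zs) \<le> depth_quot X U {0}"
    by (rule ideal_quotient.depth_quot_ge[OF _ zs'])
      (use split extends_support_ideal_proper[OF fin U_def support_ideal_empty[symmetric] zero_U _ zs'] in auto)
  then show "enat e \<le> depth_quot X U {0}" using zs(1) by simp
  have "ideal_quotient X V U" by (rule ideal_quotient.intro[OF fin ideals(3,2) U_sub_V])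
  then have "enat (length ?zs) \<le> depth_quot X V U"
    by (rule ideal_quotient.depth_quot_ge[OF _ zs'])
      (use split extends_support_ideal_proper[OF fin V_def U_def U_sub_V _ zs'] in auto)
  then show "enat e \<le> depth_quot X V U" using zs(1) by simp
qed

end

section \<open>Partitions of monomials into cones\<close>

definition cone :: "(nat \<Rightarrow>\<^sub>0 nat) \<Rightarrow> nat set \<Rightarrow> (nat \<Rightarrow>\<^sub>0 nat) set" where
  "cone t Z = {t + s | s. keys s \<subseteq> Z}"

text \<open>The combinatorial content of a Stanley decomposition. The cones are recorded as a set of pairs;
  since a cone contains its apex, disjointness forces different pairs to have different cones.\<close>

definition cone_partition ::
    "nat set \<Rightarrow> ((nat \<Rightarrow>\<^sub>0 nat) \<times> nat set) set \<Rightarrow> (nat \<Rightarrow>\<^sub>0 nat) set \<Rightarrow> bool" where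
  "cone_partition X E A \<longleftrightarrow>
     finite E \<and> (\<forall>t Z. (t, Z) \<in> E \<longrightarrow> Z \<subseteq> X) \<and>
     (\<forall>r. r \<in> A \<longleftrightarrow> (\<exists>t Z. (t, Z) \<in> E \<and> r \<in> cone t Z)) \<and>
     (\<forall>t Z t' Z' r. (t, Z) \<in> E \<longrightarrow> (t', Z') \<in> E \<longrightarrow> r \<in> cone t Z \<longrightarrow> r \<in> cone t' Z' \<longrightarrow>
        (t, Z) = (t', Z'))"

lemma cone_partitionI:
  assumes "finite E" "\<And>t Z. (t, Z) \<in> E \<Longrightarrow> Z \<subseteq> X"
    and "\<And>t Z r. (t, Z) \<in> E \<Longrightarrow> r \<in> cone t Z \<Longrightarrow> r \<in> A"
    and "\<And>r. r \<in> A \<Longrightarrow> \<exists>t Z. (t, Z) \<in> E \<and> r \<in> cone t Z"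
    and "\<And>t Z t' Z' r. \<lbrakk>(t, Z) \<in> E; (t', Z') \<in> E; r \<in> cone t Z; r \<in> cone t' Z'\<rbrakk> \<Longrightarrow> (t, Z) = (t', Z')"
  shows "cone_partition X E A"
  unfolding cone_partition_def using assms(1-4)
  by (intro conjI allI impI iffI assms(5)) blast+

lemma
  assumes "cone_partition X E A"
  shows cone_partition_finite: "finite E"
    and cone_partition_sub: "(t, Z) \<in> E \<Longrightarrow> Z \<subseteq> X"
    and cone_partition_mem: "(t, Z) \<in> E \<Longrightarrow> r \<in> cone t Z \<Longrightarrow> r \<in> A"
    and cone_partition_cover: "r \<in> A \<Longrightarrow> \<exists>t Z. (t, Z) \<in> E \<and> r \<in> cone t Z"
    and cone_partition_unique:
      "\<lbrakk>(t, Z) \<in> E; (t', Z') \<in> E; r \<in> cone t Z; r \<in> cone t' Z'\<rbrakk> \<Longrightarrow> (t, Z) = (t', Z')"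
  using assms unfolding cone_partition_def by metis+

lemma apex_in_cone: "t \<in> cone t Z"
  unfolding cone_def by (rule CollectI, rule exI[of _ 0]) simp

text \<open>The exponent after setting \<open>x\<^sub>n = 1\<close>.\<close>

definition erase :: "nat \<Rightarrow> (nat \<Rightarrow>\<^sub>0 nat) \<Rightarrow> (nat \<Rightarrow>\<^sub>0 nat)" where
  "erase n t = t - single n (lookup t n)"

lemma lookup_erase: "lookup (erase n t) i = (if i = n then 0 else lookup t i)"
  by (auto simp: erase_def lookup_minus lookup_single when_def)

lemma erase_decomp: "t = erase n t + single n (lookup t n)"
  by (rule poly_mapping_eqI) (auto simp: lookup_add lookup_erase lookup_single when_def)

lemma keys_erase: "keys (erase n t) = keys t - {n}"
  by (auto simp: in_keys_iff lookup_erase split: if_splits)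

lemma erase_add: "erase n (s + t) = erase n s + erase n t"
  by (rule poly_mapping_eqI) (simp add: lookup_add lookup_erase)

lemma erase_id: "keys t \<subseteq> X \<Longrightarrow> n \<notin> X \<Longrightarrow> erase n t = t"
  by (rule poly_mapping_eqI) (auto simp: lookup_erase in_keys_iff)

lemma cone_insert_iff:
  assumes t: "keys t \<subseteq> X" and n: "n \<notin> X"
  shows "r \<in> cone (t + single n k) (insert n Z) \<longleftrightarrow>
    k \<le> lookup r n \<and> erase n r \<in> cone t Z"
proof
  assume "r \<in> cone (t + single n k) (insert n Z)"
  then obtain s where s: "r = (t + single n k) + s" "keys s \<subseteq> insert n Z"
    unfolding cone_def by blast
  have "erase n (single n k) = 0"
    by (rule poly_mapping_eqI) (simp add: lookup_erase lookup_single when_def)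
  then have "erase n r = t + erase n s" unfolding s(1) erase_add erase_id[OF t n] by simp
  moreover have "keys (erase n s) \<subseteq> Z" using s(2) unfolding keys_erase by blast
  ultimately show "k \<le> lookup r n \<and> erase n r \<in> cone t Z"
    unfolding cone_def s(1) by (auto simp: lookup_add)
next
  assume r: "k \<le> lookup r n \<and> erase n r \<in> cone t Z"
  then obtain s where s: "erase n r = t + s" "keys s \<subseteq> Z" unfolding cone_def by blast
  let ?j = "lookup r n"
  have "r = (t + s) + single n ?j" using erase_decomp[of r n] s(1) by simp
  also have "single n ?j = single n k + single n (?j - k)"
    using r by (simp add: single_add[symmetric])
  finally have "r = (t + single n k) + (s + single n (?j - k))"
    by (simp add: add.assoc add.left_commute)
  moreover have "keys (s + single n (?j - k)) \<subseteq> insert n Z"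
    using s(2) by (auto simp: keys_plus_exponent)
  ultimately show "r \<in> cone (t + single n k) (insert n Z)" unfolding cone_def by blast
qed

lemma cone_set_exponent_iff:
  assumes "finite F"
  shows "r \<in> cone (set_exponent F) F \<longleftrightarrow> keys r = F"
proof
  assume "r \<in> cone (set_exponent F) F"
  then show "keys r = F"
    unfolding cone_def by (auto simp: keys_plus_exponent keys_set_exponent[OF assms])
next
  assume keys: "keys r = F"
  have "\<exists>s. r = set_exponent F + s"
    by (subst squarefree_divides_iff) (simp_all add: set_exponent.rep_eq keys_set_exponent[OF assms] keys)
  then obtain s where s: "r = set_exponent F + s" by blast
  then have "keys s \<subseteq> F" using keys by (auto simp: keys_plus_exponent)
  then show "r \<in> cone (set_exponent F) F" unfolding cone_def using s by blast
qed

text \<open>Monomials are sorted by their support \<open>F\<close>: those with support \<open>F\<close> form the cone over \<open>K[F]\<close>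
  whose apex is the squarefree monomial with support \<open>F\<close>.\<close>

lemma squarefree_cone_partition:
  assumes X: "finite X" and A: "\<And>r. r \<in> A \<longleftrightarrow> keys r \<subseteq> X \<and> P (keys r)"
  shows "\<exists>E. cone_partition X E A"
proof -
  define E where "E = (\<lambda>F. (set_exponent F, F)) ` {F. F \<subseteq> X \<and> P F}"
  have E: "(t, Z) \<in> E \<longleftrightarrow> Z \<subseteq> X \<and> P Z \<and> t = set_exponent Z" for t Z unfolding E_def by auto
  have cone: "r \<in> cone t Z \<longleftrightarrow> keys r = Z" if "(t, Z) \<in> E" for t Z r
    using that cone_set_exponent_iff[of Z r] finite_subset[OF _ X] unfolding E by blast
  have "cone_partition X E A"
  proof (rule cone_partitionI)
    show "finite E" unfolding E_def using X by (intro finite_imageI) simp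
    show "Z \<subseteq> X" if "(t, Z) \<in> E" for t Z using that unfolding E by blast
    show "r \<in> A" if e: "(t, Z) \<in> E" "r \<in> cone t Z" for t Z r
      using e(1) e(2)[unfolded cone[OF e(1)]] unfolding E A by auto
    show "\<exists>t Z. (t, Z) \<in> E \<and> r \<in> cone t Z" if r: "r \<in> A" for r
    proof -
      have e: "(set_exponent (keys r), keys r) \<in> E" using r unfolding E A by simp
      then show ?thesis using cone[OF e, of r] by blast
    qed
    show "(t, Z) = (t', Z')" if e: "(t, Z) \<in> E" "(t', Z') \<in> E" "r \<in> cone t Z" "r \<in> cone t' Z'" for t Z t' Z' r
      using e(1,2) e(3)[unfolded cone[OF e(1)]] e(4)[unfolded cone[OF e(2)]] unfolding E by simp
  qed
  then show ?thesis by blast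
qed

section \<open>Stanley decompositions from cones\<close>

lemma abelian_monoid_if_plus:
  fixes M :: "('a, 'b::comm_monoid_add) module"
  assumes "add M = (+)" "zero M = 0" "0 \<in> carrier M"
    and "\<And>x y. x \<in> carrier M \<Longrightarrow> y \<in> carrier M \<Longrightarrow> x + y \<in> carrier M"
  shows "abelian_monoid M"
  by (rule abelian_monoidI) (use assms in \<open>auto simp: ac_simps\<close>)

lemma finsum_eq_sum:
  fixes M :: "('a, 'b::comm_monoid_add) module"
  assumes M: "add M = (+)" "zero M = 0" "0 \<in> carrier M"
    "\<And>x y. x \<in> carrier M \<Longrightarrow> y \<in> carrier M \<Longrightarrow> x + y \<in> carrier M"
    and A: "finite A" "\<And>i. i \<in> A \<Longrightarrow> f i \<in> carrier M"
  shows "finsum M f A = sum f A"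
proof -
  interpret abelian_monoid M using M by (rule abelian_monoid_if_plus)
  show ?thesis
    using A by (induction A rule: finite_induct) (simp_all add: M(1,2) Pi_iff)
qed

lemma lookup_times_monomial:
  fixes f :: "'k::field mpoly"
  shows "lookup (f * monomial t) (t + a) = lookup f a"
  using lookup_single_times[of t 1 f a] by (simp add: monomial_def mult.commute)

lemma times_monomial_cancel:
  fixes f g :: "'k::field mpoly"
  assumes "f * monomial t = g * monomial t"
  shows "f = g"
  using assms lookup_times_monomial by (metis poly_mapping_eqI)

lemma keys_times_single:
  fixes f :: "'k::field mpoly"
  assumes "f \<in> polys Z" "r \<in> keys (f * single t c)"
  shows "r \<in> cone t Z"
proof -
  obtain a b where ab: "r = a + b" "a \<in> keys f" "b \<in> keys (single t c)"
    using assms(2) by (rule in_keys_timesE)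
  then have "b = t" by (simp split: if_splits)
  moreover have "keys a \<subseteq> Z" using assms(1) ab(2) by (simp add: polys_iff)
  ultimately show ?thesis unfolding cone_def using ab(1) by (auto simp: add.commute)
qed

definition restrict_keys :: "(nat \<Rightarrow>\<^sub>0 nat) set \<Rightarrow> 'k::field mpoly \<Rightarrow> 'k mpoly" where
  "restrict_keys A p = (\<Sum>t\<in>keys p \<inter> A. single t (lookup p t))"

lemma lookup_restrict_keys:
  "lookup (restrict_keys A p) r = (if r \<in> A then lookup p r else 0)"
proof -
  have "lookup (restrict_keys A p) r =
      (\<Sum>t\<in>keys p \<inter> A. if t = r then lookup p t else 0)"
    unfolding restrict_keys_def lookup_sum by (intro sum.cong) (auto simp: lookup_single when_def)
  also have "\<dots> = (if r \<in> A then lookup p r else 0)"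
    by (auto simp: sum.delta in_keys_iff)
  finally show ?thesis .
qed

text \<open>A principal ideal of a domain is free; the basis consists of the generating monomial.\<close>

lemma free_cyclic_space:
  fixes X :: "nat set" and I :: "'k::field mpoly set"
  defines "M \<equiv> ideal_module (poly_ring X) I"
  shows "free_module (poly_ring Z) (M\<lparr>carrier := cyclic_space M (monomial t) Z\<rparr>)"
proof -
  let ?m = "monomial t :: 'k mpoly"
  let ?M = "M\<lparr>carrier := cyclic_space M ?m Z\<rparr>"
  have carr: "carrier ?M = {f * ?m | f. f \<in> polys Z}"
    by (simp add: cyclic_space_def M_def)
  have M: "add ?M = (+)" "zero ?M = 0" "smult ?M = (*)" by (simp_all add: M_def)
  have zero: "0 \<in> carrier ?M"
    unfolding carr using polys_closed(1) by (auto intro!: exI[of _ 0])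
  have closed: "x + y \<in> carrier ?M" if xy: "x \<in> carrier ?M" "y \<in> carrier ?M" for x y
  proof -
    obtain f g where fg: "x = f * ?m" "y = g * ?m" "f \<in> polys Z" "g \<in> polys Z" using xy unfolding carr by blast
    then have "x + y = (f + g) * ?m" by (simp add: distrib_right)
    then show ?thesis unfolding carr using polys_closed(3)[OF fg(3,4)] by blast
  qed
  have mc: "?m \<in> carrier ?M"
    unfolding carr using polys_closed(2) by (auto intro!: exI[of _ 1])
  let ?good = "\<lambda>x c. c ` {?m} \<subseteq> polys Z \<and> (\<forall>b. b \<notin> {?m} \<longrightarrow> c b = 0) \<and> finite {b. c b \<noteq> 0} \<and>
        x = finsum ?M (\<lambda>b. c b * b) {b. c b \<noteq> 0}"
  have sum: "finsum ?M (\<lambda>b. c b * b) {b. c b \<noteq> 0} = c ?m * ?m"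
    if c: "c ?m \<in> polys Z" "\<forall>b. b \<notin> {?m} \<longrightarrow> c b = 0" for c
  proof -
    have sub: "{b. c b \<noteq> 0} \<subseteq> {?m}" using c(2) by blast
    have "finsum ?M (\<lambda>b. c b * b) {b. c b \<noteq> 0} = (\<Sum>b\<in>{b. c b \<noteq> 0}. c b * b)"
    proof (rule finsum_eq_sum[OF M(1,2) zero closed])
      show "finite {b. c b \<noteq> 0}" using sub finite_subset by blast
      show "c b * b \<in> carrier ?M" if "b \<in> {b. c b \<noteq> 0}" for b
      proof -
        have "b = ?m" using that sub by blast
        then show ?thesis unfolding carr using c(1) by blast
      qed
    qed
    also have "\<dots> = (\<Sum>b\<in>{?m}. c b * b)" using sub by (intro sum.mono_neutral_left) auto
    finally show ?thesis by simp
  qed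
  have "\<exists>!c. ?good x c" if x: "x \<in> carrier ?M" for x
  proof -
    obtain f where f: "x = f * ?m" "f \<in> polys Z" using x unfolding carr by blast
    define c where "c = (\<lambda>b. if b = ?m then f else 0)"
    have c: "c ?m \<in> polys Z" "\<forall>b. b \<notin> {?m} \<longrightarrow> c b = 0" using f(2) by (simp_all add: c_def)
    have "finite {b. c b \<noteq> 0}" by (rule finite_subset[of _ "{?m}"]) (use c(2) in blast, simp)
    then have "?good x c" using c sum[OF c] f(1) by (simp add: c_def)
    moreover have "c' = c" if c': "?good x c'" for c'
    proof
      fix b
      have m': "c' ?m \<in> polys Z" "\<forall>b. b \<notin> {?m} \<longrightarrow> c' b = 0" using c' by blast+
      have "x = c' ?m * ?m" using c' unfolding sum[OF m'] by blast
      then have "c' ?m * ?m = f * ?m" unfolding f(1) by (rule sym)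
      then have "c' ?m = f" by (rule times_monomial_cancel)
      then show "c' b = c b" using m'(2) by (simp add: c_def)
    qed
    ultimately show ?thesis by blast
  qed
  then show ?thesis
    unfolding free_module_def M(3) using mc by (intro exI[of _ "{?m}"]) simp
qed

text \<open>The component of \<open>x\<close> in the space of a cone is the part of \<open>x\<close> supported on this cone. As the
  cones are disjoint there is no other choice, and as they cover all monomials of \<open>I\<close> the
  components add up to \<open>x\<close>.\<close>

lemma stanley_decomposition_of_cones:
  fixes I :: "'k::field mpoly set"
  assumes I: "I = support_ideal X \<F>" and E: "cone_partition X E (support_exponents X \<F>)"
    and xs: "set xs = E" "distinct xs"
  shows "stanley_decomposition X (ideal_module (poly_ring X) I) (ideal_grading I)
    (map (\<lambda>(t, Z). (monomial t, Z)) xs)" (is "stanley_decomposition X ?M ?G ?D")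
  unfolding stanley_decomposition_def
proof (intro conjI ballI)
  have idI: "ideal_in (polys X) I" unfolding I by (rule ideal_in_support_ideal)
  note mem = cone_partition_mem[OF E] and unique = cone_partition_unique[OF E]
  show "case e of (u, Z) \<Rightarrow> is_stanley_space X ?M ?G u Z" if e: "e \<in> set ?D" for e
  proof -
    obtain t Z where tZ: "(t, Z) \<in> E" "e = (monomial t, Z)" using e xs(1) by auto
    have "t \<in> support_exponents X \<F>" using mem[OF tZ(1) apex_in_cone] .
    then have "monomial t \<in> I" unfolding I support_ideal_iff by (simp add: monomial_def)
    then have "monomial t \<in> ?G (\<lambda>i. int (lookup t i))"
      by (simp add: ideal_grading_def monomial_def)
    then show ?thesis
      using cone_partition_sub[OF E tZ(1)] free_cyclic_space tZ(2) unfolding is_stanley_space_def by auto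
  qed
  define len where "len = length xs"
  define t where "t k = fst (xs ! k)" for k
  define Z where "Z k = snd (xs ! k)" for k
  have inE: "(t k, Z k) \<in> E" if "k < len" for k
    using that xs(1) unfolding t_def Z_def len_def by (metis nth_mem prod.collapse)
  have D: "length ?D = len" "fst (?D ! k) = monomial (t k)" "snd (?D ! k) = Z k" if "k < len" for k
    using that by (simp_all add: len_def t_def Z_def split: prod.split)
  have lenD: "length ?D = len" by (simp add: len_def)
  have space: "cyclic_space ?M (fst (?D ! k)) (snd (?D ! k)) = {f * monomial (t k) | f. f \<in> polys (Z k)}"
    if "k < len" for k
    using D[OF that] by (simp add: cyclic_space_def)
  have disjoint: "k = l" if "k < len" "l < len" "r \<in> cone (t k) (Z k)" "r \<in> cone (t l) (Z l)" for k l r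
  proof -
    have "(t k, Z k) = (t l, Z l)" using unique[OF inE[OF that(1)] inE[OF that(2)] that(3,4)] .
    then have "xs ! k = xs ! l" unfolding t_def Z_def by (simp add: prod_eq_iff)
    then show ?thesis using that(1,2) xs(2) unfolding len_def by (simp add: nth_eq_iff_index_eq)
  qed
  have space_keys: "keys p \<subseteq> cone (t k) (Z k)"
    if "p \<in> {f * monomial (t k) | f. f \<in> polys (Z k)}" for p :: "'k mpoly" and k
    using that keys_times_single unfolding monomial_def by blast
  have space_sub: "p \<in> I" if k: "k < len" and p: "p \<in> {f * monomial (t k) | f. f \<in> polys (Z k)}" for p k
    using space_keys[OF p] mem[OF inE[OF k]] unfolding I support_ideal_iff by blast
  have finsum: "finsum ?M v {..<len} = (\<Sum>k<len. v k)" if "\<And>k. k < len \<Longrightarrow> v k \<in> I" for v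
    by (rule finsum_eq_sum) (use that idI in \<open>auto simp: ideal_in_def\<close>)
  fix x assume "x \<in> carrier ?M"
  then have x: "x \<in> I" by simp
  define w where "w = (\<lambda>k\<in>{..<len}. restrict_keys (cone (t k) (Z k)) x)"
  have w: "w k \<in> {f * monomial (t k) | f. f \<in> polys (Z k)}" if k: "k < len" for k
  proof -
    have "restrict_keys (cone (t k) (Z k)) x \<in> {f * monomial (t k) | f. f \<in> polys (Z k)}"
      unfolding restrict_keys_def
    proof (rule sum_mem)
      show "0 \<in> {f * monomial (t k) | f. f \<in> polys (Z k)}"
        using polys_closed(1) by (auto intro!: exI[of _ 0])
    next
      fix a b :: "'k mpoly" assume "a \<in> {f * monomial (t k) | f. f \<in> polys (Z k)}" "b \<in> {f * monomial (t k) | f. f \<in> polys (Z k)}"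
      then obtain f g where fg: "a = f * monomial (t k)" "b = g * monomial (t k)" "f \<in> polys (Z k)" "g \<in> polys (Z k)"
        by blast
      then have "a + b = (f + g) * monomial (t k)" by (simp add: distrib_right)
      then show "a + b \<in> {f * monomial (t k) | f. f \<in> polys (Z k)}" using polys_closed(3)[OF fg(3,4)] by blast
    next
      fix r assume "r \<in> keys x \<inter> cone (t k) (Z k)"
      then obtain s where s: "r = t k + s" "keys s \<subseteq> Z k" unfolding cone_def by blast
      have "single r c = single s c * monomial (t k)" for c :: 'k
        unfolding monomial_def mult_single s(1) by (simp add: add.commute)
      then show "single r (lookup x r) \<in> {f * monomial (t k) | f. f \<in> polys (Z k)}"
        using single_in_polys[OF s(2)] by blast
    qed
    then show ?thesis using k by (simp add: w_def)
  qed
  have "x = finsum ?M w {..<len}"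
  proof -
    have "(\<Sum>k<len. w k) = x"
    proof (rule poly_mapping_eqI)
      fix r
      have sum: "lookup (\<Sum>k<len. w k) r =
          (\<Sum>k<len. if r \<in> cone (t k) (Z k) then lookup x r else 0)"
        unfolding lookup_sum by (intro sum.cong) (auto simp: w_def lookup_restrict_keys)
      show "lookup (\<Sum>k<len. w k) r = lookup x r"
      proof (cases "r \<in> keys x")
        case True
        then have "r \<in> support_exponents X \<F>" using x unfolding I support_ideal_iff by blast
        then obtain t' Z' where tZ: "(t', Z') \<in> E" "r \<in> cone t' Z'" using cone_partition_cover[OF E] by blast
        then obtain l where l: "l < len" "xs ! l = (t', Z')" unfolding len_def using xs(1) by (metis in_set_conv_nth)
        then have rl: "r \<in> cone (t l) (Z l)" using tZ(2) by (simp add: t_def Z_def)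
        have "r \<in> cone (t k) (Z k) \<longleftrightarrow> k = l" if "k < len" for k
          using disjoint[OF that l(1) _ rl] rl by blast
        then have "(\<Sum>k<len. if r \<in> cone (t k) (Z k) then lookup x r else 0) =
            (\<Sum>k<len. if k = l then lookup x r else 0)"
          by (intro sum.cong) simp_all
        also have "\<dots> = lookup x r" using l(1) by simp
        finally show ?thesis using sum by simp
      next
        case False
        then have zero: "lookup x r = 0" by (simp add: in_keys_iff)
        show ?thesis unfolding sum zero by simp
      qed
    qed
    then show ?thesis using finsum[of w] space_sub w by simp
  qed
  moreover have "w \<in> (\<Pi>\<^sub>E k\<in>{..<len}. cyclic_space ?M (fst (?D ! k)) (snd (?D ! k)))"
    using w space by (intro PiE_I) (auto simp: w_def)
  moreover have "v = w" if v: "v \<in> (\<Pi>\<^sub>E k\<in>{..<len}. cyclic_space ?M (fst (?D ! k)) (snd (?D ! k)))"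
    "x = finsum ?M v {..<len}" for v
  proof (rule PiE_ext[OF v(1)])
    show "w \<in> (\<Pi>\<^sub>E k\<in>{..<len}. cyclic_space ?M (fst (?D ! k)) (snd (?D ! k)))" by fact
    fix k assume "k \<in> {..<len}"
    then have k: "k < len" by simp
    have vl: "v l \<in> {f * monomial (t l) | f. f \<in> polys (Z l)}" if "l < len" for l
      using PiE_mem[OF v(1), of l] space[OF that] that by simp
    have x_sum: "x = (\<Sum>l<len. v l)" using v(2) finsum[of v] space_sub vl by simp
    show "v k = w k"
    proof (rule poly_mapping_eqI)
      fix r
      show "lookup (v k) r = lookup (w k) r"
      proof (cases "r \<in> cone (t k) (Z k)")
        case True
        have "lookup (v l) r = 0" if "l < len" "l \<noteq> k" for l
        proof -
          have "r \<notin> cone (t l) (Z l)" using disjoint[OF that(1) k _ True] that(2) by blast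
          then have "r \<notin> keys (v l)" using space_keys[OF vl[OF that(1)]] by blast
          then show ?thesis by (simp add: in_keys_iff)
        qed
        then have "lookup x r = (\<Sum>l<len. if l = k then lookup (v k) r else 0)"
          unfolding x_sum lookup_sum by (intro sum.cong) auto
        then show ?thesis using k True by (simp add: w_def lookup_restrict_keys)
      next
        case False
        then have "r \<notin> keys (v k)" using space_keys[OF vl[OF k]] by blast
        then show ?thesis using False k by (simp add: in_keys_iff w_def lookup_restrict_keys)
      qed
    qed
  qed
  ultimately show "\<exists>!v. v \<in> (\<Pi>\<^sub>E k\<in>{..<length ?D}. cyclic_space ?M (fst (?D ! k)) (snd (?D ! k))) \<and>
      x = finsum ?M v {..<length ?D}"
    unfolding lenD by blast
qed

lemma sdepth_ideal_ge:
  fixes I :: "'k::field mpoly set"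
  assumes I: "I = support_ideal X \<F>" and E: "cone_partition X E (support_exponents X \<F>)"
    and k: "\<And>t Z. (t, Z) \<in> E \<Longrightarrow> k \<le> card Z"
  shows "enat k \<le> sdepth_ideal X I"
proof -
  obtain xs where xs: "set xs = E" "distinct xs" using finite_distinct_list[OF cone_partition_finite[OF E]] by blast
  let ?D = "map (\<lambda>(t, Z). (monomial t :: 'k mpoly, Z)) xs"
  have "enat k \<le> sdepth_of_decomposition ?D"
    unfolding sdepth_of_decomposition_def using k xs(1) by (intro INF_greatest) auto
  also have "\<dots> \<le> sdepth_ideal X I"
    unfolding sdepth_ideal_def sdepth_def
    using stanley_decomposition_of_cones[OF I E xs] by (auto intro!: Sup_upper)
  finally show ?thesis .
qed

section \<open>Cones for an ideal from cones for its slices\<close>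

text \<open>Here \<open>I\<close> being squarefree matters: the condition on the exponent of \<open>x\<^sub>n\<close> is whether it vanishes.\<close>

lemma (in squarefree_slices) exponent_iff:
  "r \<in> support_exponents (insert n X) \<F> \<longleftrightarrow>
    (if lookup r n = 0 then erase n r \<in> support_exponents X {F \<in> \<F>. n \<notin> F}
     else erase n r \<in> support_exponents X ((\<lambda>F. F - {n}) ` \<F>))"
proof (cases "keys (erase n r) \<subseteq> X")
  case True
  have "r = erase n r + single n (lookup r n)" by (rule erase_decomp)
  then show ?thesis
    using exponent_U_iff[OF True] exponent_V_iff[OF True, of "lookup r n"]
    by (cases "lookup r n = 0") (simp_all del: lookup_not_eq_zero_eq_in_keys)
next
  case False
  moreover from this have "\<not> keys r \<subseteq> insert n X" unfolding keys_erase by blast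
  ultimately show ?thesis unfolding support_exponents_def by simp
qed

text \<open>This is \<open>I = U[x\<^sub>n] \<oplus> x\<^sub>n(V/U)[x\<^sub>n]\<close>. A monomial of \<open>I\<close> falls into the first summand iff it lies
  in \<open>U\<close> after setting \<open>x\<^sub>n = 1\<close>.\<close>

lemma (in squarefree_slices) combine_cone_partitions:
  defines "A \<equiv> support_exponents X {F \<in> \<F>. n \<notin> F}"
    and "B \<equiv> support_exponents X ((\<lambda>F. F - {n}) ` \<F>)"
  assumes EU: "cone_partition X EU A" and EQ: "cone_partition X EQ (B - A)"
  shows "cone_partition (insert n X)
    ((\<lambda>(t, Z). (t, insert n Z)) ` EU \<union> (\<lambda>(t, Z). (t + single n 1, insert n Z)) ` EQ)
    (support_exponents (insert n X) \<F>)" (is "cone_partition _ ?E _")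
proof -
  have AB: "keys t \<subseteq> X" if "t \<in> A \<or> t \<in> B" for t
    using that unfolding A_def B_def support_exponents_def by blast
  have coneU: "r \<in> cone t (insert n Z) \<longleftrightarrow> erase n r \<in> cone t Z" if e: "(t, Z) \<in> EU" for t Z r
    using cone_insert_iff[OF AB n, of t r 0 Z]
      cone_partition_mem[OF EU e apex_in_cone] by simp
  have coneQ: "r \<in> cone (t + single n 1) (insert n Z) \<longleftrightarrow>
      lookup r n \<noteq> 0 \<and> erase n r \<in> cone t Z" if e: "(t, Z) \<in> EQ" for t Z r
    using cone_insert_iff[OF AB n, of t r 1 Z]
      cone_partition_mem[OF EQ e apex_in_cone] by (simp add: Suc_le_eq)
  have A_sub_B: "A \<subseteq> B" unfolding A_def B_def support_exponents_def by blast
  have memE: "(\<exists>t' Z'. (t', Z') \<in> EU \<and> (t, Z) = (t', insert n Z')) \<or>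
      (\<exists>t' Z'. (t', Z') \<in> EQ \<and> (t, Z) = (t' + single n 1, insert n Z'))" if "(t, Z) \<in> ?E" for t Z
    using that by auto
  note exp = exponent_iff[folded A_def B_def]
  show ?thesis
  proof (rule cone_partitionI)
    show "finite ?E" using cone_partition_finite[OF EU] cone_partition_finite[OF EQ] by simp
    show "Z \<subseteq> insert n X" if "(t, Z) \<in> ?E" for t Z
      using memE[OF that] cone_partition_sub[OF EU] cone_partition_sub[OF EQ] by blast
    show "r \<in> support_exponents (insert n X) \<F>" if e: "(t, Z) \<in> ?E" "r \<in> cone t Z" for t Z r
      using memE[OF e(1)]
    proof (elim disjE exE conjE)
      fix t' Z' assume e': "(t', Z') \<in> EU" "(t, Z) = (t', insert n Z')"
      then have "erase n r \<in> cone t' Z'" using e(2) coneU by simp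
      then have "erase n r \<in> A" using cone_partition_mem[OF EU e'(1)] by blast
      then show ?thesis using A_sub_B unfolding exp by auto
    next
      fix t' Z' assume e': "(t', Z') \<in> EQ" "(t, Z) = (t' + single n 1, insert n Z')"
      then have "lookup r n \<noteq> 0" "erase n r \<in> cone t' Z'" using e(2) coneQ by simp_all
      then show ?thesis using cone_partition_mem[OF EQ e'(1)] unfolding exp by auto
    qed
    show "\<exists>t Z. (t, Z) \<in> ?E \<and> r \<in> cone t Z" if r: "r \<in> support_exponents (insert n X) \<F>" for r
    proof (cases "erase n r \<in> A")
      case True
      then obtain t Z where tZ: "(t, Z) \<in> EU" "erase n r \<in> cone t Z" using cone_partition_cover[OF EU] by blast
      then have "r \<in> cone t (insert n Z)" using coneU by blast
      moreover have "(t, insert n Z) \<in> ?E" using tZ(1) by force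
      ultimately show ?thesis by blast
    next
      case False
      then have j: "lookup r n \<noteq> 0" "erase n r \<in> B - A" using r unfolding exp by (auto split: if_splits)
      then obtain t Z where tZ: "(t, Z) \<in> EQ" "erase n r \<in> cone t Z" using cone_partition_cover[OF EQ] by blast
      then have "r \<in> cone (t + single n 1) (insert n Z)" using coneQ j(1) by blast
      moreover have "(t + single n 1, insert n Z) \<in> ?E" using tZ(1) by force
      ultimately show ?thesis by blast
    qed
    show "(t, Z) = (t', Z')"
      if e: "(t, Z) \<in> ?E" "(t', Z') \<in> ?E" "r \<in> cone t Z" "r \<in> cone t' Z'" for t Z t' Z' r
      using memE[OF e(1)] memE[OF e(2)]
    proof (elim disjE exE conjE)
      fix s Y s' Y' assume s: "(s, Y) \<in> EU" "(t, Z) = (s, insert n Y)" "(s', Y') \<in> EU" "(t', Z') = (s', insert n Y')"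
      then have "(s, Y) = (s', Y')" using e(3,4) coneU cone_partition_unique[OF EU s(1,3), of "erase n r"] by simp
      then show ?thesis using s by simp
    next
      fix s Y s' Y' assume s: "(s, Y) \<in> EU" "(t, Z) = (s, insert n Y)"
        "(s', Y') \<in> EQ" "(t', Z') = (s' + single n 1, insert n Y')"
      then have c: "erase n r \<in> cone s Y" "erase n r \<in> cone s' Y'" using e(3,4) coneU coneQ by simp_all
      show ?thesis using cone_partition_mem[OF EU s(1) c(1)] cone_partition_mem[OF EQ s(3) c(2)] by simp
    next
      fix s Y s' Y' assume s: "(s, Y) \<in> EQ" "(t, Z) = (s + single n 1, insert n Y)"
        "(s', Y') \<in> EU" "(t', Z') = (s', insert n Y')"
      then have c: "erase n r \<in> cone s' Y'" "erase n r \<in> cone s Y" using e(3,4) coneU coneQ by simp_all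
      show ?thesis using cone_partition_mem[OF EU s(3) c(1)] cone_partition_mem[OF EQ s(1) c(2)] by simp
    next
      fix s Y s' Y' assume s: "(s, Y) \<in> EQ" "(t, Z) = (s + single n 1, insert n Y)"
        "(s', Y') \<in> EQ" "(t', Z') = (s' + single n 1, insert n Y')"
      then have "(s, Y) = (s', Y')" using e(3,4) coneQ cone_partition_unique[OF EQ s(1,3), of "erase n r"] by simp
      then show ?thesis using s by simp
    qed
  qed
qed

section \<open>Cones from Stanley decompositions\<close>

lemma ex1_eq: "\<lbrakk>\<exists>!x. P x; P a; P b\<rbrakk> \<Longrightarrow> a = b"
  by blast

context ideal_quotient
begin

text \<open>A multigraded component of the polynomial ring is spanned by one monomial. The
  coefficient \<open>c = 0\<close> occurs if the homogeneous representative is the zero polynomial.\<close>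

lemma homogeneous_class:
  assumes "u \<in> quot_grading MV U (ideal_grading V) a"
  obtains t c where "u = cls (single t c)" "single t c \<in> V"
proof -
  obtain p where p: "p \<in> V" "u = cls p"
      "\<And>t i. t \<in> keys p \<Longrightarrow> int (lookup t i) = a i"
    using assms unfolding quot_grading_def ideal_grading_def by blast
  have "\<exists>t c. p = single t c"
  proof (cases "keys p = {}")
    case True
    then have "p = 0" by (metis poly_mapping_eqI lookup_zero in_keys_iff empty_iff)
    then have "p = single 0 0" by simp
    then show ?thesis by blast
  next
    case False
    then obtain t where t: "t \<in> keys p" by blast
    have "s = t" if s: "s \<in> keys p" for s
    proof (rule poly_mapping_eqI)
      fix i
      have "int (lookup s i) = int (lookup t i)" using p(3)[OF s] p(3)[OF t] by simp
      then show "lookup s i = lookup t i" by simp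
    qed
    then have "p = single t (lookup p t)"
      by (intro poly_mapping_eqI) (auto simp: lookup_single when_def in_keys_iff)
    then show ?thesis by blast
  qed
  then show ?thesis using p(1,2) that by blast
qed

lemma polys_sub: "Z \<subseteq> X \<Longrightarrow> f \<in> polys Z \<Longrightarrow> f \<in> polys X"
  unfolding polys_iff by blast

lemma cyclic_space_cls:
  assumes "p \<in> V" "Z \<subseteq> X"
  shows "cyclic_space Q (cls p) Z = {cls (f * p) | f. f \<in> polys Z}"
proof -
  have "f \<odot>\<^bsub>Q\<^esub> cls p = cls (f * p)" if "f \<in> polys Z" for f
    using Q_smult[OF polys_sub[OF assms(2) that] assms(1)] .
  then show ?thesis unfolding cyclic_space_def by (intro Collect_cong) metis
qed

text \<open>Freeness of a cyclic module \<open>u K[Z] \<noteq> 0\<close> means that \<open>u\<close> has no annihilator. The basis provided by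
  the definition need not be \<open>u\<close>; but if \<open>f\<close> kills \<open>u\<close>, it kills every basis element \<open>b\<close>, and for
  \<open>f \<noteq> 0\<close> the zero element gets two expansions, \<open>0\<close> and \<open>f b\<close>.\<close>

lemma free_cyclic_space_faithful:
  assumes p: "p \<in> V" "p \<notin> U" and Z: "Z \<subseteq> X"
    and free: "free_module (poly_ring Z) (Q\<lparr>carrier := cyclic_space Q (cls p) Z\<rparr>)"
    and f: "f \<in> polys Z" "f * p \<in> U"
  shows "f = 0"
proof (rule ccontr)
  assume "f \<noteq> 0"
  interpret Q: plain_module R Q by (rule module_Q)
  let ?M = "Q\<lparr>carrier := cyclic_space Q (cls p) Z\<rparr>"
  have carr: "carrier ?M = {cls (g * p) | g. g \<in> polys Z}" using cyclic_space_cls[OF p(1) Z] by simp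
  have gp: "g * p \<in> V" if "g \<in> polys Z" for g using ideal_in_mult[OF V polys_sub[OF Z that] p(1)] .
  have zeroU: "cls 0 = U" using cls_eq_zero_iff[OF ideal_in_zero[OF V]] ideal_in_zero[OF U] by simp
  have zero: "U \<in> carrier ?M"
    unfolding carr using polys_closed(1) zeroU by (auto intro!: exI[of _ 0])
  have M: "abelian_monoid ?M"
  proof (rule abelian_monoidI)
    show "x \<oplus>\<^bsub>?M\<^esub> y \<in> carrier ?M" if xy: "x \<in> carrier ?M" "y \<in> carrier ?M" for x y
    proof -
      obtain g h where gh: "x = cls (g * p)" "y = cls (h * p)" "g \<in> polys Z" "h \<in> polys Z"
        using xy unfolding carr by blast
      have "x \<oplus>\<^bsub>?M\<^esub> y = cls ((g + h) * p)"
        using gh Q_add[OF gp[OF gh(3)] gp[OF gh(4)]] by (simp add: distrib_right)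
      then show ?thesis unfolding carr using polys_closed(3)[OF gh(3,4)] by blast
    qed
    have sub: "x \<in> carrier Q" if "x \<in> carrier ?M" for x using that gp unfolding carr Q_carrier by blast
    show "\<zero>\<^bsub>?M\<^esub> \<in> carrier ?M" using zero by (simp add: Q_zero)
    show "x \<oplus>\<^bsub>?M\<^esub> y \<oplus>\<^bsub>?M\<^esub> z = x \<oplus>\<^bsub>?M\<^esub> (y \<oplus>\<^bsub>?M\<^esub> z)"
      if "x \<in> carrier ?M" "y \<in> carrier ?M" "z \<in> carrier ?M" for x y z
      using Q.M.a_assoc[OF that[THEN sub]] by simp
    show "\<zero>\<^bsub>?M\<^esub> \<oplus>\<^bsub>?M\<^esub> x = x" if "x \<in> carrier ?M" for x
      using Q.M.l_zero[OF sub[OF that]] by simp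
    show "x \<oplus>\<^bsub>?M\<^esub> y = y \<oplus>\<^bsub>?M\<^esub> x" if "x \<in> carrier ?M" "y \<in> carrier ?M" for x y
      using Q.M.a_comm[OF that[THEN sub]] by simp
  qed
  let ?P = "\<lambda>B x c. c ` B \<subseteq> polys Z \<and> (\<forall>b. b \<notin> B \<longrightarrow> c b = 0) \<and> finite {b. c b \<noteq> 0} \<and>
        x = finsum ?M (\<lambda>b. c b \<odot>\<^bsub>?M\<^esub> b) {b. c b \<noteq> 0}"
  from free[unfolded free_module_def poly_ring_simps]
  obtain B where B: "B \<subseteq> carrier ?M" and unique: "\<forall>x\<in>carrier ?M. \<exists>!c. ?P B x c"
    by (elim exE conjE) (rule that)
  have pM: "cls p \<in> carrier ?M" unfolding carr using polys_closed(2) by (auto intro!: exI[of _ 1])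
  obtain c where c: "?P B (cls p) c" using ex1_implies_ex[OF bspec[OF unique pM]] by (rule exE)
  have "{b. c b \<noteq> 0} \<noteq> {}"
  proof
    assume empty: "{b. c b \<noteq> 0} = {}"
    have "cls p = \<zero>\<^bsub>?M\<^esub>" using c unfolding empty abelian_monoid.finsum_empty[OF M] by (elim conjE)
    then show False using cls_eq_zero_iff[OF p(1)] p(2) by (simp add: Q_zero)
  qed
  then obtain b where "c b \<noteq> 0" by blast
  moreover have "\<forall>b. b \<notin> B \<longrightarrow> c b = 0" using c by (elim conjE)
  ultimately have b: "b \<in> B" by blast
  then obtain g where g: "b = cls (g * p)" "g \<in> polys Z" using B unfolding carr by blast
  have fb: "f \<odot>\<^bsub>?M\<^esub> b = U"
  proof -
    have "f \<odot>\<^bsub>?M\<^esub> b = cls (f * (g * p))"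
      using Q_smult[OF polys_sub[OF Z f(1)] gp[OF g(2)]] g(1) by simp
    moreover have "f * (g * p) = g * (f * p)" by (simp add: mult.left_commute)
    moreover have "g * (f * p) \<in> U" using ideal_in_mult[OF U polys_sub[OF Z g(2)] f(2)] .
    ultimately show ?thesis using cls_eq_zero_iff[of "g * (f * p)"] UV by auto
  qed
  have "?P B U (\<lambda>_. 0)"
    using polys_closed(1) abelian_monoid.finsum_empty[OF M] by (auto simp: Q_zero)
  moreover have "?P B U ((\<lambda>_. 0)(b := f))"
  proof -
    \<comment> \<open>The expansion \<open>f b\<close> of zero, with support \<open>{b}\<close>.\<close>
    have supp: "{b'. ((\<lambda>_. 0)(b := f)) b' \<noteq> 0} = {b}" using \<open>f \<noteq> 0\<close> by auto
    have "finsum ?M (\<lambda>b'. ((\<lambda>_. 0)(b := f)) b' \<odot>\<^bsub>?M\<^esub> b') {b} = f \<odot>\<^bsub>?M\<^esub> b"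
    proof -
      interpret M: abelian_monoid ?M by (rule M)
      have "finsum ?M (\<lambda>b'. ((\<lambda>_. 0)(b := f)) b' \<odot>\<^bsub>?M\<^esub> b') (insert b {}) =
          (((\<lambda>_. 0)(b := f)) b \<odot>\<^bsub>?M\<^esub> b) \<oplus>\<^bsub>?M\<^esub> finsum ?M (\<lambda>b'. ((\<lambda>_. 0)(b := f)) b' \<odot>\<^bsub>?M\<^esub> b') {}"
        by (rule M.finsum_insert) (use fb zero in auto)
      then show ?thesis using fb zero M.r_zero[of U] by simp
    qed
    then show ?thesis unfolding supp fb using f(1) b polys_closed(1) by auto
  qed
  ultimately have "(\<lambda>_. 0) = (\<lambda>_. 0)(b := f)" by (rule ex1_eq[OF bspec[OF unique zero]])
  then show False using \<open>f \<noteq> 0\<close> by (metis fun_upd_same)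
qed

lemma finsum_cls:
  assumes "finite A" "\<And>i. i \<in> A \<Longrightarrow> g i \<in> V"
  shows "finsum Q (\<lambda>i. cls (g i)) A = cls (sum g A)"
  using assms
proof (induction A rule: finite_induct)
  case empty
  interpret Q: plain_module R Q by (rule module_Q)
  show ?case
    using cls_eq_zero_iff[OF ideal_in_zero[OF V]] ideal_in_zero[OF U] by (simp add: Q_zero)
next
  case (insert i A)
  interpret Q: plain_module R Q by (rule module_Q)
  have "sum g A \<in> V" using insert.prems by (intro sum_mem[OF ideal_in_zero[OF V] ideal_in_add[OF V]]) auto
  then show ?case
    using insert by (simp add: Q.M.finsum_insert Q_carrier Pi_iff Q_add)
qed

end

text \<open>A Stanley decomposition may contain generators that are zero in \<open>V/U\<close>; the index set \<open>J\<close>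
  discards them. The other generators are classes of monomials \<open>t k\<close>, and by freeness the cone at
  \<open>t k\<close> does not meet \<open>U\<close>. A monomial in two cones would have two decompositions, and comparing the
  coefficient of a monomial outside \<open>U\<close> with that in its decomposition shows that it lies in some cone.\<close>

lemma cone_partition_of_stanley_decomposition:
  fixes U V :: "'k::field mpoly set"
  assumes fin: "finite X" and VF: "V = support_ideal X \<F>" and UF: "U = support_ideal X \<G>" and UV: "U \<subseteq> V"
    and dec: "stanley_decomposition X (quot_module (ideal_module (poly_ring X) V) U)
      (quot_grading (ideal_module (poly_ring X) V) U (ideal_grading V)) D"
  shows "\<exists>E. cone_partition X E (support_exponents X \<F> - support_exponents X \<G>) \<and>
    (\<forall>(t, Z)\<in>E. sdepth_of_decomposition D \<le> enat (card Z))"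
proof -
  have idV: "ideal_in (polys X) V" and idU: "ideal_in (polys X) U"
    unfolding VF UF by (rule ideal_in_support_ideal)+
  interpret ideal_quotient X V U by (rule ideal_quotient.intro[OF fin idV idU UV])
  interpret Q: plain_module R Q by (rule module_Q)
  let ?A = "support_exponents X \<F>" and ?B = "support_exponents X \<G>"
  define len where "len = length D"
  define u where "u k = fst (D ! k)" for k
  define Z where "Z k = snd (D ! k)" for k
  note spaces = dec[unfolded stanley_decomposition_def, THEN conjunct1]
    and sums = dec[unfolded stanley_decomposition_def, THEN conjunct2]
  have space: "is_stanley_space X Q (quot_grading MV U (ideal_grading V)) (u k) (Z k)" if "k < len" for k
  proof -
    have "D ! k \<in> set D" using that by (simp add: len_def)
    then have "case D ! k of (u, Z) \<Rightarrow> is_stanley_space X Q (quot_grading MV U (ideal_grading V)) u Z"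
      by (rule bspec[OF spaces])
    then show ?thesis by (simp add: u_def Z_def split_beta)
  qed
  have ZX: "Z k \<subseteq> X" if "k < len" for k using space[OF that] unfolding is_stanley_space_def by blast
  have free: "free_module (poly_ring (Z k)) (Q\<lparr>carrier := cyclic_space Q (u k) (Z k)\<rparr>)" if "k < len" for k
    using space[OF that] unfolding is_stanley_space_def by blast
  have "\<exists>t c. k < len \<longrightarrow> u k = cls (single t c) \<and> single t c \<in> V" for k
  proof (cases "k < len")
    case True
    then obtain a where "u k \<in> quot_grading MV U (ideal_grading V) a"
      using space unfolding is_stanley_space_def by blast
    then show ?thesis by (rule homogeneous_class) blast
  qed simp
  then obtain t c where tc: "\<And>k. k < len \<Longrightarrow> u k = cls (single (t k) (c k))"
      "\<And>k. k < len \<Longrightarrow> single (t k) (c k) \<in> V" by metis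
  have V_iff: "single r a \<in> V \<longleftrightarrow> a = 0 \<or> r \<in> ?A" for r and a :: 'k
    unfolding VF support_ideal_iff by simp
  have U_iff: "single r a \<in> U \<longleftrightarrow> a = 0 \<or> r \<in> ?B" for r and a :: 'k
    unfolding UF support_ideal_iff by simp
  define J where "J = {k. k < len \<and> single (t k) (c k) \<notin> U}"
  have J: "k < len" "c k \<noteq> 0" "t k \<in> ?A" if "k \<in> J" for k
    using that tc(2)[of k] unfolding J_def V_iff U_iff by auto
  have cone_sub: "r \<in> ?A - ?B" if k: "k \<in> J" and r: "r \<in> cone (t k) (Z k)" for k r
  proof -
    obtain s where s: "r = t k + s" "keys s \<subseteq> Z k" using r unfolding cone_def by blast
    have "r \<in> ?A"
      using support_exponents_add[OF J(3)[OF k], of s] s ZX[OF J(1)[OF k]] by (simp add: add.commute)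
    moreover have "r \<notin> ?B"
    proof
      assume "r \<in> ?B"
      then have "single s 1 * single (t k) (c k) \<in> U"
        unfolding mult_single using U_iff s(1) by (simp add: add.commute)
      moreover have "single (t k) (c k) \<notin> U" using k unfolding J_def by blast
      ultimately have "single s 1 = (0 :: 'k mpoly)"
        using free_cyclic_space_faithful[OF tc(2)[OF J(1)[OF k]] _ ZX[OF J(1)[OF k]] _ single_in_polys[OF s(2)]]
          free[OF J(1)[OF k]] tc(1)[OF J(1)[OF k]] by simp
      then have "lookup (single s (1::'k)) s = 0" by simp
      then show False by simp
    qed
    ultimately show ?thesis by blast
  qed
  have cspace: "cyclic_space Q (u k) (Z k) = {cls (f * single (t k) (c k)) | f. f \<in> polys (Z k)}"
    if "k < len" for k
    unfolding tc(1)[OF that] by (rule cyclic_space_cls[OF tc(2)[OF that] ZX[OF that]])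
  have mult_V: "f * single (t k) (c k) \<in> V" if "k < len" "f \<in> polys (Z k)" for f k
    using ideal_in_mult[OF idV polys_sub[OF ZX[OF that(1)] that(2)] tc(2)[OF that(1)]] .
  have sub_Q: "x \<in> carrier Q" if "k < len" "x \<in> cyclic_space Q (u k) (Z k)" for x k
    using that(2) mult_V[OF that(1)] unfolding cspace[OF that(1)] Q_carrier by blast
  have zero_in: "\<zero>\<^bsub>Q\<^esub> \<in> cyclic_space Q (u k) (Z k)" if "k < len" for k
  proof -
    have "cls (0 * single (t k) (c k)) = \<zero>\<^bsub>Q\<^esub>"
      using cls_eq_zero_iff[OF ideal_in_zero[OF idV]] ideal_in_zero[OF idU] by (simp add: Q_zero)
    then show ?thesis unfolding cspace[OF that] using polys_closed(1) by blast
  qed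
  have unique: "\<exists>!v. v \<in> (\<Pi>\<^sub>E k\<in>{..<len}. cyclic_space Q (u k) (Z k)) \<and> x = finsum Q v {..<len}"
    if "x \<in> carrier Q" for x
    using bspec[OF sums that] unfolding len_def u_def Z_def .
  have mono_in_space: "cls (single r 1) \<in> cyclic_space Q (u k) (Z k)"
    if k: "k \<in> J" and r: "r \<in> cone (t k) (Z k)" for k r
  proof -
    obtain s where s: "r = t k + s" "keys s \<subseteq> Z k" using r unfolding cone_def by blast
    have eq: "single r 1 = single s (1 / c k) * single (t k) (c k)"
      unfolding mult_single s(1) using J(2)[OF k] by (simp add: add.commute)
    show ?thesis
      unfolding cspace[OF J(1)[OF k]] mem_Collect_eq
      by (intro exI[of _ "single s (1 / c k)"] conjI single_in_polys[OF s(2)]) (simp only: eq)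
  qed
  have disjoint: "k = l" if kl: "k \<in> J" "l \<in> J" "r \<in> cone (t k) (Z k)" "r \<in> cone (t l) (Z l)" for k l r
  proof (rule ccontr)
    assume "k \<noteq> l"
    let ?x = "cls (single r 1)"
    \<comment> \<open>The decomposition of \<open>x\<close> whose only entry is \<open>x\<close> itself, placed in the \<open>k\<close>-th space.\<close>
    define v where "v k = (\<lambda>i\<in>{..<len}. if i = k then ?x else \<zero>\<^bsub>Q\<^esub>)" for k
    have v: "v k \<in> (\<Pi>\<^sub>E i\<in>{..<len}. cyclic_space Q (u i) (Z i)) \<and> ?x = finsum Q (v k) {..<len}"
      if k: "k \<in> J" "r \<in> cone (t k) (Z k)" for k
    proof
      show "v k \<in> (\<Pi>\<^sub>E i\<in>{..<len}. cyclic_space Q (u i) (Z i))"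
        unfolding v_def using mono_in_space[OF k] zero_in by (intro PiE_I) auto
      have xQ: "?x \<in> carrier Q" using sub_Q[OF J(1)[OF k(1)] mono_in_space[OF k]] .
      have "finsum Q (v k) {..<len} = finsum Q (\<lambda>i. if k = i then ?x else \<zero>\<^bsub>Q\<^esub>) {..<len}"
        by (rule Q.M.finsum_cong') (use xQ in \<open>auto simp: v_def\<close>)
      also have "\<dots> = ?x"
        by (rule Q.M.finsum_singleton) (use J(1)[OF k(1)] xQ in auto)
      finally show "?x = finsum Q (v k) {..<len}" by (rule sym)
    qed
    have xQ: "?x \<in> carrier Q" using sub_Q[OF J(1)[OF kl(1)] mono_in_space[OF kl(1,3)]] .
    have "v k = v l" using v[OF kl(1,3)] v[OF kl(2,4)] by (rule ex1_eq[OF unique[OF xQ]])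
    then have "v k k = v l k" by (rule fun_cong)
    then have "?x = \<zero>\<^bsub>Q\<^esub>" using J(1)[OF kl(1)] \<open>k \<noteq> l\<close> by (simp add: v_def)
    moreover have r: "r \<in> ?A - ?B" by (rule cone_sub[OF kl(1,3)])
    then have "single r 1 \<in> V" unfolding V_iff by simp
    ultimately have "single r 1 \<in> U" using cls_eq_zero_iff by (simp add: Q_zero)
    then show False using r unfolding U_iff by simp
  qed
  have cover: "\<exists>k\<in>J. r \<in> cone (t k) (Z k)" if r: "r \<in> ?A - ?B" for r
  proof -
    have rV: "single r 1 \<in> V" using r unfolding V_iff by simp
    then have "cls (single r 1) \<in> carrier Q" unfolding Q_carrier by blast
    from ex1_implies_ex[OF unique[OF this]]
    obtain v where v: "v \<in> (\<Pi>\<^sub>E k\<in>{..<len}. cyclic_space Q (u k) (Z k))"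
      "cls (single r 1) = finsum Q v {..<len}" by (elim exE conjE)
    have "\<exists>f. k < len \<longrightarrow> f \<in> polys (Z k) \<and> v k = cls (f * single (t k) (c k))" for k
      using PiE_mem[OF v(1), of k] cspace[of k] by (cases "k < len") auto
    then obtain f where f: "\<And>k. k < len \<Longrightarrow> f k \<in> polys (Z k)"
      "\<And>k. k < len \<Longrightarrow> v k = cls (f k * single (t k) (c k))" by metis
    let ?g = "\<lambda>k. f k * single (t k) (c k)"
    have "finsum Q v {..<len} = finsum Q (\<lambda>k. cls (?g k)) {..<len}"
      by (rule Q.M.finsum_cong') (use f mult_V in \<open>auto simp: Q_carrier\<close>)
    also have "\<dots> = cls (sum ?g {..<len})" by (rule finsum_cls) (use f(1) mult_V in auto)
    finally have "single r 1 - sum ?g {..<len} \<in> U" using v(2) cls_eq_iff by simp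
    then have "r \<notin> keys (single r 1 - sum ?g {..<len})"
      using r unfolding UF support_ideal_iff by blast
    then have "(\<Sum>k<len. lookup (?g k) r) \<noteq> 0"
      by (simp add: in_keys_iff lookup_minus lookup_sum)
    then obtain k where k: "k < len" "lookup (?g k) r \<noteq> 0" by (meson lessThan_iff sum.neutral)
    then have key: "r \<in> keys (?g k)" by (simp add: in_keys_iff)
    have cone: "r \<in> cone (t k) (Z k)" by (rule keys_times_single[OF f(1)[OF k(1)] key])
    have "single (t k) (c k) \<notin> U"
    proof
      assume "single (t k) (c k) \<in> U"
      then have "?g k \<in> U" using ideal_in_mult[OF idU polys_sub[OF ZX[OF k(1)] f(1)[OF k(1)]]] by blast
      then show False using key r unfolding UF support_ideal_iff by blast
    qed
    then have "k \<in> J" using k(1) unfolding J_def by blast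
    then show ?thesis using cone by blast
  qed
  define E where "E = (\<lambda>k. (t k, Z k)) ` J"
  have "cone_partition X E (?A - ?B)"
  proof (rule cone_partitionI)
    have "J \<subseteq> {..<len}" unfolding J_def by blast
    then show "finite E" unfolding E_def using finite_subset by blast
    show "Y \<subseteq> X" if "(s, Y) \<in> E" for s Y using that ZX J(1) unfolding E_def by blast
    show "r \<in> ?A - ?B" if e: "(s, Y) \<in> E" "r \<in> cone s Y" for s Y r
      using e cone_sub unfolding E_def by blast
    show "\<exists>s Y. (s, Y) \<in> E \<and> r \<in> cone s Y" if r: "r \<in> ?A - ?B" for r
      using cover[OF r] unfolding E_def by blast
    show "(s, Y) = (s', Y')"
      if e: "(s, Y) \<in> E" "(s', Y') \<in> E" "r \<in> cone s Y" "r \<in> cone s' Y'" for s Y s' Y' r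
    proof -
      obtain k l where kl: "k \<in> J" "l \<in> J" "(s, Y) = (t k, Z k)" "(s', Y') = (t l, Z l)"
        using e(1,2) unfolding E_def by blast
      then have "k = l" using disjoint[OF kl(1,2), of r] e(3,4) by simp
      then show ?thesis using kl(3,4) by simp
    qed
  qed
  moreover have "sdepth_of_decomposition D \<le> enat (card Y)" if e: "(s, Y) \<in> E" for s Y
  proof -
    obtain k where k: "k \<in> J" "Y = Z k" using e unfolding E_def by blast
    then have "D ! k \<in> set D" using J(1) by (simp add: len_def)
    then have "(INF (u, Z)\<in>set D. enat (card Z)) \<le> (case D ! k of (u, Z) \<Rightarrow> enat (card Z))"
      by (rule INF_lower)
    then show ?thesis unfolding sdepth_of_decomposition_def by (simp add: k(2) Z_def split_beta)
  qed
  ultimately show ?thesis by blast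
qed

text \<open>For \<open>k > 0\<close> the supremum defining the Stanley depth exceeds \<open>k - 1\<close>, so some decomposition
  attains \<open>k\<close>. For \<open>k = 0\<close> the supremum says nothing, and the partition by supports is used.
  For the zero module, whose Stanley depth is infinite, the empty partition serves.\<close>

lemma cone_partition_of_sdepth_quot:
  fixes U V :: "'k::field mpoly set"
  assumes fin: "finite X" and VF: "V = support_ideal X \<F>" and UF: "U = support_ideal X \<G>" and UV: "U \<subseteq> V"
    and k: "enat k \<le> sdepth_quot X V U"
  shows "\<exists>E. cone_partition X E (support_exponents X \<F> - support_exponents X \<G>) \<and>
    (\<forall>(t, Z)\<in>E. k \<le> card Z)"
proof -
  let ?A = "support_exponents X \<F>" and ?B = "support_exponents X \<G>"
  have idV: "ideal_in (polys X) V" and idU: "ideal_in (polys X) U"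
    unfolding VF UF by (rule ideal_in_support_ideal)+
  interpret ideal_quotient X V U by (rule ideal_quotient.intro[OF fin idV idU UV])
  consider "k = 0" | "V = U" | k' where "k = Suc k'" "V \<noteq> U" by (cases k) auto
  then show ?thesis
  proof cases
    case 1
    have "\<exists>E. cone_partition X E (?A - ?B)"
      by (rule squarefree_cone_partition[OF fin, where P = "\<lambda>F. (\<exists>G\<in>\<F>. G \<subseteq> F) \<and> \<not> (\<exists>G\<in>\<G>. G \<subseteq> F)"])
        (auto simp: support_exponents_def)
    then show ?thesis using 1 by auto
  next
    case 2
    have "r \<in> ?B" if "r \<in> ?A" for r
    proof -
      have "(single r 1 :: 'k mpoly) \<in> V" using that unfolding VF support_ideal_iff by simp
      then show ?thesis unfolding 2 UF support_ideal_iff by simp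
    qed
    then have "cone_partition X {} (?A - ?B)" by (intro cone_partitionI) auto
    then show ?thesis by blast
  next
    case 3
    obtain x where x: "x \<in> V" "x \<notin> U" using 3(2) UV by blast
    then have "cls x \<noteq> \<zero>\<^bsub>Q\<^esub>" using cls_eq_zero_iff Q_zero by simp
    then have "carrier Q \<noteq> {\<zero>\<^bsub>Q\<^esub>}" using x(1) unfolding Q_carrier by blast
    then have Sup: "sdepth_quot X V U = Sup {sdepth_of_decomposition D | D.
        stanley_decomposition X Q (quot_grading MV U (ideal_grading V)) D}" (is "_ = Sup ?S")
      unfolding sdepth_quot_def sdepth_def by simp
    have "\<exists>d\<in>?S. enat k \<le> d"
    proof (rule ccontr)
      assume neg: "\<not> (\<exists>d\<in>?S. enat k \<le> d)"
      have "d \<le> enat k'" if "d \<in> ?S" for d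
      proof -
        have "\<not> enat (Suc k') \<le> d"
        proof
          assume "enat (Suc k') \<le> d"
          then have "enat k \<le> d" using 3(1) by simp
          then have "\<exists>d\<in>?S. enat k \<le> d" using that by (rule bexI)
          with neg show False by (rule notE)
        qed
        then show ?thesis by (cases d) simp_all
      qed
      then have "Sup ?S \<le> enat k'" by (rule Sup_least)
      then have "enat k \<le> enat k'" using k unfolding Sup by (rule order_trans[rotated])
      then show False using 3(1) by simp
    qed
    then obtain D where D: "stanley_decomposition X Q (quot_grading MV U (ideal_grading V)) D"
      "enat k \<le> sdepth_of_decomposition D" by blast
    obtain E where E: "cone_partition X E (?A - ?B)"
      "\<forall>(t, Z)\<in>E. sdepth_of_decomposition D \<le> enat (card Z)"
      using cone_partition_of_stanley_decomposition[OF fin VF UF UV D(1)] by blast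
    have "k \<le> card Z" if "(t, Z) \<in> E" for t Z
    proof -
      have "sdepth_of_decomposition D \<le> enat (card Z)" using E(2) that by blast
      then have "enat k \<le> enat (card Z)" using D(2) by (rule order_trans[rotated])
      then show ?thesis by simp
    qed
    then show ?thesis using E(1) by blast
  qed
qed

section \<open>Passing from \<open>n - 1\<close> to \<open>n\<close> variables\<close>

theorem theorem2p7:
  fixes n :: nat
  assumes "n \<ge> 1"
    and "\<And>U V :: 'k::field mpoly set.
           squarefree_monomial_ideal {1..n-1} U \<Longrightarrow> squarefree_monomial_ideal {1..n-1} V \<Longrightarrow>
           U \<subseteq> V \<Longrightarrow> sdepth_quot {1..n-1} V U \<ge> depth_quot {1..n-1} V U"
  shows "\<forall>I :: 'k mpoly set. squarefree_monomial_ideal {1..n} I \<longrightarrow>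
           sdepth_ideal {1..n} I \<ge> depth_ideal {1..n} I"
proof (intro allI impI)
  fix I :: "'k mpoly set"
  define X where "X = {1..n-1}"
  have X: "finite X" "n \<notin> X" "{1..n} = insert n X" using assms(1) by (auto simp: X_def)
  assume "squarefree_monomial_ideal {1..n} I"
  then obtain \<F> where \<F>: "\<F> \<subseteq> Pow (insert n X)" and I: "I = support_ideal (insert n X) \<F>"
    unfolding X(3) using squarefree_monomial_ideal_iff[of "insert n X" I] X(1) by auto
  define U V :: "'k mpoly set" where "U = support_ideal X {F \<in> \<F>. n \<notin> F}"
    and "V = support_ideal X ((\<lambda>F. F - {n}) ` \<F>)"
  interpret squarefree_slices X n \<F> I U V
    by unfold_locales (use X \<F> in \<open>auto simp: I U_def V_def\<close>)
  have sq: "squarefree_monomial_ideal X U" "squarefree_monomial_ideal X V"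
      "squarefree_monomial_ideal X ({0} :: 'k mpoly set)"
  proof -
    have "{F \<in> \<F>. n \<notin> F} \<subseteq> Pow X" "(\<lambda>F. F - {n}) ` \<F> \<subseteq> Pow X" using \<F> by auto
    then show "squarefree_monomial_ideal X U" "squarefree_monomial_ideal X V"
      unfolding squarefree_monomial_ideal_iff[OF X(1)] U_def V_def by blast+
    show "squarefree_monomial_ideal X ({0} :: 'k mpoly set)"
      unfolding squarefree_monomial_ideal_iff[OF X(1)] by (intro exI[of _ "{}"]) (simp add: support_ideal_empty)
  qed
  have zero_U: "{0} \<subseteq> U" using ideals(2) unfolding ideal_in_def by blast
  have bound: "enat (length fs) \<le> sdepth_ideal (insert n X) I"
    if fs: "set fs \<subseteq> graded_maximal_ideal (insert n X)"
      "regular_sequence (ideal_module (poly_ring (insert n X)) I) fs" for fs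
  proof (cases "length fs")
    case 0
    then show ?thesis by (simp add: zero_enat_def[symmetric])
  next
    case (Suc e)
    have "enat e \<le> depth_quot X U {0}" "enat e \<le> depth_quot X V U"
      using depth_slices_ge[OF fs, of e] Suc by simp_all
    then have sd: "enat e \<le> sdepth_quot X U {0}" "enat e \<le> sdepth_quot X V U"
      using assms(2)[folded X_def, OF sq(3,1) zero_U] assms(2)[folded X_def, OF sq(1,2) U_sub_V]
      by (auto intro: order_trans)
    obtain EU where EU: "cone_partition X EU (support_exponents X {F \<in> \<F>. n \<notin> F} - support_exponents X {})"
        "\<forall>(t, Z)\<in>EU. e \<le> card Z"
      using cone_partition_of_sdepth_quot[OF X(1) U_def support_ideal_empty[symmetric] zero_U sd(1)] by blast
    have EU': "cone_partition X EU (support_exponents X {F \<in> \<F>. n \<notin> F})"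
      using EU(1) by (simp add: support_exponents_def)
    obtain EQ where EQ: "cone_partition X EQ (support_exponents X ((\<lambda>F. F - {n}) ` \<F>) -
          support_exponents X {F \<in> \<F>. n \<notin> F})" "\<forall>(t, Z)\<in>EQ. e \<le> card Z"
      using cone_partition_of_sdepth_quot[OF X(1) V_def U_def U_sub_V sd(2)] by blast
    \<comment> \<open>Adjoining \<open>x\<^sub>n\<close> raises every dimension by one.\<close>
    have card: "Suc e \<le> card (insert n Z)" if "Z \<subseteq> X" "e \<le> card Z" for Z
      using that X(1,2) finite_subset[OF that(1) X(1)] by (auto simp: card_insert_if)
    have "enat (Suc e) \<le> sdepth_ideal (insert n X) I"
    proof (rule sdepth_ideal_ge[OF I combine_cone_partitions[OF EU' EQ(1)]])
      fix t Z assume "(t, Z) \<in> (\<lambda>(t, Z). (t, insert n Z)) ` EU \<union>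
        (\<lambda>(t, Z). (t + single n 1, insert n Z)) ` EQ"
      then obtain t' Z' where Z': "(t', Z') \<in> EU \<or> (t', Z') \<in> EQ" "Z = insert n Z'" by auto
      have "Z' \<subseteq> X"
        using Z'(1) cone_partition_sub[OF EU(1), of t' Z'] cone_partition_sub[OF EQ(1), of t' Z'] by (elim disjE)
      moreover have "e \<le> card Z'"
        using Z'(1) bspec[OF EU(2), of "(t', Z')"] bspec[OF EQ(2), of "(t', Z')"] by auto
      ultimately show "Suc e \<le> card Z" unfolding Z'(2) by (rule card)
    qed
    then show ?thesis using Suc by simp
  qed
  show "sdepth_ideal {1..n} I \<ge> depth_ideal {1..n} I"
  proof (cases "I = {0}")
    case True
    then show ?thesis by (simp add: sdepth_ideal_def sdepth_def)
  next
    case False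
    then have "depth_ideal (insert n X) I = Sup {enat (length fs) | fs.
        set fs \<subseteq> graded_maximal_ideal (insert n X) \<and>
        regular_sequence (ideal_module (poly_ring (insert n X)) I) fs}"
      by (simp add: depth_ideal_def depth_def depth_wrt_def)
    also have "\<dots> \<le> sdepth_ideal (insert n X) I"
      by (rule Sup_least) (use bound in blast)
    finally show ?thesis unfolding X(3) .
  qed
qed

end
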